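(* Let $n\ge 1$, $\mathfrak g=\mathfrak{sl}_{n+1}(\mathbb C)$, and let $\mathbf i_0=(1,2,\ldots,n,\,1,2,\ldots,n-1,\,\ldots,\,1,2,3,\,1,2,\,1)$. For every dominant integral weight $\lambda=\sum_{i=1}^n\lambda_i\Lambda_i$ ($\lambda_i\in\mathbb Z_{\ge0}$) there is an isomorphism of crystals $B_{f_B,\Theta^-_{\mathbf i_0}}(\lambda)\cong\Sigma_{\iota_0}[\lambda]$, where $B_{f_B,\Theta^-_{\mathbf i_0}}(\lambda)$ is the crystal obtained by ultra-discretization of the decorated geometric crystal on $TB^-_{w_0}$ and $\Sigma_{\iota_0}[\lambda]$ is the polyhedral realization crystal associated with $\iota_0=\mathbf i_0^{-1}$ (the word $\mathbf i_0$ written in the opposite order).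
   Context: Notation. $I=\{1,\dots,n\}$, $(a_{ij})$ is the Cartan matrix of type $A_n$ with $a_{ij}=\langle h_i,\alpha_j\rangle$, $\Lambda_i$ are the fundamental weights, $N=n(n+1)/2$. $G=SL_{n+1}(\mathbb C)$, $T$ the maximal torus, $U=U^+$ and $U^-$ the unipotent radicals of the opposite Borel subgroups $B^+,B^-\supset T$, $x_i(c)=\exp(ce_i)$, $y_i(c)=\exp(cf_i)$, $\alpha_i^\vee(c)$ the simple coroot, $\overline s_i=x_i(-1)y_i(1)x_i(-1)$, $\overline w=\overline s_{j_1}\cdots\overline s_{j_l}$ for a reduced expression $w=s_{j_1}\cdots s_{j_l}$, and $w_0$ the longest Weyl group element. Decoration. $\chi_i:U\to\mathbb C$ is the additive character with $\chi_i(x_j(c))=\delta_{ij}c$; $\chi^{st}=\sum_i\chi_i$; $\pi^+:B^-U\to U$, $\pi^+(bu)=u$; $\eta:G\to G$ is the anti-automorphism with $\eta(x_i(c))=x_i(c)$, $\eta(y_i(c))=y_i(c)$, $\eta(t)=t^{-1}$ ($t\in T$). Put $f_B(g)=\chi^{st}(\pi^+(\overline w_0^{-1}g))+\chi^{st}(\pi^+(\overline w_0^{-1}\eta(g)))$. Parametrization. Write $\mathbf i_0=(i_1,\dots,i_N)$ and $\Theta^-_{\mathbf i_0}(c)=\mathbf y_{i_1}(c_1)\cdots\mathbf y_{i_N}(c_N)$ with $\mathbf y_i(c)=y_i(c)\alpha_i^\vee(c^{-1})$. The coordinates are also double-indexed as $(c_{1,1},\dots,c_{1,n},c_{2,1},\dots,c_{2,n-1},\dots,c_{n-1,1},c_{n-1,2},c_{n,1})=(c_1,\dots,c_N)$,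 so that $c_{k,l}$ belongs to a letter $l$. The crystal $B_{f_B,\Theta^-_{\mathbf i_0}}(\lambda)$. The function $f_B(t\Theta^-_{\mathbf i_0}(c))$ depends on $t\in T$ only through $\alpha_1(t),\dots,\alpha_n(t)$: $f_B(t\Theta^-_{\mathbf i_0}(c))=F(\alpha_1(t),\dots,\alpha_n(t),c)$ with $F$ a positive (subtraction-free) function. Its ultra-discretization $\mathcal{UD}(F)$ is obtained by replacing $(\cdot,/,+)$ by $(+,-,\min)$. As a set, $B_{f_B,\Theta^-_{\mathbf i_0}}(\lambda)=\{x\in\mathbb Z^N:\mathcal{UD}(F)(\lambda_1,\dots,\lambda_n,x)\ge0\}$ (the value $\mathcal{UD}(\alpha_j(t))$ is identified with $\lambda_j$). Its crystal structure is: $\mathrm{wt}(x)=\lambda-\sum_kx_k\alpha_{i_k}$, $\varepsilon_i(x)=\max_{m:\,i_m=i}\bigl(x_m+\sum_{k>m}a_{i_k,i}x_k\bigr)$, $\varphi_i(x)=\langle h_i,\mathrm{wt}(x)\rangle+\varepsilon_i(x)$; with $X_m=x_m+\sum_{k<m}a_{i_k,i}x_k$ for $i_m=i$ and $M$ the set of those $m$ (with $i_m=i$) at which $X_m$ is minimal, $\tilde e_i(x)$ is obtained from $x$ by subtracting $1$ from $x_{\max M}$ and $\tilde f_i(x)$ by adding $1$ to $x_{\min M}$, if the result lies in the set, and is $0$ otherwise. The crystal $\Sigma_{\iota_0}[\lambda]$. As a set it consists of all integer families $(x_{j;i})_{j,i\ge1,\ i+j\le n+1}$ such that $x_{1;i}\ge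 x_{2;i-1}\ge\cdots\ge x_{i;1}\ge0$ for $1\le i\le n$, and $\lambda_i\ge x_{j;i-j+1}-x_{j;i-j}$ for $1\le j\le i\le n$ (with $x_{j;0}=0$). Its crystal structure is the one induced from $\mathbb Z^\infty_\iota[\lambda]$: extend $x$ by $x_{j;i}=0$ for all other $(j;i)\in\mathbb Z_{\ge1}\times I$, order the index set $\mathbb Z_{\ge1}\times I$ lexicographically, and put $\sigma_{(j;i)}(x)=x_{j;i}+\sum_{(j';i')>(j;i)}\langle h_i,\alpha_{i'}\rangle x_{j';i'}$, $\sigma^{(i)}_0(x)=-\langle h_i,\lambda\rangle+\sum_{(j';i')}\langle h_i,\alpha_{i'}\rangle x_{j';i'}$, $\sigma^{(i)}(x)=\max_{j}\sigma_{(j;i)}(x)$, $M^{(i)}=\{(j;i):\sigma_{(j;i)}(x)=\sigma^{(i)}(x)\}$. Then $\mathrm{wt}(x)=\lambda-\sum x_{j;i}\alpha_i$, $\varepsilon_i(x)=\max(\sigma^{(i)}(x),\sigma_0^{(i)}(x))$, $\varphi_i(x)=\langle h_i,\mathrm{wt}(x)\rangle+\varepsilon_i(x)$; $\tilde f_i$ adds $1$ at position $\min M^{(i)}$ if $\sigma^{(i)}(x)>\sigma^{(i)}_0(x)$ and is $0$ otherwise; $\tilde e_i$ subtracts $1$ at position $\max M^{(i)}$ if $\sigma^{(i)}(x)>0$ and $\sigma^{(i)}(x)\ge\sigma^{(i)}_0(x)$, and is $0$ otherwise. *)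

theory Defs
  imports
    "HOL-Algebra.Group"
    "HOL-Combinatorics.Transposition"
    "Jordan_Normal_Form.Determinant"
    Complex_Main
begin

section \<open>Root datum of type A and the word \<open>i_0\<close>\<close>

text \<open>The index set \<open>I\<close> is \<^term>\<open>{1..n}\<close>. A weight is given by its coefficients
  with respect to the fundamental weights, i.e. as \<open>\<mu> :: nat \<Rightarrow> int\<close> with
  \<open>\<mu> i = \<langle>h_i, \<mu>\<rangle>\<close> for \<open>i \<in> I\<close>, and \<open>0\<close> for \<open>i \<notin> I\<close>.\<close>

type_synonym weight = "nat \<Rightarrow> int"

definition cartan :: "nat \<Rightarrow> nat \<Rightarrow> int" where
  "cartan i j = (if i = j then 2 else if i = Suc j \<or> j = Suc i then -1 else 0)"

definition weight_of :: "nat \<Rightarrow> (nat \<Rightarrow> int) \<Rightarrow> weight" where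
  "weight_of n lam = (\<lambda>i. if i \<in> {1..n} then lam i else 0)"

definition simple_root :: "nat \<Rightarrow> nat \<Rightarrow> weight" where
  "simple_root n j = (\<lambda>i. if i \<in> {1..n} then cartan i j else 0)"

text \<open>\<open>(1,...,n, 1,...,n-1, ..., 1,2, 1)\<close>\<close>

primrec word_i0 :: "nat \<Rightarrow> nat list" where
  "word_i0 0 = []"
| "word_i0 (Suc n) = [1..<Suc (Suc n)] @ word_i0 n"

text \<open>The next two lemmas show that \<^const>\<open>word_i0\<close> is a reduced word of the longest element of
  the Weyl group \<open>S_{n+1}\<close> (acting on \<open>{0..n}\<close>): it has as many letters as there are positive
  roots, and the product of the corresponding simple reflections reverses \<open>{0..n}\<close>.\<close>

lemma length_word_i0: "length (word_i0 n) = n * (n + 1) div 2"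
  by (induction n) auto

definition weyl_word :: "nat list \<Rightarrow> nat \<Rightarrow> nat" where
  "weyl_word is = foldr (\<lambda>i w. transpose (i - 1) i \<circ> w) is id"

lemma weyl_word_append: "weyl_word (xs @ ys) = weyl_word xs \<circ> weyl_word ys"
  by (induction xs) (auto simp: weyl_word_def comp_assoc)

lemma weyl_word_upt:
  "weyl_word [1..<Suc m] p = (if p < m then Suc p else if p = m then 0 else p)"
proof (induction m arbitrary: p)
  case 0
  then show ?case by (simp add: weyl_word_def)
next
  case (Suc m)
  have "weyl_word [1..<Suc (Suc m)] p = weyl_word [1..<Suc m] (transpose m (Suc m) p)"
    by (simp add: weyl_word_append) (simp add: weyl_word_def)
  then show ?case
    by (simp only: Suc.IH) (auto simp: transpose_def)
qed

lemma weyl_word_i0: "weyl_word (word_i0 n) p = (if p \<le> n then n - p else p)"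
proof (induction n arbitrary: p)
  case 0
  then show ?case by (simp add: weyl_word_def)
next
  case (Suc n)
  have "weyl_word (word_i0 (Suc n)) p = weyl_word [1..<Suc (Suc n)] (weyl_word (word_i0 n) p)"
    by (simp only: word_i0.simps weyl_word_append comp_apply)
  then show ?case
    by (simp only: Suc.IH weyl_word_upt) auto
qed


section \<open>The group \<open>SL_{n+1}(\<complex>)\<close>\<close>

text \<open>Matrices have rows and columns \<open>0,...,n\<close>, so that the root vectors \<open>e_i\<close>, \<open>f_i\<close>
  (\<open>1 \<le> i \<le> n\<close>) have their nonzero entry at \<open>(i-1,i)\<close> and \<open>(i,i-1)\<close> respectively.\<close>

definition SL :: "nat \<Rightarrow> complex mat monoid" where
  "SL n = \<lparr>carrier = {g \<in> carrier_mat (Suc n) (Suc n). det g = 1},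
           mult = (*), one = 1\<^sub>m (Suc n)\<rparr>"

definition torus :: "nat \<Rightarrow> complex mat set" where
  "torus n = {g \<in> carrier (SL n). diagonal_mat g}"

definition borel_minus :: "nat \<Rightarrow> complex mat set" where
  "borel_minus n = {g \<in> carrier (SL n). upper_triangular (transpose_mat g)}"

definition unip_plus :: "nat \<Rightarrow> complex mat set" where
  "unip_plus n = {g \<in> carrier (SL n). upper_triangular g \<and> (\<forall>p\<le>n. g $$ (p,p) = 1)}"

definition mat_exp :: "complex mat \<Rightarrow> complex mat" where
  "mat_exp A = mat (dim_row A) (dim_row A) (\<lambda>(p,q). \<Sum>k. (A ^\<^sub>m k) $$ (p,q) / fact k)"

definition e_mat :: "nat \<Rightarrow> nat \<Rightarrow> complex mat" where
  "e_mat n i = mat (Suc n) (Suc n) (\<lambda>(p,q). if p = i - 1 \<and> q = i then 1 else 0)"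

definition f_mat :: "nat \<Rightarrow> nat \<Rightarrow> complex mat" where
  "f_mat n i = mat (Suc n) (Suc n) (\<lambda>(p,q). if p = i \<and> q = i - 1 then 1 else 0)"

definition x_elt :: "nat \<Rightarrow> nat \<Rightarrow> complex \<Rightarrow> complex mat" where
  "x_elt n i c = mat_exp (c \<cdot>\<^sub>m e_mat n i)"

definition y_elt :: "nat \<Rightarrow> nat \<Rightarrow> complex \<Rightarrow> complex mat" where
  "y_elt n i c = mat_exp (c \<cdot>\<^sub>m f_mat n i)"

definition coroot :: "nat \<Rightarrow> nat \<Rightarrow> complex \<Rightarrow> complex mat" where
  "coroot n i c =
     mat_diag (Suc n) (\<lambda>p. if p = i - 1 then c else if p = i then inverse c else 1)"

text \<open>The simple root \<open>\<alpha>_i\<close> as a character of the torus.\<close>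

definition root_char :: "nat \<Rightarrow> complex mat \<Rightarrow> complex" where
  "root_char i t = t $$ (i - 1, i - 1) / t $$ (i, i)"

definition mat_prod :: "nat \<Rightarrow> complex mat list \<Rightarrow> complex mat" where
  "mat_prod n gs = foldr (*) gs (1\<^sub>m (Suc n))"

definition s_bar :: "nat \<Rightarrow> nat \<Rightarrow> complex mat" where
  "s_bar n i = x_elt n i (-1) * y_elt n i 1 * x_elt n i (-1)"

definition w0_bar :: "nat \<Rightarrow> complex mat" where
  "w0_bar n = mat_prod n (map (s_bar n) (word_i0 n))"


section \<open>The decoration\<close>

text \<open>Additivity and the values on the \<open>x_j(c)\<close>, which generate \<open>U\<close>, determine \<open>\<chi>_i\<close> on \<open>U\<close>;
  likewise \<open>\<eta>\<close> is determined on \<open>SL_{n+1}\<close>. The choice operator below only affects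
  irrelevant values outside \<open>U\<close> and \<open>SL_{n+1}\<close> respectively.\<close>

definition is_char :: "nat \<Rightarrow> nat \<Rightarrow> (complex mat \<Rightarrow> complex) \<Rightarrow> bool" where
  "is_char n i \<chi> \<longleftrightarrow>
     (\<forall>u\<in>unip_plus n. \<forall>v\<in>unip_plus n. \<chi> (u * v) = \<chi> u + \<chi> v) \<and>
     (\<forall>j\<in>{1..n}. \<forall>c. \<chi> (x_elt n j c) = (if i = j then c else 0))"

definition chi :: "nat \<Rightarrow> nat \<Rightarrow> complex mat \<Rightarrow> complex" where
  "chi n i = (SOME \<chi>. is_char n i \<chi>)"

definition chi_st :: "nat \<Rightarrow> complex mat \<Rightarrow> complex" where
  "chi_st n u = (\<Sum>i\<in>{1..n}. chi n i u)"

definition pi_plus :: "nat \<Rightarrow> complex mat \<Rightarrow> complex mat" where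
  "pi_plus n g = (THE u. u \<in> unip_plus n \<and> (\<exists>b\<in>borel_minus n. g = b * u))"

definition is_eta :: "nat \<Rightarrow> (complex mat \<Rightarrow> complex mat) \<Rightarrow> bool" where
  "is_eta n \<eta> \<longleftrightarrow>
     bij_betw \<eta> (carrier (SL n)) (carrier (SL n)) \<and>
     (\<forall>g\<in>carrier (SL n). \<forall>h\<in>carrier (SL n). \<eta> (g * h) = \<eta> h * \<eta> g) \<and>
     (\<forall>i\<in>{1..n}. \<forall>c. \<eta> (x_elt n i c) = x_elt n i c \<and> \<eta> (y_elt n i c) = y_elt n i c) \<and>
     (\<forall>t\<in>torus n. \<eta> t = inv\<^bsub>SL n\<^esub> t)"

definition eta :: "nat \<Rightarrow> complex mat \<Rightarrow> complex mat" where
  "eta n = (SOME \<eta>. is_eta n \<eta>)"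

definition f_B :: "nat \<Rightarrow> complex mat \<Rightarrow> complex" where
  "f_B n g = chi_st n (pi_plus n (inv\<^bsub>SL n\<^esub> (w0_bar n) * g))
           + chi_st n (pi_plus n (inv\<^bsub>SL n\<^esub> (w0_bar n) * eta n g))"

definition Theta_minus :: "nat \<Rightarrow> complex list \<Rightarrow> complex mat" where
  "Theta_minus n cs =
     mat_prod n (map2 (\<lambda>i c. y_elt n i c * coroot n i (inverse c)) (word_i0 n) cs)"


section \<open>Subtraction-free functions and ultra-discretization\<close>

text \<open>Positive rational constants are built from \<open>Unit\<close>; their ultra-discretization is \<open>0\<close>.\<close>

datatype 'v sfree =
    Var 'v
  | Unit
  | Add "'v sfree" "'v sfree"
  | Mul "'v sfree" "'v sfree"
  | Div "'v sfree" "'v sfree"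

primrec sf_eval :: "('v \<Rightarrow> 'a::field) \<Rightarrow> 'v sfree \<Rightarrow> 'a" where
  "sf_eval \<rho> (Var v) = \<rho> v"
| "sf_eval \<rho> Unit = 1"
| "sf_eval \<rho> (Add E F) = sf_eval \<rho> E + sf_eval \<rho> F"
| "sf_eval \<rho> (Mul E F) = sf_eval \<rho> E * sf_eval \<rho> F"
| "sf_eval \<rho> (Div E F) = sf_eval \<rho> E / sf_eval \<rho> F"

text \<open>No denominator vanishes at \<open>\<rho>\<close>.\<close>

primrec sf_defined :: "('v \<Rightarrow> 'a::field) \<Rightarrow> 'v sfree \<Rightarrow> bool" where
  "sf_defined \<rho> (Var v) \<longleftrightarrow> True"
| "sf_defined \<rho> Unit \<longleftrightarrow> True"
| "sf_defined \<rho> (Add E F) \<longleftrightarrow> sf_defined \<rho> E \<and> sf_defined \<rho> F"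
| "sf_defined \<rho> (Mul E F) \<longleftrightarrow> sf_defined \<rho> E \<and> sf_defined \<rho> F"
| "sf_defined \<rho> (Div E F) \<longleftrightarrow> sf_defined \<rho> E \<and> sf_defined \<rho> F \<and> sf_eval \<rho> F \<noteq> 0"

primrec sf_ud :: "('v \<Rightarrow> int) \<Rightarrow> 'v sfree \<Rightarrow> int" where
  "sf_ud \<rho> (Var v) = \<rho> v"
| "sf_ud \<rho> Unit = 0"
| "sf_ud \<rho> (Add E F) = min (sf_ud \<rho> E) (sf_ud \<rho> F)"
| "sf_ud \<rho> (Mul E F) = sf_ud \<rho> E + sf_ud \<rho> F"
| "sf_ud \<rho> (Div E F) = sf_ud \<rho> E - sf_ud \<rho> F"

text \<open>The variables of \<open>F(\<alpha>_1(t),...,\<alpha>_n(t),c_1,...,c_N)\<close>. Positions in the word are counted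
  from \<open>0\<close>, so \<open>Coord k\<close> stands for \<open>c_{k+1}\<close>.\<close>

datatype param = Root nat | Coord nat

primrec param_val :: "(nat \<Rightarrow> 'a) \<Rightarrow> 'a list \<Rightarrow> param \<Rightarrow> 'a" where
  "param_val a c (Root j) = a j"
| "param_val a c (Coord k) = c ! k"

definition represents_f_B :: "nat \<Rightarrow> param sfree \<Rightarrow> bool" where
  "represents_f_B n F \<longleftrightarrow>
     set_sfree F \<subseteq> Root ` {1..n} \<union> Coord ` {..<length (word_i0 n)} \<and>
     (\<forall>t\<in>torus n. \<forall>c. length c = length (word_i0 n) \<longrightarrow> 0 \<notin> set c \<longrightarrow>
        sf_defined (param_val (\<lambda>j. root_char j t) c) F \<longrightarrow>
        f_B n (t * Theta_minus n c) = sf_eval (param_val (\<lambda>j. root_char j t) c) F)"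

text \<open>The ultra-discretization depends only on the rational function and not on the chosen
  subtraction-free expression for it.\<close>

definition UD_f_B :: "nat \<Rightarrow> (nat \<Rightarrow> int) \<Rightarrow> int list \<Rightarrow> int" where
  "UD_f_B n lam x = sf_ud (param_val lam x) (SOME F. represents_f_B n F)"


section \<open>Crystals\<close>

text \<open>The element \<open>0\<close> is represented by \<^const>\<open>None\<close>.\<close>

record 'b crystal =
  cr_set :: "'b set"
  cr_wt :: "'b \<Rightarrow> weight"
  cr_eps :: "nat \<Rightarrow> 'b \<Rightarrow> int"
  cr_phi :: "nat \<Rightarrow> 'b \<Rightarrow> int"
  cr_e :: "nat \<Rightarrow> 'b \<Rightarrow> 'b option"
  cr_f :: "nat \<Rightarrow> 'b \<Rightarrow> 'b option"

definition crystal_isomorphism ::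
    "nat set \<Rightarrow> ('b, 'r) crystal_scheme \<Rightarrow> ('c, 's) crystal_scheme \<Rightarrow> ('b \<Rightarrow> 'c) \<Rightarrow> bool" where
  "crystal_isomorphism I B C \<Psi> \<longleftrightarrow>
     bij_betw \<Psi> (cr_set B) (cr_set C) \<and>
     (\<forall>b\<in>cr_set B.
        cr_wt C (\<Psi> b) = cr_wt B b \<and>
        (\<forall>i\<in>I. cr_eps C i (\<Psi> b) = cr_eps B i b \<and>
               cr_phi C i (\<Psi> b) = cr_phi B i b \<and>
               cr_e C i (\<Psi> b) = map_option \<Psi> (cr_e B i b) \<and>
               cr_f C i (\<Psi> b) = map_option \<Psi> (cr_f B i b)))"

definition crystal_isomorphic ::
    "nat set \<Rightarrow> ('b, 'r) crystal_scheme \<Rightarrow> ('c, 's) crystal_scheme \<Rightarrow> bool" where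
  "crystal_isomorphic I B C \<longleftrightarrow> (\<exists>\<Psi>. crystal_isomorphism I B C \<Psi>)"


section \<open>The crystal obtained by ultra-discretization\<close>

definition B_set :: "nat \<Rightarrow> (nat \<Rightarrow> int) \<Rightarrow> int list set" where
  "B_set n lam = {x. length x = length (word_i0 n) \<and> UD_f_B n lam x \<ge> 0}"

definition positions :: "nat \<Rightarrow> nat \<Rightarrow> nat set" where
  "positions n i = {m. m < length (word_i0 n) \<and> word_i0 n ! m = i}"

definition B_wt :: "nat \<Rightarrow> (nat \<Rightarrow> int) \<Rightarrow> int list \<Rightarrow> weight" where
  "B_wt n lam x = (\<lambda>i. weight_of n lam i
     - (\<Sum>k<length (word_i0 n). x ! k * simple_root n (word_i0 n ! k) i))"

definition B_eps :: "nat \<Rightarrow> nat \<Rightarrow> int list \<Rightarrow> int" where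
  "B_eps n i x = Max ((\<lambda>m. x ! m +
     (\<Sum>k\<in>{m<..<length (word_i0 n)}. cartan (word_i0 n ! k) i * x ! k)) ` positions n i)"

definition B_X :: "nat \<Rightarrow> nat \<Rightarrow> int list \<Rightarrow> nat \<Rightarrow> int" where
  "B_X n i x m = x ! m + (\<Sum>k<m. cartan (word_i0 n ! k) i * x ! k)"

definition B_M :: "nat \<Rightarrow> nat \<Rightarrow> int list \<Rightarrow> nat set" where
  "B_M n i x = {m \<in> positions n i. B_X n i x m = Min (B_X n i x ` positions n i)}"

definition B_e :: "nat \<Rightarrow> (nat \<Rightarrow> int) \<Rightarrow> nat \<Rightarrow> int list \<Rightarrow> int list option" where
  "B_e n lam i x = (let m = Max (B_M n i x); x' = x[m := x ! m - 1]
                    in if x' \<in> B_set n lam then Some x' else None)"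

definition B_f :: "nat \<Rightarrow> (nat \<Rightarrow> int) \<Rightarrow> nat \<Rightarrow> int list \<Rightarrow> int list option" where
  "B_f n lam i x = (let m = Min (B_M n i x); x' = x[m := x ! m + 1]
                    in if x' \<in> B_set n lam then Some x' else None)"

definition B_crystal :: "nat \<Rightarrow> (nat \<Rightarrow> int) \<Rightarrow> int list crystal" where
  "B_crystal n lam =
     \<lparr>cr_set = B_set n lam,
      cr_wt = B_wt n lam,
      cr_eps = B_eps n,
      cr_phi = (\<lambda>i x. B_wt n lam x i + B_eps n i x),
      cr_e = B_e n lam,
      cr_f = B_f n lam\<rparr>"


section \<open>The polyhedral realization\<close>

text \<open>A family \<open>(x_{j;i})\<close> is a function of \<open>(j,i)\<close>, extended by \<open>0\<close> to all pairs.\<close>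

type_synonym family = "nat \<times> nat \<Rightarrow> int"

definition Sigma_set :: "nat \<Rightarrow> (nat \<Rightarrow> int) \<Rightarrow> family set" where
  "Sigma_set n lam = {x.
     (\<forall>j i. \<not> (j \<ge> 1 \<and> i \<ge> 1 \<and> i + j \<le> n + 1) \<longrightarrow> x (j,i) = 0) \<and>
     (\<forall>i\<in>{1..n}. (\<forall>k\<in>{1..<i}. x (k, i + 1 - k) \<ge> x (k + 1, i - k)) \<and> x (i,1) \<ge> 0) \<and>
     (\<forall>i\<in>{1..n}. \<forall>j\<in>{1..i}. lam i \<ge> x (j, i - j + 1) - x (j, i - j))}"

definition lex_less :: "nat \<times> nat \<Rightarrow> nat \<times> nat \<Rightarrow> bool" where
  "lex_less p q \<longleftrightarrow> fst p < fst q \<or> (fst p = fst q \<and> snd p < snd q)"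

text \<open>The sums over all index pairs are restricted to the finite range \<open>{1..n} \<times> {1..n}\<close>, outside
  of which the families vanish.\<close>

definition Sigma_sigma :: "nat \<Rightarrow> nat \<Rightarrow> family \<Rightarrow> nat \<Rightarrow> int" where
  "Sigma_sigma n i x j = x (j,i) +
     (\<Sum>p\<in>{p \<in> {1..n} \<times> {1..n}. lex_less (j,i) p}. cartan i (snd p) * x p)"

definition Sigma_sigma0 :: "nat \<Rightarrow> (nat \<Rightarrow> int) \<Rightarrow> nat \<Rightarrow> family \<Rightarrow> int" where
  "Sigma_sigma0 n lam i x = - lam i + (\<Sum>p\<in>{1..n} \<times> {1..n}. cartan i (snd p) * x p)"

text \<open>The image is finite, since \<open>\<sigma>_{(j;i)}(x) = 0\<close> for \<open>j > n\<close>.\<close>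

definition Sigma_sigma_max :: "nat \<Rightarrow> nat \<Rightarrow> family \<Rightarrow> int" where
  "Sigma_sigma_max n i x = Max (Sigma_sigma n i x ` {1..})"

text \<open>All elements of \<open>M^{(i)}\<close> have second component \<open>i\<close>, so only the first ones are recorded;
  the lexicographic order on \<open>M^{(i)}\<close> becomes the order of these. The set can be infinite (when
  \<open>\<sigma>^{(i)}(x) = 0\<close>), so its minimum is taken with \<open>LEAST\<close>; its maximum is needed only when
  \<open>\<sigma>^{(i)}(x) > 0\<close>.\<close>

definition Sigma_M :: "nat \<Rightarrow> nat \<Rightarrow> family \<Rightarrow> nat set" where
  "Sigma_M n i x = {j. j \<ge> 1 \<and> Sigma_sigma n i x j = Sigma_sigma_max n i x}"

definition Sigma_wt :: "nat \<Rightarrow> (nat \<Rightarrow> int) \<Rightarrow> family \<Rightarrow> weight" where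
  "Sigma_wt n lam x = (\<lambda>i. weight_of n lam i
     - (\<Sum>p\<in>{1..n} \<times> {1..n}. x p * simple_root n (snd p) i))"

definition Sigma_eps :: "nat \<Rightarrow> (nat \<Rightarrow> int) \<Rightarrow> nat \<Rightarrow> family \<Rightarrow> int" where
  "Sigma_eps n lam i x = max (Sigma_sigma_max n i x) (Sigma_sigma0 n lam i x)"

definition Sigma_e :: "nat \<Rightarrow> (nat \<Rightarrow> int) \<Rightarrow> nat \<Rightarrow> family \<Rightarrow> family option" where
  "Sigma_e n lam i x =
     (if Sigma_sigma_max n i x > 0 \<and> Sigma_sigma_max n i x \<ge> Sigma_sigma0 n lam i x
      then let p = (Max (Sigma_M n i x), i) in Some (x(p := x p - 1))
      else None)"

definition Sigma_f :: "nat \<Rightarrow> (nat \<Rightarrow> int) \<Rightarrow> nat \<Rightarrow> family \<Rightarrow> family option" where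
  "Sigma_f n lam i x =
     (if Sigma_sigma_max n i x > Sigma_sigma0 n lam i x
      then let p = (LEAST j. j \<in> Sigma_M n i x, i) in Some (x(p := x p + 1))
      else None)"

definition Sigma_crystal :: "nat \<Rightarrow> (nat \<Rightarrow> int) \<Rightarrow> family crystal" where
  "Sigma_crystal n lam =
     \<lparr>cr_set = Sigma_set n lam,
      cr_wt = Sigma_wt n lam,
      cr_eps = Sigma_eps n lam,
      cr_phi = (\<lambda>i x. Sigma_wt n lam x i + Sigma_eps n lam i x),
      cr_e = Sigma_e n lam,
      cr_f = Sigma_f n lam\<rparr>"

end

(* The decoration is computed explicitly. In terms of the double-indexed coordinates,
     f_B(t Theta(c)) = sum over j, l of c_{j,l} / c_{j+1,l-1} + alpha_{j+l-1}(t) c_{j,l-1} / c_{j,l}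
   with c_{j,0} = 1, so non-negativity of the ultra-discretization says termwise that
   x_{j,l} >= x_{j+1,l-1} and lambda_{j+l-1} >= x_{j,l} - x_{j,l-1}: these are the inequalities of the
   polyhedral realization, and the isomorphism is the re-indexing of coordinates.

   To compute pi^+(w^-1 X), with w the lift of w_0, one looks for a unipotent v such that X v vanishes
   strictly below the antidiagonal; then w^-1 X v lies in the lower Borel subgroup, and pi^+(w^-1 X) is
   the inverse of v. For X = Theta(c) and X = eta(Theta(c)) such a v is built by induction on n, since the
   first n letters of the word contribute a bidiagonal matrix and the remaining ones an element of the
   upper left corner SL_n. The map eta is inversion followed by conjugation with diag(1,-1,1,...).

   The ultra-discretization of a subtraction-free expression E is the order of growth of
   E(s^e_1, s^e_2, ...) as s tends to 0, hence it depends only on the values of E at positive reals.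

   On the crystal side, X_m and sigma_(j;i) add up to a constant, which exchanges minima and maxima,
   and the defining inequalities of the set are changes of consecutive sigma_(j;i). *)

theory Submission
  imports Defs
begin

section \<open>Positions in the word\<close>

text \<open>The choice operators shape the group side: \<open>chi\<close>, \<open>eta\<close>,
  \<open>pi_plus\<close> and the expression behind \<open>UD_f_B\<close> are accessible only through
  their defining properties, so each must be pinned down before anything can be computed. For
  \<open>eta\<close> this is done on products of generators, which covers
  \<open>Theta_minus\<close>. What keeps the computation small is that chi^st sees only
  superdiagonal entries, and these add up under multiplication in U. Hence the inductions carry just
  the superdiagonal sum of v, and passing from n to n+1 adds one new row of the triangle of
  coordinates to it. The torus part enters by scaling superdiagonal entries with simple roots, so
  the second induction keeps arbitrary weights \<open>a\<close>. On the crystal side the two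
  definitions test different things: one asks whether the changed point still lies in the set, the
  other compares values of sigma. They are bridged by \<open>lower_mem_iff\<close> and
  \<open>raise_mem_iff\<close>, where strict changes of sigma next to an extremal row give the
  touched inequalities their room.\<close>

definition tri :: "nat \<Rightarrow> (nat \<times> nat) set" where
  "tri n = {p. fst p \<ge> 1 \<and> snd p \<ge> 1 \<and> fst p + snd p \<le> n + 1}"

text \<open>The position, counted from 0, of the coordinate c_{j,l}. Row j of the triangle is the
  j-th block of the word, so peeling off the first block lowers the row index. Values off
  \<open>tri n\<close> are junk.\<close>

primrec word_pos :: "nat \<Rightarrow> nat \<times> nat \<Rightarrow> nat" where
  "word_pos 0 p = 0"
| "word_pos (Suc n) p =
     (if fst p \<le> 1 then snd p - 1 else Suc n + word_pos n (fst p - 1, snd p))"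

lemma tri_shift: "p \<in> tri (Suc n) \<Longrightarrow> \<not> fst p \<le> 1 \<Longrightarrow> (fst p - 1, snd p) \<in> tri n"
  by (auto simp: tri_def)

lemma word_pos_less: "p \<in> tri n \<Longrightarrow> word_pos n p < length (word_i0 n)"
proof (induction n arbitrary: p)
  case 0 then show ?case by (auto simp: tri_def)
next
  case (Suc n)
  show ?case
  proof (cases "fst p \<le> 1")
    case True then show ?thesis using Suc.prems by (auto simp: tri_def)
  next
    case False
    then show ?thesis using Suc.IH[OF tri_shift[OF Suc.prems False]] by simp
  qed
qed

lemma word_i0_word_pos: "p \<in> tri n \<Longrightarrow> word_i0 n ! word_pos n p = snd p"
proof (induction n arbitrary: p)
  case 0 then show ?case by (auto simp: tri_def)
next
  case (Suc n)
  show ?case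
  proof (cases "fst p \<le> 1")
    case True then show ?thesis using Suc.prems by (auto simp: tri_def nth_append simp del: upt_Suc)
  next
    case False
    then show ?thesis using Suc.IH[OF tri_shift[OF Suc.prems False]]
      by (simp add: nth_append del: upt_Suc)
  qed
qed

text \<open>Word order is the lexicographic order of the polyhedral side, so a sum over later
  letters becomes a sum over later pairs and the re-indexing involves no reversal.\<close>

lemma word_pos_mono:
  "p \<in> tri n \<Longrightarrow> q \<in> tri n \<Longrightarrow> lex_less p q \<Longrightarrow> word_pos n p < word_pos n q"
proof (induction n arbitrary: p q)
  case 0 then show ?case by (auto simp: tri_def)
next
  case (Suc n)
  show ?case
  proof (cases "fst p \<le> 1")
    case True then show ?thesis using Suc.prems by (auto simp: tri_def lex_less_def)
  next
    case False
    then have q: "\<not> fst q \<le> 1" using Suc.prems by (auto simp: lex_less_def)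
    have "lex_less (fst p - 1, snd p) (fst q - 1, snd q)"
      using Suc.prems False q by (auto simp: lex_less_def)
    then show ?thesis
      using Suc.IH[OF tri_shift[OF Suc.prems(1) False] tri_shift[OF Suc.prems(2) q]] False q
      by simp
  qed
qed

lemma lex_less_total: "p = q \<or> lex_less p q \<or> lex_less q p"
  by (auto simp: lex_less_def prod_eq_iff)

lemma word_pos_less_iff:
  assumes "p \<in> tri n" "q \<in> tri n"
  shows "word_pos n p < word_pos n q \<longleftrightarrow> lex_less p q"
proof
  assume less: "word_pos n p < word_pos n q"
  then have "p \<noteq> q" by auto
  moreover have "\<not> lex_less q p" using word_pos_mono[OF assms(2,1)] less by auto
  ultimately show "lex_less p q" using lex_less_total[of p q] by blast
qed (rule word_pos_mono[OF assms])

lemma word_pos_inj: "inj_on (word_pos n) (tri n)"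
proof (rule inj_onI)
  fix p q assume "p \<in> tri n" "q \<in> tri n" "word_pos n p = word_pos n q"
  then show "p = q"
    using word_pos_mono[of p n q] word_pos_mono[of q n p] lex_less_total[of p q] by auto
qed

lemma word_pos_surj: "m < length (word_i0 n) \<Longrightarrow> \<exists>p\<in>tri n. word_pos n p = m"
proof (induction n arbitrary: m)
  case 0 then show ?case by simp
next
  case (Suc n)
  show ?case
  proof (cases "m < Suc n")
    case True
    then show ?thesis by (intro bexI[of _ "(1, Suc m)"]) (auto simp: tri_def)
  next
    case False
    moreover have "length (word_i0 (Suc n)) = Suc n + length (word_i0 n)"
      by (simp del: upt_Suc)
    ultimately have "m - Suc n < length (word_i0 n)" using Suc.prems by linarith
    from Suc.IH[OF this] obtain p where p: "p \<in> tri n" "word_pos n p = m - Suc n" by blast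
    show ?thesis
    proof (intro bexI[of _ "(Suc (fst p), snd p)"])
      show "word_pos (Suc n) (Suc (fst p), snd p) = m" using p False by (auto simp: tri_def)
    qed (use p in \<open>auto simp: tri_def\<close>)
  qed
qed

lemma word_pos_bij: "bij_betw (word_pos n) (tri n) {..<length (word_i0 n)}"
  unfolding bij_betw_def
proof
  show "word_pos n ` tri n = {..<length (word_i0 n)}"
    using word_pos_surj[of _ n] by (fastforce simp: word_pos_less image_iff)
qed (rule word_pos_inj)

lemma tri_subset: "tri n \<subseteq> {1..n} \<times> {1..n}"
  by (auto simp: tri_def)

lemma positions_eq:
  assumes "i \<in> {1..n}"
  shows "positions n i = (\<lambda>j. word_pos n (j,i)) ` {1..n + 1 - i}"
proof -
  have "positions n i \<subseteq> (\<lambda>j. word_pos n (j,i)) ` {1..n + 1 - i}"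
  proof
    fix m assume "m \<in> positions n i"
    then have m: "m < length (word_i0 n)" "word_i0 n ! m = i" by (auto simp: positions_def)
    from word_pos_surj[OF m(1)] obtain p where p: "p \<in> tri n" "word_pos n p = m" by blast
    then have "snd p = i" using word_i0_word_pos[OF p(1)] m by simp
    then show "m \<in> (\<lambda>j. word_pos n (j,i)) ` {1..n + 1 - i}" using p
      by (intro image_eqI[of _ _ "fst p"]) (auto simp: tri_def)
  qed
  moreover have "(\<lambda>j. word_pos n (j,i)) ` {1..n + 1 - i} \<subseteq> positions n i"
  proof
    fix m assume "m \<in> (\<lambda>j. word_pos n (j,i)) ` {1..n + 1 - i}"
    then obtain j where j: "j \<in> {1..n+1-i}" "m = word_pos n (j,i)" by blast
    then have "(j,i) \<in> tri n" using assms by (auto simp: tri_def)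
    then show "m \<in> positions n i"
      using j word_pos_less word_i0_word_pos by (auto simp: positions_def)
  qed
  ultimately show ?thesis by blast
qed

text \<open>The isomorphism of the theorem. The zeros off the triangle also supply the boundary
  entries of the inequalities.\<close>

definition family_of :: "nat \<Rightarrow> int list \<Rightarrow> family" where
  "family_of n x = (\<lambda>p. if p \<in> tri n then x ! word_pos n p else 0)"

text \<open>Sums over letters live on positions, those of the polyhedral side on the square; the
  zeros of the family off the triangle reconcile the two ranges.\<close>

lemma sum_word:
  assumes "A \<subseteq> {..<length (word_i0 n)}"
    and "\<And>p. p \<in> tri n \<Longrightarrow> word_pos n p \<in> A \<longleftrightarrow> P p"
  shows "(\<Sum>k\<in>A. f (word_i0 n ! k) * x ! k) =
    (\<Sum>p\<in>{p \<in> {1..n} \<times> {1..n}. P p}. f (snd p) * family_of n x p)"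
proof -
  have "(\<Sum>k\<in>A. f (word_i0 n ! k) * x ! k) = (\<Sum>p\<in>{p\<in>tri n. P p}. f (snd p) * family_of n x p)"
  proof -
    have "bij_betw (word_pos n) {p\<in>tri n. P p} A"
    proof (rule bij_betw_subset[OF word_pos_bij[of n]])
      show "word_pos n ` {p \<in> tri n. P p} = A"
      proof
        show "A \<subseteq> word_pos n ` {p \<in> tri n. P p}"
        proof
          fix m assume "m \<in> A"
          with assms(1) word_pos_surj[of m n] obtain p where "p \<in> tri n" "word_pos n p = m" by blast
          with \<open>m \<in> A\<close> assms(2)[of p] show "m \<in> word_pos n ` {p \<in> tri n. P p}" by blast
        qed
      qed (use assms(2) in auto)
    qed auto
    then have "(\<Sum>k\<in>A. f (word_i0 n ! k) * x ! k) =
       (\<Sum>p\<in>{p\<in>tri n. P p}. f (word_i0 n ! word_pos n p) * x ! word_pos n p)"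
      by (rule sum.reindex_bij_betw[symmetric])
    also have "\<dots> = (\<Sum>p\<in>{p\<in>tri n. P p}. f (snd p) * family_of n x p)"
      by (intro sum.cong) (auto simp: word_i0_word_pos family_of_def)
    finally show ?thesis .
  qed
  also have "\<dots> = (\<Sum>p\<in>{p \<in> {1..n} \<times> {1..n}. P p}. f (snd p) * family_of n x p)"
    using tri_subset[of n] by (intro sum.mono_neutral_left) (auto simp: family_of_def)
  finally show ?thesis .
qed

section \<open>The crystal structures\<close>

lemma cartan_sym: "cartan i j = cartan j i"
  by (auto simp: cartan_def)

text \<open>All inequalities are brought to one uniform shape at a place \<open>(j,i)\<close>.
  Nonnegativity in column 1 becomes the case \<open>i = 1\<close> of the chain inequality, because
  column 0 is zero.\<close>

lemma Sigma_setD: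
  assumes "y \<in> Sigma_set n lam"
  shows "p \<notin> tri n \<Longrightarrow> y p = 0"
    and "\<lbrakk>1 \<le> j; 1 \<le> i; i + j \<le> n + 1\<rbrakk> \<Longrightarrow> y (Suc j, i - 1) \<le> y (j, i)"
    and "\<lbrakk>1 \<le> j; 1 \<le> i; i + j \<le> n + 1\<rbrakk> \<Longrightarrow> y (j, i) - y (j, i - 1) \<le> lam (i + j - 1)"
proof -
  have z: "\<not> (j \<ge> 1 \<and> i \<ge> 1 \<and> i + j \<le> n + 1) \<Longrightarrow> y (j,i) = 0" for j i
    using assms by (simp add: Sigma_set_def)
  then show "p \<notin> tri n \<Longrightarrow> y p = 0" by (cases p) (auto simp: tri_def)
  show "y (Suc j, i - 1) \<le> y (j, i)" if "1 \<le> j" "1 \<le> i" "i + j \<le> n + 1"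
  proof (cases "i = 1")
    case True
    then have "y (j,1) \<ge> 0" using assms that by (auto simp: Sigma_set_def)
    then show ?thesis using True z[of "Suc j" 0] by simp
  next
    case False
    define l where "l = i + j - 1"
    have "l \<in> {1..n}" "j \<in> {1..<l}" using that False by (auto simp: l_def)
    then have "y (j, l + 1 - j) \<ge> y (j + 1, l - j)" using assms by (simp add: Sigma_set_def)
    moreover have "l + 1 - j = i" "l - j = i - 1" using that by (auto simp: l_def)
    ultimately show ?thesis by simp
  qed
  show "y (j, i) - y (j, i - 1) \<le> lam (i + j - 1)" if "1 \<le> j" "1 \<le> i" "i + j \<le> n + 1"
  proof -
    define l where "l = i + j - 1"
    have "l \<in> {1..n}" "j \<in> {1..l}" using that by (auto simp: l_def)
    then have "y (j, l - j + 1) - y (j, l - j) \<le> lam l" using assms by (simp add: Sigma_set_def)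
    moreover have "l - j + 1 = i" "l - j = i - 1" using that by (auto simp: l_def)
    ultimately show ?thesis by (simp add: l_def)
  qed
qed

lemma Sigma_setI:
  assumes "\<And>p. p \<notin> tri n \<Longrightarrow> y p = 0"
    and 1: "\<And>j i. \<lbrakk>1 \<le> j; 1 \<le> i; i + j \<le> n + 1\<rbrakk> \<Longrightarrow> y (Suc j, i - 1) \<le> y (j, i)"
    and 2: "\<And>j i. \<lbrakk>1 \<le> j; 1 \<le> i; i + j \<le> n + 1\<rbrakk> \<Longrightarrow> y (j, i) - y (j, i - 1) \<le> lam (i + j - 1)"
  shows "y \<in> Sigma_set n lam"
proof -
  have z: "y (j,0) = 0" for j using assms(1)[of "(j,0)"] by (simp add: tri_def)
  have "y (k + 1, i - k) \<le> y (k, i + 1 - k)" if "i \<in> {1..n}" "k \<in> {1..<i}" for i k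
    using 1[of k "i + 1 - k"] that by (simp add: Suc_diff_le)
  moreover have "0 \<le> y (i, 1)" if "i \<in> {1..n}" for i
    using 1[of i 1] z that by simp
  moreover have "y (j, i - j + 1) - y (j, i - j) \<le> lam i" if "i \<in> {1..n}" "j \<in> {1..i}" for i j
    using 2[of j "i - j + 1"] that by simp
  moreover have "y (j, i) = 0" if "\<not> (j \<ge> 1 \<and> i \<ge> 1 \<and> i + j \<le> n + 1)" for j i
    using assms(1)[of "(j,i)"] that by (auto simp: tri_def)
  ultimately show ?thesis unfolding Sigma_set_def by simp
qed

text \<open>The two zeros pad the range to \<open>{0..Suc n}\<close>, so that both neighbours of
  \<open>i\<close> lie in it and the end letters need no separate treatment.\<close>

lemma sum_cartan_row:
  assumes "i \<in> {1..n}" "f 0 = 0" "f (Suc n) = 0"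
  shows "(\<Sum>l\<in>{1..n}. cartan i l * f l) = 2 * f i - f (i - 1) - f (Suc i)"
proof -
  have "(\<Sum>l\<in>{1..n}. cartan i l * f l) = (\<Sum>l\<in>{0..Suc n}. cartan i l * f l)"
    using assms by (intro sum.mono_neutral_left) (auto simp: not_less_eq_eq intro: le_antisym)
  also have "\<dots> = (\<Sum>l\<in>{i - 1, i, Suc i}. cartan i l * f l)"
    using assms by (intro sum.mono_neutral_right) (auto simp: cartan_def)
  also have "\<dots> = 2 * f i - f (i - 1) - f (Suc i)"
    using assms(1) by (cases i) (auto simp: cartan_def)
  finally show ?thesis .
qed

section \<open>Closed formulas for the row functions \<open>Sigma_sigma\<close>\<close>

context
  fixes n :: nat and i :: nat and y :: family
  assumes i: "i \<in> {1..n}" and supp: "\<And>p. p \<notin> tri n \<Longrightarrow> y p = 0"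
begin

lemma family_boundary: "y (j, 0) = 0" "y (0, j) = 0" "j + l > n + 1 \<Longrightarrow> y (j, l) = 0"
  using supp[of "(j,0)"] supp[of "(0,j)"] supp[of "(j,l)"] by (auto simp: tri_def)

text \<open>Behind \<open>(j,i)\<close> in its own row only the letter \<open>Suc i\<close> is a
  neighbour of \<open>i\<close>; every later row contributes a full row of the Cartan
  matrix.\<close>

lemma Sigma_sigma_eq:
  "Sigma_sigma n i y j = y (j,i) - y (j, Suc i) +
     (\<Sum>j'\<in>{j<..n}. 2 * y (j',i) - y (j', i - 1) - y (j', Suc i))" 
proof -
  have "{p \<in> {1..n} \<times> {1..n}. lex_less (j,i) p} =
     (if j \<in> {1..n} then {j} \<times> {i<..n} else {}) \<union> {j<..n} \<times> {1..n}"
    by (auto simp: lex_less_def)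
  moreover have "(\<Sum>p\<in>(if j \<in> {1..n} then {j} \<times> {i<..n} else {}). cartan i (snd p) * y p) =
     - y (j, Suc i)"
  proof (cases "j \<in> {1..n}")
    case True
    have "(\<Sum>p\<in>{j} \<times> {i<..n}. cartan i (snd p) * y p) = (\<Sum>l\<in>{i<..n}. cartan i l * y (j,l))"
      by (simp add: sum.cartesian_product' )
    also have "\<dots> = (\<Sum>l\<in>{i<..Suc n}. cartan i l * y (j,l))"
      using True by (intro sum.mono_neutral_left) (auto intro!: family_boundary(3) simp: not_less_eq_eq)
    also have "\<dots> = (\<Sum>l\<in>{Suc i}. cartan i l * y (j,l))"
      using i by (intro sum.mono_neutral_right) (auto simp: cartan_def)
    finally show ?thesis using True by (simp add: cartan_def)
  next
    case False
    then have "y (j, Suc i) = 0" using family_boundary(2)[of "Suc i"] family_boundary(3)[of j "Suc i"] by (cases j) auto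
    with False show ?thesis by (simp only: if_False sum.empty)
  qed
  moreover have "(\<Sum>p\<in>{j<..n} \<times> {1..n}. cartan i (snd p) * y p) =
     (\<Sum>j'\<in>{j<..n}. 2 * y (j',i) - y (j', i - 1) - y (j', Suc i))"
    unfolding sum.cartesian_product' snd_conv
    using i by (intro sum.cong refl sum_cartan_row) (auto intro: family_boundary)
  moreover have "(if j \<in> {1..n} then {j} \<times> {i<..n} else {}) \<inter> {j<..n} \<times> {1..n} = {}" by auto
  moreover have "finite (if j \<in> {1..n} then {j} \<times> {i<..n} else {})" "finite ({j<..n} \<times> {1..n})"
    by auto
  ultimately show ?thesis unfolding Sigma_sigma_def by (simp only: sum.union_disjoint)
qed

text \<open>The right-hand side can be read in two ways: as the slack of the chain inequality at
  \<open>(j,i)\<close> minus that at \<open>(j, Suc i)\<close>, or as the slack of the lambda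
  inequality at \<open>(j, Suc i)\<close> minus that at \<open>(Suc j, i)\<close>; the last two
  involve the same \<open>lam (i + j)\<close>. A strict change of sigma thus makes one inequality of
  each kind strict.\<close>

lemma Sigma_sigma_diff:
  "Sigma_sigma n i y j - Sigma_sigma n i y (Suc j) =
     y (j,i) + y (Suc j, i) - y (j, Suc i) - y (Suc j, i - 1)"
proof (cases "j < n")
  case True
  then have "{j<..n} = insert (Suc j) {Suc j<..n}" by auto
  then show ?thesis by (simp add: Sigma_sigma_eq)
next
  case False
  then have "y (Suc j, i - 1) = 0"
    using i family_boundary(1)[of "Suc j"] family_boundary(3)[of "Suc j" "i - 1"] by (cases "i = 1") auto
  then show ?thesis using False i by (simp add: Sigma_sigma_eq family_boundary(3))
qed

lemma Sigma_sigma_zero: "n + 1 < i + j \<Longrightarrow> Sigma_sigma n i y j = 0"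
  unfolding Sigma_sigma_eq using i by (auto simp: family_boundary(3) intro!: sum.neutral)

text \<open>Boundary case at the top: \<open>Sigma_sigma0\<close> lies below the first row's value
  by the slack of the lambda inequality at \<open>(1,i)\<close>.\<close>

lemma Sigma_sigma0_eq: "Sigma_sigma0 n lam i y = Sigma_sigma n i y 1 + y (1,i) - y (1, i - 1) - lam i"
proof -
  have "(\<Sum>p\<in>{1..n} \<times> {1..n}. cartan i (snd p) * y p) =
     (\<Sum>j'\<in>{1..n}. 2 * y (j',i) - y (j', i - 1) - y (j', Suc i))"
    unfolding sum.cartesian_product' snd_conv
    using i by (intro sum.cong refl sum_cartan_row) (auto intro: family_boundary)
  moreover have "{1..n} = insert 1 {1<..n}" using i by auto
  ultimately show ?thesis unfolding Sigma_sigma0_def Sigma_sigma_eq by simp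
qed

text \<open>Boundary case at the bottom: in the last row of the triangle sigma is itself the slack
  of a chain inequality.\<close>

lemma Sigma_sigma_last: "Sigma_sigma n i y (n + 1 - i) = y (n + 1 - i, i) - y (n + 2 - i, i - 1)"
  using Sigma_sigma_diff[of "n + 1 - i"] Sigma_sigma_zero[of "n + 2 - i"] i
    family_boundary(3)[of "n + 1 - i" "Suc i"] family_boundary(3)[of "n + 2 - i" i]
  by (simp add: Suc_diff_le)

end

text \<open>Restricting to rows of the triangle matches the positions in the word and keeps the set
  finite; \<open>Sigma_M\<close> contains all rows beyond the triangle when the maximum is
  0.\<close>

definition argmax_rows :: "nat \<Rightarrow> nat \<Rightarrow> family \<Rightarrow> nat set" where
  "argmax_rows n i y = {j \<in> {1..n+1-i}.
     Sigma_sigma n i y j = Max (Sigma_sigma n i y ` {1..n+1-i})}"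

lemma argmax_rows_nonempty: "i \<in> {1..n} \<Longrightarrow> argmax_rows n i y \<noteq> {}"
  using Max_in[of "Sigma_sigma n i y ` {1..n+1-i}"] by (fastforce simp: argmax_rows_def)

lemma argmax_rows_finite: "finite (argmax_rows n i y)"
  by (simp add: argmax_rows_def)

section \<open>Row maxima and the points obtained by raising or lowering an entry\<close>

context
  fixes n i :: nat and lam :: "nat \<Rightarrow> int" and y :: family
  assumes i: "i \<in> {1..n}" and y: "y \<in> Sigma_set n lam"
begin

lemma Sigma_set_support: "p \<notin> tri n \<Longrightarrow> y p = 0"
  using Sigma_setD(1)[OF y] .

lemma Sigma_sigma_last_nonneg: "Sigma_sigma n i y (n + 1 - i) \<ge> 0"
  using Sigma_sigma_last[where y = y, OF i Sigma_set_support] Sigma_setD(2)[OF y, of "n + 1 - i" i] i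
  by (simp add: Suc_diff_le)

lemma Max_rows_nonneg: "Max (Sigma_sigma n i y ` {1..n+1-i}) \<ge> 0"
  using Sigma_sigma_last_nonneg i
  by (subst Max_ge_iff) (auto intro!: bexI[of _ "n + 1 - i"])

text \<open>Rows beyond the triangle contribute only the value 0, and the last row of the triangle
  already reaches at least 0.\<close>

lemma Sigma_sigma_max_eq: "Sigma_sigma_max n i y = Max (Sigma_sigma n i y ` {1..n+1-i})"
proof -
  have rows: "Sigma_sigma n i y ` {1..} = insert 0 (Sigma_sigma n i y ` {1..n+1-i})"
  proof -
    have "{1..} = {1..n+1-i} \<union> {n+2-i..}" using i by auto
    moreover have "Sigma_sigma n i y ` {n+2-i..} = {0}"
      using Sigma_sigma_zero[where y = y, OF i Sigma_set_support] by (force simp: image_iff)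
    ultimately show ?thesis by (simp add: image_Un)
  qed
  then show ?thesis unfolding Sigma_sigma_max_def
    using Max_rows_nonneg i by (subst rows, subst Max_insert) auto
qed

lemma Sigma_sigma0_le_first: "Sigma_sigma0 n lam i y \<le> Sigma_sigma n i y 1"
  using Sigma_sigma0_eq[where y = y, OF i Sigma_set_support, where lam = lam] Sigma_setD(3)[OF y, of 1 i] i by simp

lemma Sigma_sigma_le_max: "j \<in> {1..n+1-i} \<Longrightarrow> Sigma_sigma n i y j \<le> Sigma_sigma_max n i y"
  unfolding Sigma_sigma_max_eq by simp

lemma Sigma_sigma0_le: "Sigma_sigma0 n lam i y \<le> Sigma_sigma_max n i y"
  using Sigma_sigma0_le_first Sigma_sigma_le_max[of 1] i by force

lemma Sigma_M_inter: "Sigma_M n i y \<inter> {..n+1-i} = argmax_rows n i y"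
  by (auto simp: Sigma_M_def argmax_rows_def Sigma_sigma_max_eq)

lemma argmax_rows_iff:
  "j \<in> argmax_rows n i y \<longleftrightarrow> 1 \<le> j \<and> j \<le> n + 1 - i \<and> Sigma_sigma n i y j = Sigma_sigma_max n i y"
  by (auto simp: argmax_rows_def Sigma_sigma_max_eq)

text \<open>The extra rows that \<open>Sigma_M\<close> may contain come after the whole triangle and
  cannot be least.\<close>

lemma Least_Sigma_M: "(LEAST j. j \<in> Sigma_M n i y) = Min (argmax_rows n i y)"
proof (rule Least_equality)
  have *: "Min (argmax_rows n i y) \<in> argmax_rows n i y"
    using argmax_rows_nonempty[OF i] argmax_rows_finite by (rule Min_in[rotated])
  then show "Min (argmax_rows n i y) \<in> Sigma_M n i y" using Sigma_M_inter by blast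
  fix j assume j: "j \<in> Sigma_M n i y"
  show "Min (argmax_rows n i y) \<le> j"
  proof (cases "j \<le> n + 1 - i")
    case True
    with j have "j \<in> argmax_rows n i y" using Sigma_M_inter by blast
    then show ?thesis using argmax_rows_finite by simp
  next
    case False
    with * show ?thesis by (simp add: argmax_rows_def)
  qed
qed

lemma Sigma_M_pos:
  assumes "Sigma_sigma_max n i y > 0"
  shows "Sigma_M n i y = argmax_rows n i y"
proof -
  have "j \<le> n + 1 - i" if "j \<in> Sigma_M n i y" for j
    using that assms Sigma_sigma_zero[where y = y, OF i Sigma_set_support, where j = j] by (force simp: Sigma_M_def)
  then show ?thesis using Sigma_M_inter by blast
qed

text \<open>Lowering the entry at \<open>(j,i)\<close> endangers two inequalities: the chain
  inequality there and the lambda inequality at \<open>(j, Suc i)\<close>. As \<open>j\<close> is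
  the last maximal row, sigma drops strictly to the next row, which makes both strict. In the last
  row of the triangle only the first one remains, and its slack is sigma.\<close>

lemma lower_mem_iff:
  defines "p \<equiv> (Max (argmax_rows n i y), i)"
  shows "y(p := y p - 1) \<in> Sigma_set n lam \<longleftrightarrow> Sigma_sigma_max n i y > 0"
proof -
  define j where "j = Max (argmax_rows n i y)"
  let ?S = "Sigma_sigma n i y"
  have "j \<in> argmax_rows n i y"
    unfolding j_def using argmax_rows_nonempty[OF i] argmax_rows_finite by (rule Max_in[rotated])
  then have j: "1 \<le> j" "i + j \<le> n + 1" and Sj: "?S j = Sigma_sigma_max n i y"
    using i by (auto simp: argmax_rows_iff)
  have p: "p = (j, i)" by (simp add: p_def j_def)
  have later: "?S (Suc j) < ?S j" if "i + j \<le> n"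
  proof (rule ccontr)
    assume "\<not> ?thesis"
    moreover have "?S (Suc j) \<le> Sigma_sigma_max n i y" using that i by (intro Sigma_sigma_le_max) auto
    ultimately have "Suc j \<in> argmax_rows n i y"
      using Sj that i by (auto simp: argmax_rows_iff)
    then have "Suc j \<le> j" unfolding j_def using argmax_rows_finite by simp
    then show False by simp
  qed
  note diff = Sigma_sigma_diff[where y = y, OF i Sigma_set_support, where j = j]
  show ?thesis
  proof
    assume mem: "y(p := y p - 1) \<in> Sigma_set n lam"
    show "Sigma_sigma_max n i y > 0"
    proof (rule ccontr)
      assume "\<not> Sigma_sigma_max n i y > 0"
      then have z: "Sigma_sigma_max n i y = 0" using Max_rows_nonneg Sigma_sigma_max_eq by simp
      \<comment> \<open>If the maximum is 0, the nonnegative last row attains it too, so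
        \<open>j\<close> is that row; there the chain inequality is tight and lowering violates
        it.\<close>
      have "i + j = n + 1"
      proof (rule ccontr)
        assume "i + j \<noteq> n + 1"
        have "?S (n + 1 - i) = 0"
          using Sigma_sigma_last_nonneg Sigma_sigma_le_max[of "n + 1 - i"] z i by auto
        then have "n + 1 - i \<in> argmax_rows n i y"
          using z i by (auto simp: argmax_rows_iff)
        then have "n + 1 - i \<le> j" unfolding j_def using argmax_rows_finite by simp
        with \<open>i + j \<noteq> n + 1\<close> j show False by simp
      qed
      then have "j = n + 1 - i" "n + 2 - i = Suc j" using i by auto
      then have "y (j, i) = y (Suc j, i - 1)" using Sigma_sigma_last[where y = y, OF i Sigma_set_support] z Sj by simp
      moreover have "(y(p := y p - 1)) (Suc j, i - 1) \<le> (y(p := y p - 1)) (j, i)"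
        using Sigma_setD(2)[OF mem, of j i] j i by simp
      ultimately show False by (simp add: p)
    qed
  next
    assume pos: "Sigma_sigma_max n i y > 0"
    have 1: "y (j,i) > y (Suc j, i - 1)"
    proof (cases "i + j \<le> n")
      case True
      then show ?thesis using later[OF True] diff Sigma_setD(2)[OF y, of j "Suc i"] j i by simp
    next
      case False
      then have "j = n + 1 - i" "n + 2 - i = Suc j" using i j by auto
      then show ?thesis using Sigma_sigma_last[where y = y, OF i Sigma_set_support] pos Sj by simp
    qed
    have 2: "y (j, Suc i) - y (j,i) < lam (i + j)" if "i + j \<le> n"
      using later[OF that] diff Sigma_setD(3)[OF y, of "Suc j" i] that i by simp
    show "y(p := y p - 1) \<in> Sigma_set n lam"
    proof (rule Sigma_setI)
      show "(y(p := y p - 1)) q = 0" if "q \<notin> tri n" for q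
        using Sigma_set_support[OF that] that j i by (auto simp: p tri_def)
      fix l m assume lm: "1 \<le> l" "1 \<le> m" "m + l \<le> n + 1"
      show "(y(p := y p - 1)) (Suc l, m - 1) \<le> (y(p := y p - 1)) (l, m)"
        using 1 Sigma_setD(2)[OF y lm] by (auto simp: p)
      show "(y(p := y p - 1)) (l, m) - (y(p := y p - 1)) (l, m - 1) \<le> lam (m + l - 1)"
      proof (cases "l = j \<and> m = Suc i")
        case True
        then show ?thesis using 2 lm by (simp add: p)
      next
        case False
        then have "(l, m - 1) \<noteq> p" using lm by (auto simp: p)
        then show ?thesis using Sigma_setD(3)[OF y lm] by auto
      qed
    qed
  qed
qed

text \<open>Raising the entry at \<open>(j,i)\<close> endangers the chain inequality one row up, at
  \<open>(j - 1, Suc i)\<close>, and the lambda inequality at \<open>(j,i)\<close>. As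
  \<open>j\<close> is the first maximal row, sigma rises strictly from row \<open>j - 1\<close>,
  which makes both strict. For \<open>j = 1\<close> only the lambda inequality is left, and its
  slack is the gap between the first sigma and \<open>Sigma_sigma0\<close>.\<close>

lemma raise_mem_iff:
  defines "p \<equiv> (Min (argmax_rows n i y), i)"
  shows "y(p := y p + 1) \<in> Sigma_set n lam \<longleftrightarrow> Sigma_sigma_max n i y > Sigma_sigma0 n lam i y"
proof -
  define j where "j = Min (argmax_rows n i y)"
  let ?S = "Sigma_sigma n i y"
  have "j \<in> argmax_rows n i y"
    unfolding j_def using argmax_rows_nonempty[OF i] argmax_rows_finite by (rule Min_in[rotated])
  then have j: "1 \<le> j" "i + j \<le> n + 1" and Sj: "?S j = Sigma_sigma_max n i y"
    using i by (auto simp: argmax_rows_iff)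
  have p: "p = (j, i)" by (simp add: p_def j_def)
  have earlier: "?S l < ?S j" if "1 \<le> l" "l < j" for l
  proof (rule ccontr)
    assume "\<not> ?thesis"
    moreover have "?S l \<le> Sigma_sigma_max n i y" using that j by (intro Sigma_sigma_le_max) auto
    ultimately have "l \<in> argmax_rows n i y"
      using Sj that j by (auto simp: argmax_rows_iff)
    then have "j \<le> l" unfolding j_def using argmax_rows_finite by simp
    then show False using that by simp
  qed
  note sigma0 = Sigma_sigma0_eq[where y = y, OF i Sigma_set_support, where lam = lam]
  show ?thesis
  proof
    assume mem: "y(p := y p + 1) \<in> Sigma_set n lam"
    show "Sigma_sigma_max n i y > Sigma_sigma0 n lam i y"
    proof (cases "j = 1")
      case True
      then have "y (1, i) + 1 - y (1, i - 1) \<le> lam i"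
        using Sigma_setD(3)[OF mem, of 1 i] i by (auto simp: p split: if_splits)
      then show ?thesis using sigma0 Sj True by simp
    next
      case False
      then show ?thesis using earlier[of 1] j Sj Sigma_sigma0_le_first by simp
    qed
  next
    assume pos: "Sigma_sigma_max n i y > Sigma_sigma0 n lam i y"
    have 1: "y (l, Suc i) > y (j, i)" if "j = Suc l" "1 \<le> l" for l
      using earlier[of l] Sigma_sigma_diff[where y = y, OF i Sigma_set_support, where j = l] Sigma_setD(2)[OF y, of l i] that j i
      by simp
    have 2: "y (j, i) - y (j, i - 1) < lam (i + j - 1)"
    proof (cases "j = 1")
      case True
      then show ?thesis using sigma0 Sj pos by simp
    next
      case False
      then obtain l where l: "j = Suc l" "1 \<le> l" using j by (cases j) auto
      then show ?thesis
        using earlier[of l] Sigma_sigma_diff[where y = y, OF i Sigma_set_support, where j = l] Sigma_setD(3)[OF y, of l "Suc i"] j i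
        by simp
    qed
    show "y(p := y p + 1) \<in> Sigma_set n lam"
    proof (rule Sigma_setI)
      show "(y(p := y p + 1)) q = 0" if "q \<notin> tri n" for q
        using Sigma_set_support[OF that] that j i by (auto simp: p tri_def)
      fix l m assume lm: "1 \<le> l" "1 \<le> m" "m + l \<le> n + 1"
      show "(y(p := y p + 1)) (Suc l, m - 1) \<le> (y(p := y p + 1)) (l, m)"
      proof (cases "Suc l = j \<and> m - 1 = i")
        case True
        then have "m = Suc i" using lm i by auto
        then show ?thesis using 1[of l] True lm by (simp add: p)
      next
        case False
        then show ?thesis using Sigma_setD(2)[OF y lm] by (auto simp: p)
      qed
      show "(y(p := y p + 1)) (l, m) - (y(p := y p + 1)) (l, m - 1) \<le> lam (m + l - 1)"
        using 2 Sigma_setD(3)[OF y lm] by (auto simp: p)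
    qed
  qed
qed

end

section \<open>Transport of the crystal structure along the re-indexing\<close>

lemma family_of_update:
  assumes "p \<in> tri n" "length x = length (word_i0 n)"
  shows "family_of n (x[word_pos n p := v]) = (family_of n x)(p := v)"
proof
  fix q
  show "family_of n (x[word_pos n p := v]) q = ((family_of n x)(p := v)) q"
    using assms word_pos_less[of p n] inj_onD[OF word_pos_inj, of n p q]
    by (auto simp: family_of_def nth_list_update)
qed

lemma family_of_inj:
  assumes "length x = length (word_i0 n)" "length x' = length (word_i0 n)"
    and "family_of n x = family_of n x'"
  shows "x = x'"
proof (rule nth_equalityI)
  fix m assume "m < length x"
  with assms obtain p where "p \<in> tri n" "word_pos n p = m" using word_pos_surj by metis
  then show "x ! m = x' ! m" using fun_cong[OF assms(3), of p] by (simp add: family_of_def)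
qed (use assms in simp)

lemma family_of_surj:
  assumes "\<And>p. p \<notin> tri n \<Longrightarrow> y p = 0"
  shows "\<exists>x. length x = length (word_i0 n) \<and> family_of n x = y"
proof (intro exI conjI)
  let ?x = "map (\<lambda>m. y (inv_into (tri n) (word_pos n) m)) [0..<length (word_i0 n)]"
  show "family_of n ?x = y"
  proof
    fix p show "family_of n ?x p = y p"
      using assms[of p] word_pos_less[of p n] inv_into_f_f[OF word_pos_inj, of p n]
      by (auto simp: family_of_def)
  qed
qed simp

lemma Sigma_wt_family_of: "Sigma_wt n lam (family_of n x) = B_wt n lam x"
proof
  fix i
  show "Sigma_wt n lam (family_of n x) i = B_wt n lam x i"
    using sum_word[where A = "{..<length (word_i0 n)}" and n = n and P = "\<lambda>_. True"
        and f = "\<lambda>j. simple_root n j i" and x = x] word_pos_less[of _ n]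
    by (auto simp: Sigma_wt_def B_wt_def mult.commute)
qed

lemma B_sigma_eq:
  assumes "p \<in> tri n"
  shows "x ! word_pos n p +
      (\<Sum>k\<in>{word_pos n p<..<length (word_i0 n)}. cartan (word_i0 n ! k) (snd p) * x ! k)
    = Sigma_sigma n (snd p) (family_of n x) (fst p)"
proof -
  have "(\<Sum>k\<in>{word_pos n p<..<length (word_i0 n)}. cartan (word_i0 n ! k) (snd p) * x ! k) =
      (\<Sum>q\<in>{q \<in> {1..n} \<times> {1..n}. lex_less p q}. cartan (snd q) (snd p) * family_of n x q)"
    by (rule sum_word) (use assms in \<open>auto simp: word_pos_less word_pos_less_iff\<close>)
  then show ?thesis
    using assms by (simp add: Sigma_sigma_def family_of_def cartan_sym[of _ "snd p"])
qed

lemma B_eps_eq: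
  assumes "i \<in> {1..n}"
  shows "B_eps n i x = Max (Sigma_sigma n i (family_of n x) ` {1..n+1-i})"
proof -
  have "(j,i) \<in> tri n" if "j \<in> {1..n+1-i}" for j using that assms by (auto simp: tri_def)
  then show ?thesis
    unfolding B_eps_def positions_eq[OF assms] image_image
    using B_sigma_eq[of "(_,i)" n x] by (intro arg_cong[of _ _ Max] image_cong) auto
qed

text \<open>In the total sum the entry at the position itself has coefficient 2; one copy belongs to
  X with the earlier letters, the other to sigma with the later ones.\<close>

lemma B_X_eq:
  assumes "p \<in> tri n"
  shows "B_X n (snd p) x (word_pos n p) =
    (\<Sum>k<length (word_i0 n). cartan (word_i0 n ! k) (snd p) * x ! k) -
    Sigma_sigma n (snd p) (family_of n x) (fst p)"
proof -
  let ?m = "word_pos n p" and ?f = "\<lambda>k. cartan (word_i0 n ! k) (snd p) * x ! k"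
  have split: "{..<length (word_i0 n)} = {..<?m} \<union> {?m} \<union> {?m<..<length (word_i0 n)}"
    using word_pos_less[OF assms] by auto
  have "(\<Sum>k<length (word_i0 n). ?f k) =
      (\<Sum>k\<in>{..<?m} \<union> {?m}. ?f k) + (\<Sum>k\<in>{?m<..<length (word_i0 n)}. ?f k)"
    unfolding split by (rule sum.union_disjoint) auto
  also have "(\<Sum>k\<in>{..<?m} \<union> {?m}. ?f k) = (\<Sum>k<?m. ?f k) + ?f ?m"
    by (subst sum.union_disjoint) auto
  finally have "(\<Sum>k<length (word_i0 n). ?f k) =
      (\<Sum>k<?m. ?f k) + ?f ?m + (\<Sum>k\<in>{?m<..<length (word_i0 n)}. ?f k)" .
  then show ?thesis
    using B_sigma_eq[OF assms, of x] word_i0_word_pos[OF assms]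
    by (simp add: B_X_def cartan_def)
qed

lemma B_M_eq:
  assumes "i \<in> {1..n}"
  shows "B_M n i x = (\<lambda>j. word_pos n (j,i)) ` argmax_rows n i (family_of n x)"
proof -
  let ?S = "Sigma_sigma n i (family_of n x)" and ?J = "{1..n+1-i}"
  define T where "T = (\<Sum>k<length (word_i0 n). cartan (word_i0 n ! k) i * x ! k)"
  have tri: "(j,i) \<in> tri n" if "j \<in> ?J" for j using that assms by (auto simp: tri_def)
  have X: "B_X n i x (word_pos n (j,i)) = T - ?S j" if "j \<in> ?J" for j
    using B_X_eq[OF tri[OF that], of x] by (simp add: T_def)
  have ne: "?S ` ?J \<noteq> {}" using assms by auto
  have "Min (B_X n i x ` positions n i) = Min ((\<lambda>j. T - ?S j) ` ?J)"
    unfolding positions_eq[OF assms] image_image using X by (intro arg_cong[of _ _ Min] image_cong) auto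
  also have "\<dots> = T - Max (?S ` ?J)"
  proof (rule Min_eqI)
    show "T - Max (?S ` ?J) \<in> (\<lambda>j. T - ?S j) ` ?J"
      using Max_in[OF _ ne] by (simp only: finite_imageI finite_atLeastAtMost) fastforce
  qed auto
  finally have "B_M n i x = {m \<in> positions n i. B_X n i x m = T - Max (?S ` ?J)}"
    by (simp only: B_M_def)
  also have "\<dots> = (\<lambda>j. word_pos n (j,i)) ` {j \<in> ?J. T - ?S j = T - Max (?S ` ?J)}"
    unfolding positions_eq[OF assms] using X by fastforce
  finally show ?thesis by (simp add: argmax_rows_def)
qed

lemma mono_on_word_pos_rows:
  assumes "i \<in> {1..n}"
  shows "mono_on (argmax_rows n i y) (\<lambda>j. word_pos n (j,i))"
proof (rule mono_onI)
  fix r s assume "r \<in> argmax_rows n i y" "s \<in> argmax_rows n i y" "r \<le> s"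
  then show "word_pos n (r,i) \<le> word_pos n (s,i)"
    using word_pos_mono[of "(r,i)" n "(s,i)"] assms
    by (cases "r = s") (auto simp: argmax_rows_def tri_def lex_less_def intro!: less_imp_le)
qed

lemma Max_B_M:
  assumes "i \<in> {1..n}"
  shows "Max (B_M n i x) = word_pos n (Max (argmax_rows n i (family_of n x)), i)"
proof (rule Max_eqI)
  let ?J = "argmax_rows n i (family_of n x)"
  have *: "Max ?J \<in> ?J" using argmax_rows_nonempty[OF assms] argmax_rows_finite by (rule Max_in[rotated])
  then show "word_pos n (Max ?J, i) \<in> B_M n i x" by (auto simp: B_M_eq[OF assms])
  fix m assume "m \<in> B_M n i x"
  then obtain j where "j \<in> ?J" "m = word_pos n (j,i)" by (auto simp: B_M_eq[OF assms])
  then show "m \<le> word_pos n (Max ?J, i)"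
    using mono_onD[OF mono_on_word_pos_rows[OF assms] _ *] argmax_rows_finite by simp
qed (simp add: B_M_eq[OF assms] argmax_rows_finite)

lemma Min_B_M:
  assumes "i \<in> {1..n}"
  shows "Min (B_M n i x) = word_pos n (Min (argmax_rows n i (family_of n x)), i)"
proof (rule Min_eqI)
  let ?J = "argmax_rows n i (family_of n x)"
  have *: "Min ?J \<in> ?J" using argmax_rows_nonempty[OF assms] argmax_rows_finite by (rule Min_in[rotated])
  then show "word_pos n (Min ?J, i) \<in> B_M n i x" by (auto simp: B_M_eq[OF assms])
  fix m assume "m \<in> B_M n i x"
  then obtain j where "j \<in> ?J" "m = word_pos n (j,i)" by (auto simp: B_M_eq[OF assms])
  then show "word_pos n (Min ?J, i) \<le> m"
    using mono_onD[OF mono_on_word_pos_rows[OF assms] *] argmax_rows_finite by simp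
qed (simp add: B_M_eq[OF assms] argmax_rows_finite)

lemma crystal_isomorphism_family_of:
  assumes B: "B_set n lam =
    {x. length x = length (word_i0 n) \<and> family_of n x \<in> Sigma_set n lam}"
  shows "crystal_isomorphism {1..n} (B_crystal n lam) (Sigma_crystal n lam) (family_of n)"
  unfolding crystal_isomorphism_def
proof (intro conjI ballI)
  have "inj_on (family_of n) (B_set n lam)"
    using family_of_inj by (auto simp: inj_on_def B)
  moreover have "y \<in> family_of n ` B_set n lam" if "y \<in> Sigma_set n lam" for y
    using family_of_surj[of n y, OF Sigma_setD(1)[OF that]] that by (auto simp: B)
  ultimately show "bij_betw (family_of n) (cr_set (B_crystal n lam)) (cr_set (Sigma_crystal n lam))"
    by (auto simp: bij_betw_def B_crystal_def Sigma_crystal_def B)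
next
  fix x assume x': "x \<in> cr_set (B_crystal n lam)"
  then have x: "length x = length (word_i0 n)" "family_of n x \<in> Sigma_set n lam"
    by (auto simp: B_crystal_def B)
  let ?y = "family_of n x"
  show "cr_wt (Sigma_crystal n lam) ?y = cr_wt (B_crystal n lam) x"
    by (simp add: B_crystal_def Sigma_crystal_def Sigma_wt_family_of)
  fix i assume i: "i \<in> {1..n}"
  have eps: "Sigma_eps n lam i ?y = B_eps n i x"
    using Sigma_sigma0_le[OF i x(2)] Sigma_sigma_max_eq[OF i x(2)] B_eps_eq[OF i]
    by (simp add: Sigma_eps_def)
  then show "cr_eps (Sigma_crystal n lam) i ?y = cr_eps (B_crystal n lam) i x"
    by (simp add: B_crystal_def Sigma_crystal_def)
  from eps show "cr_phi (Sigma_crystal n lam) i ?y = cr_phi (B_crystal n lam) i x"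
    by (simp add: B_crystal_def Sigma_crystal_def Sigma_wt_family_of)
  have rows: "(j, i) \<in> tri n" if "j \<in> argmax_rows n i ?y" for j
    using that i by (auto simp: argmax_rows_def tri_def)
  have max: "(Max (argmax_rows n i ?y), i) \<in> tri n"
    by (rule rows) (use argmax_rows_nonempty[OF i] argmax_rows_finite in \<open>rule Max_in[rotated]\<close>)
  have min: "(Min (argmax_rows n i ?y), i) \<in> tri n"
    by (rule rows) (use argmax_rows_nonempty[OF i] argmax_rows_finite in \<open>rule Min_in[rotated]\<close>)
  \<comment> \<open>On the set \<open>Sigma_sigma0\<close> never exceeds the maximum, so the guard
    of \<open>Sigma_e\<close> amounts to positivity, which is the membership test of
    \<open>B_e\<close>.\<close>
  have "Sigma_e n lam i ?y = map_option (family_of n) (B_e n lam i x)"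
  proof -
    let ?p = "(Max (argmax_rows n i ?y), i)"
    have "x ! word_pos n ?p = ?y ?p" using max by (simp add: family_of_def)
    then show ?thesis
      using lower_mem_iff[OF i x(2)] Sigma_sigma0_le[OF i x(2)] Sigma_M_pos[OF i x(2)]
      by (auto simp: B_e_def Sigma_e_def Let_def Max_B_M[OF i] B x(1) family_of_update[OF max x(1)])
  qed
  then show "cr_e (Sigma_crystal n lam) i ?y = map_option (family_of n) (cr_e (B_crystal n lam) i x)"
    by (simp add: B_crystal_def Sigma_crystal_def)
  have "Sigma_f n lam i ?y = map_option (family_of n) (B_f n lam i x)"
  proof -
    let ?p = "(Min (argmax_rows n i ?y), i)"
    have "x ! word_pos n ?p = ?y ?p" using min by (simp add: family_of_def)
    then show ?thesis
      using raise_mem_iff[OF i x(2)]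
      by (auto simp: B_f_def Sigma_f_def Let_def Min_B_M[OF i] B x(1) family_of_update[OF min x(1)]
          Least_Sigma_M[OF i x(2)])
  qed
  then show "cr_f (Sigma_crystal n lam) i ?y = map_option (family_of n) (cr_f (B_crystal n lam) i x)"
    by (simp add: B_crystal_def Sigma_crystal_def)
qed

section \<open>Characters and the projection onto the unipotent radical\<close>

lemma det_mat_diag: "det (mat_diag n d) = (\<Prod>p<n. d p)"
proof -
  have "det (mat_diag n d) = prod_list (diag_mat (mat_diag n d))"
    by (rule det_upper_triangular[of _ n]) (auto simp: mat_diag_def)
  also have "\<dots> = (\<Prod>p<n. d p)"
    by (simp add: prod_list_diag_prod atLeast0LessThan mat_diag_def)
  finally show ?thesis .
qed

lemma carrier_SL: "g \<in> carrier (SL n) \<longleftrightarrow> g \<in> carrier_mat (Suc n) (Suc n) \<and> det g = 1"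
  by (simp add: SL_def)

lemma mult_SL [simp]: "mult (SL n) = (*)" and one_SL [simp]: "one (SL n) = 1\<^sub>m (Suc n)"
  by (simp_all add: SL_def)

lemma group_SL: "group (SL n)"
proof (rule groupI)
  fix g assume g: "g \<in> carrier (SL n)"
  then have c: "g \<in> carrier_mat (Suc n) (Suc n)" and d: "det g = 1" by (auto simp: carrier_SL)
  have prod: "adj_mat g * g = 1\<^sub>m (Suc n)" using adj_mat(3)[OF c] d by (intro eq_matI) auto
  then have "det (adj_mat g) = 1"
    using det_mult[OF adj_mat(1)[OF c] c] d by simp
  with prod show "\<exists>h\<in>carrier (SL n). h \<otimes>\<^bsub>SL n\<^esub> g = \<one>\<^bsub>SL n\<^esub>"
    using adj_mat(1)[OF c] by (intro bexI[of _ "adj_mat g"]) (auto simp: carrier_SL)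
next
  fix g h assume "g \<in> carrier (SL n)" "h \<in> carrier (SL n)"
  then show "g \<otimes>\<^bsub>SL n\<^esub> h \<in> carrier (SL n)"
    using det_mult[of g "Suc n" h] by (auto simp: carrier_SL)
qed (auto simp: carrier_SL)

interpretation SL: group "SL n" for n
  by (rule group_SL)

lemma SL_carrier_mat: "g \<in> carrier (SL n) \<Longrightarrow> g \<in> carrier_mat (Suc n) (Suc n)"
  by (simp add: carrier_SL)

lemma SL_mult_closed: "g \<in> carrier (SL n) \<Longrightarrow> h \<in> carrier (SL n) \<Longrightarrow> g * h \<in> carrier (SL n)"
  using SL.m_closed[of g n h] by simp

lemma SL_inv_mult: "g \<in> carrier (SL n) \<Longrightarrow> inv\<^bsub>SL n\<^esub> g * g = 1\<^sub>m (Suc n)"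
  and SL_mult_inv: "g \<in> carrier (SL n) \<Longrightarrow> g * inv\<^bsub>SL n\<^esub> g = 1\<^sub>m (Suc n)"
  using SL.l_inv[of g n] SL.r_inv[of g n] by simp_all

lemma SL_inv_eqI:
  "g \<in> carrier (SL n) \<Longrightarrow> h \<in> carrier_mat (Suc n) (Suc n) \<Longrightarrow> h * g = 1\<^sub>m (Suc n) \<Longrightarrow> inv\<^bsub>SL n\<^esub> g = h"
  using det_mult[of h "Suc n" g] by (intro SL.inv_equality) (auto simp: carrier_SL)

lemma mat_mult_index:
  assumes "A \<in> carrier_mat m k" "B \<in> carrier_mat k l" "i < m" "j < l"
  shows "(A * B) $$ (i,j) = (\<Sum>r<k. A $$ (i,r) * B $$ (r,j))"
  using assms by (simp add: scalar_prod_def atLeast0LessThan)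

lemma upper_triangular_iff:
  "A \<in> carrier_mat m m \<Longrightarrow> upper_triangular A \<longleftrightarrow> (\<forall>i<m. \<forall>j<i. A $$ (i,j) = 0)"
  by (auto simp: upper_triangular_def)

lemma lower_triangular_iff:
  "A \<in> carrier_mat m m \<Longrightarrow> upper_triangular (transpose_mat A) \<longleftrightarrow> (\<forall>i<m. \<forall>j<m. i < j \<longrightarrow> A $$ (i,j) = 0)"
  by (auto simp: upper_triangular_def)

lemma unip_plus_iff:
  "u \<in> unip_plus n \<longleftrightarrow> u \<in> carrier_mat (Suc n) (Suc n) \<and>
     (\<forall>i\<le>n. \<forall>j<i. u $$ (i,j) = 0) \<and> (\<forall>i\<le>n. u $$ (i,i) = 1)" (is "_ \<longleftrightarrow> ?R")
proof
  assume "u \<in> unip_plus n"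
  then show ?R by (auto simp: unip_plus_def carrier_SL upper_triangular_iff less_Suc_eq_le)
next
  assume R: ?R
  then have up: "upper_triangular u" by (auto simp: upper_triangular_def)
  moreover have "det u = 1"
    using R det_upper_triangular[OF up, of "Suc n"]
    by (auto simp: prod_list_diag_prod less_Suc_eq_le)
  ultimately show "u \<in> unip_plus n" using R by (simp add: unip_plus_def carrier_SL)
qed

lemma unip_plus_SL: "u \<in> unip_plus n \<Longrightarrow> u \<in> carrier (SL n)"
  by (simp add: unip_plus_def)

lemma borel_minus_iff:
  "b \<in> borel_minus n \<longleftrightarrow> b \<in> carrier (SL n) \<and> (\<forall>i\<le>n. \<forall>j\<le>n. i < j \<longrightarrow> b $$ (i,j) = 0)"
  unfolding borel_minus_def using lower_triangular_iff[of b "Suc n"]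
  by (auto simp: carrier_SL less_Suc_eq_le)

lemma borel_minusI:
  assumes "b \<in> carrier_mat (Suc n) (Suc n)" "\<And>i j. i \<le> n \<Longrightarrow> j \<le> n \<Longrightarrow> i < j \<Longrightarrow> b $$ (i,j) = 0"
    and "u \<in> unip_plus n" "b * u \<in> carrier (SL n)"
  shows "b \<in> borel_minus n"
  using assms unip_plus_SL[OF assms(3)] det_mult[of b "Suc n" u]
  by (auto simp: borel_minus_iff carrier_SL)

lemma borel_minus_diag_nonzero:
  assumes "b \<in> borel_minus n" "i \<le> n"
  shows "b $$ (i,i) \<noteq> 0"
proof
  assume "b $$ (i,i) = 0"
  have c: "b \<in> carrier_mat (Suc n) (Suc n)" using assms by (auto simp: borel_minus_iff carrier_SL)
  have "det b = prod_list (diag_mat b)"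
    using assms c by (intro det_lower_triangular[of "Suc n"]) (auto simp: borel_minus_iff)
  also have "\<dots> = 0" unfolding prod_list_diag_prod
    by (rule prod_zero) (use \<open>b $$ (i,i) = 0\<close> c assms(2) in \<open>auto intro!: bexI[of _ i]\<close>)
  finally show False using assms by (simp add: borel_minus_iff carrier_SL)
qed

text \<open>Forward substitution along the rows: in the product entry \<open>(i,j)\<close> the terms
  before \<open>i\<close> vanish by induction and those after \<open>i\<close> by triangularity of
  \<open>A\<close>, which leaves the diagonal term. Applied to transposes, it also handles upper
  triangular matrices.\<close>

lemma lower_triangular_cancel:
  assumes A: "A \<in> carrier_mat m m" "\<And>i j. j < m \<Longrightarrow> i < j \<Longrightarrow> A $$ (i,j) = 0"
    and diag: "\<And>i. i < m \<Longrightarrow> A $$ (i,i) \<noteq> (0::complex)"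
    and B: "B \<in> carrier_mat m m" and AB: "\<And>i j. j < m \<Longrightarrow> i < j \<Longrightarrow> (A * B) $$ (i,j) = 0"
  shows "j < m \<Longrightarrow> i < j \<Longrightarrow> B $$ (i,j) = 0"
proof (induction i rule: less_induct)
  case (less i)
  have "0 = (\<Sum>r<m. A $$ (i,r) * B $$ (r,j))"
    using AB[OF less.prems] mat_mult_index[OF A(1) B, of i j] less.prems by simp
  also have "\<dots> = (\<Sum>r\<in>{i}. A $$ (i,r) * B $$ (r,j))"
  proof (rule sum.mono_neutral_right)
    show "\<forall>r\<in>{..<m} - {i}. A $$ (i,r) * B $$ (r,j) = 0"
    proof
      fix r assume r: "r \<in> {..<m} - {i}"
      show "A $$ (i,r) * B $$ (r,j) = 0"
        using r A(2)[of r i] less.IH[of r] less.prems by (cases "r < i") auto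
    qed
  qed (use less.prems in auto)
  finally show ?case using diag[of i] less.prems by simp
qed

text \<open>Uniqueness behind the description operator: for two factorizations, \<open>M\<close> =
  u' u^-1 satisfies b' \<open>M\<close> = b, hence is lower triangular, and \<open>M\<close> u = u',
  hence is upper unitriangular. So it is the identity.\<close>

lemma pi_plus_eq:
  assumes b: "b \<in> borel_minus n" and u: "u \<in> unip_plus n" and g: "g = b * u"
  shows "pi_plus n g = u"
  unfolding pi_plus_def
proof (rule the_equality)
  show "u \<in> unip_plus n \<and> (\<exists>b\<in>borel_minus n. g = b * u)" using assms by blast
  fix u' assume "u' \<in> unip_plus n \<and> (\<exists>b'\<in>borel_minus n. g = b' * u')"
  then obtain b' where u': "u' \<in> unip_plus n" and b': "b' \<in> borel_minus n" and g': "g = b' * u'" by blast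
  let ?N = "Suc n"
  have c [simp]: "u \<in> carrier_mat ?N ?N" "u' \<in> carrier_mat ?N ?N" "b \<in> carrier_mat ?N ?N" "b' \<in> carrier_mat ?N ?N"
    using u u' b b' by (auto simp: unip_plus_iff borel_minus_iff carrier_SL)
  define v where "v = inv\<^bsub>SL n\<^esub> u"
  have v: "v \<in> carrier (SL n)" using unip_plus_SL[OF u] by (simp add: v_def)
  then have cv [simp]: "v \<in> carrier_mat ?N ?N" by (simp add: carrier_SL)
  have uv: "u * v = 1\<^sub>m ?N" "v * u = 1\<^sub>m ?N"
    using SL_mult_inv[OF unip_plus_SL[OF u]] SL_inv_mult[OF unip_plus_SL[OF u]] by (auto simp: v_def)
  define M where "M = u' * v"
  have cM [simp]: "M \<in> carrier_mat ?N ?N" by (simp add: M_def mult_carrier_mat[of _ ?N ?N])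
  have "b' * M = (b' * u') * v" by (simp add: M_def assoc_mult_mat[of _ ?N ?N _ ?N _ ?N])
  also have "\<dots> = b * (u * v)" using g g' by (simp add: assoc_mult_mat[of _ ?N ?N _ ?N _ ?N])
  finally have bM: "b' * M = b" by (simp add: uv right_mult_one_mat[of _ ?N ?N])
  have Mu: "M * u = u'"
    by (simp add: M_def assoc_mult_mat[of _ ?N ?N _ ?N _ ?N] uv right_mult_one_mat[of _ ?N ?N])
  have lower: "M $$ (i,j) = 0" if "j \<le> n" "i < j" for i j
    using b b' that bM borel_minus_diag_nonzero[OF b']
    by (intro lower_triangular_cancel[of b' ?N M]) (auto simp: borel_minus_iff)
  have "transpose_mat u * transpose_mat M = transpose_mat u'"
    using transpose_mult[of M ?N ?N u ?N] Mu by simp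
  then have "transpose_mat M $$ (i,j) = 0" if "j \<le> n" "i < j" for i j
    using u u' that
    by (intro lower_triangular_cancel[of "transpose_mat u" ?N "transpose_mat M"])
      (auto simp: unip_plus_iff carrier_matD[OF c(1)] carrier_matD[OF c(2)])
  then have upper: "M $$ (i,j) = 0" if "i \<le> n" "j < i" for i j
    using that carrier_matD[OF cM] by (metis index_transpose_mat(1) le_imp_less_Suc less_trans)
  have diag: "M $$ (i,i) = 1" if "i \<le> n" for i
  proof -
    have "1 = (M * u) $$ (i,i)" using Mu u' that by (simp add: unip_plus_iff)
    also have "\<dots> = (\<Sum>r<?N. M $$ (i,r) * u $$ (r,i))"
      using that by (intro mat_mult_index[of _ ?N _ _ ?N]) auto
    also have "\<dots> = (\<Sum>r\<in>{i}. M $$ (i,r) * u $$ (r,i))"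
    proof (rule sum.mono_neutral_right)
      show "\<forall>r\<in>{..<?N} - {i}. M $$ (i,r) * u $$ (r,i) = 0"
      proof
        fix r assume r: "r \<in> {..<?N} - {i}"
        then show "M $$ (i,r) * u $$ (r,i) = 0"
          using lower[of r i] upper[of i r] that by (cases "r < i") auto
      qed
    qed (use that in auto)
    finally show ?thesis using u that by (simp add: unip_plus_iff)
  qed
  have "M = 1\<^sub>m ?N"
  proof (rule eq_matI)
    fix i j assume "i < dim_row (1\<^sub>m ?N)" "j < dim_col (1\<^sub>m ?N)"
    then show "M $$ (i,j) = 1\<^sub>m ?N $$ (i,j)"
      using lower[of j i] upper[of i j] diag[of i] by (cases i j rule: linorder_cases) auto
  qed (use carrier_matD[OF cM] in auto)
  then show "u' = u" using Mu by (simp add: left_mult_one_mat[of _ ?N ?N])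
qed

section \<open>Root subgroups and the characters of U\<close>

lemma mat_exp_square_zero:
  assumes A: "A \<in> carrier_mat m m" and sq: "A * A = 0\<^sub>m m m"
  shows "mat_exp A = 1\<^sub>m m + A"
proof (rule eq_matI)
  have pow: "A ^\<^sub>m (k + 2) = 0\<^sub>m m m" for k
  proof (induction k)
    case 0
    then show ?case using A sq by (simp add: numeral_2_eq_2)
  next
    case (Suc k)
    then show ?case using A by simp
  qed
  fix p q assume "p < dim_row (1\<^sub>m m + A)" "q < dim_col (1\<^sub>m m + A)"
  then have pq: "p < m" "q < m" using A by auto
  have "(\<Sum>k. (A ^\<^sub>m k) $$ (p,q) / fact k) = (\<Sum>k\<in>{0,1}. (A ^\<^sub>m k) $$ (p,q) / fact k)"
  proof (rule suminf_finite)
    fix k assume "k \<notin> {0,1::nat}"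
    then have "k = (k - 2) + 2" by auto
    then obtain l where "k = l + 2" by blast
    then show "(A ^\<^sub>m k) $$ (p,q) / fact k = 0" using pow pq by simp
  qed simp
  also have "\<dots> = (1\<^sub>m m + A) $$ (p,q)" using A pq by (simp add: left_mult_one_mat)
  finally show "mat_exp A $$ (p,q) = (1\<^sub>m m + A) $$ (p,q)"
    using A pq by (simp add: mat_exp_def)
qed (use A in \<open>auto simp: mat_exp_def\<close>)

text \<open>As elementary matrices the exponentials act by row operations, which
  \<open>addrow_mat\<close> evaluates without sums.\<close>

lemma x_elt_eq:
  assumes "i \<in> {1..n}"
  shows "x_elt n i c = addrow_mat (Suc n) c (i - 1) i"
proof -
  have "(c \<cdot>\<^sub>m e_mat n i) * (c \<cdot>\<^sub>m e_mat n i) = 0\<^sub>m (Suc n) (Suc n)"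
    using assms by (intro eq_matI) (auto simp: e_mat_def scalar_prod_def intro!: sum.neutral)
  then have "x_elt n i c = 1\<^sub>m (Suc n) + c \<cdot>\<^sub>m e_mat n i"
    unfolding x_elt_def by (intro mat_exp_square_zero) (auto simp: e_mat_def)
  also have "\<dots> = addrow_mat (Suc n) c (i - 1) i"
    using assms by (intro eq_matI) (auto simp: e_mat_def addrow_mat_def)
  finally show ?thesis .
qed

lemma y_elt_eq:
  assumes "i \<in> {1..n}"
  shows "y_elt n i c = addrow_mat (Suc n) c i (i - 1)"
proof -
  have "(c \<cdot>\<^sub>m f_mat n i) * (c \<cdot>\<^sub>m f_mat n i) = 0\<^sub>m (Suc n) (Suc n)"
    using assms by (intro eq_matI) (auto simp: f_mat_def scalar_prod_def intro!: sum.neutral)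
  then have "y_elt n i c = 1\<^sub>m (Suc n) + c \<cdot>\<^sub>m f_mat n i"
    unfolding y_elt_def by (intro mat_exp_square_zero) (auto simp: f_mat_def)
  also have "\<dots> = addrow_mat (Suc n) c i (i - 1)"
    using assms by (intro eq_matI) (auto simp: f_mat_def addrow_mat_def)
  finally show ?thesis .
qed

lemma addrow_mat_SL: "k \<noteq> l \<Longrightarrow> k \<le> n \<Longrightarrow> l \<le> n \<Longrightarrow> addrow_mat (Suc n) c k l \<in> carrier (SL n)"
  by (simp add: carrier_SL det_addrow_mat)

lemma addrow_mat_unip_plus: "k < l \<Longrightarrow> l \<le> n \<Longrightarrow> addrow_mat (Suc n) c k l \<in> unip_plus n"
  by (auto simp: unip_plus_iff addrow_mat_def)

lemma superdiag_mult:
  assumes u: "u \<in> unip_plus n" and v: "v \<in> unip_plus n" and i: "i < n"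
  shows "(u * v) $$ (i, Suc i) = u $$ (i, Suc i) + v $$ (i, Suc i)"
proof -
  have "(u * v) $$ (i, Suc i) = (\<Sum>r<Suc n. u $$ (i,r) * v $$ (r, Suc i))"
    using u v i by (intro mat_mult_index[of _ "Suc n" _ _ "Suc n"]) (auto simp: unip_plus_iff)
  also have "\<dots> = (\<Sum>r\<in>{i, Suc i}. u $$ (i,r) * v $$ (r, Suc i))"
  proof (rule sum.mono_neutral_right)
    show "\<forall>r\<in>{..<Suc n} - {i, Suc i}. u $$ (i,r) * v $$ (r, Suc i) = 0"
    proof
      fix r assume "r \<in> {..<Suc n} - {i, Suc i}"
      then show "u $$ (i,r) * v $$ (r, Suc i) = 0"
        using u v i by (cases "r < i") (auto simp: unip_plus_iff)
    qed
  qed (use i in auto)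
  finally show ?thesis using u v i by (simp add: unip_plus_iff)
qed

text \<open>Existence of the character; with \<open>is_char_unique\<close> it turns the
  \<open>SOME\<close> in \<open>chi\<close> into a matrix entry.\<close>

lemma is_char_superdiag:
  assumes i: "i \<in> {1..n}"
  shows "is_char n i (\<lambda>u. u $$ (i - 1, i))"
proof -
  have "x_elt n j c $$ (i - 1, i) = (if i = j then c else 0)" if "j \<in> {1..n}" for j c
    using that i by (auto simp: x_elt_eq addrow_mat_def)
  then show ?thesis using superdiag_mult[of _ n _ "i - 1"] i by (auto simp: is_char_def)
qed

text \<open>A root subgroup for a non-simple root consists of commutators:
  \<open>?A * ?B = ?E * (?B * ?A)\<close>. An additive character therefore kills it.\<close>

lemma is_char_root_subgroup:
  assumes chi: "is_char n i \<chi>" and kl: "k < l" "l \<le> n"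
  shows "\<chi> (addrow_mat (Suc n) c k l) = (if i = l \<and> l = Suc k then c else 0)"
proof (cases "l = Suc k")
  case True
  have "\<chi> (x_elt n l c) = (if i = l then c else 0)"
    using chi kl by (auto simp: is_char_def)
  then show ?thesis using True kl by (simp add: x_elt_eq)
next
  case False
  let ?E = "addrow_mat (Suc n) c k l" and ?A = "addrow_mat (Suc n) c k (l - 1)"
    and ?B = "addrow_mat (Suc n) 1 (l - 1) l"
  have mem: "?E \<in> unip_plus n" "?A \<in> unip_plus n" "?B \<in> unip_plus n"
    using kl False by (auto intro!: addrow_mat_unip_plus)
  have BA: "?B * ?A \<in> unip_plus n"
    using kl False by (subst addrow_mat[symmetric, of _ _ "Suc n"]) (auto simp: unip_plus_iff addrow_mat_def)
  have "?A * ?B = ?E * (?B * ?A)"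
    using kl False
    by (subst (1 2 3) addrow_mat[symmetric, of _ "Suc n" "Suc n"]) (auto simp: mat_addrow_def addrow_mat_def intro!: eq_matI)
  moreover have "\<chi> (g * h) = \<chi> g + \<chi> h" if "g \<in> unip_plus n" "h \<in> unip_plus n" for g h
    using chi that by (simp add: is_char_def)
  ultimately have "\<chi> ?A + \<chi> ?B = \<chi> ?E + (\<chi> ?B + \<chi> ?A)"
    using mem BA by metis
  then show ?thesis using False by simp
qed

lemma is_char_unique:
  assumes chi: "is_char n i \<chi>" and i: "i \<in> {1..n}" and u: "u \<in> unip_plus n"
  shows "\<chi> u = u $$ (i - 1, i)"
proof -
  \<comment> \<open>\<open>u\<close> is built up from the identity by inserting its entries column by column, from the left
    and from the top; each insertion is the left multiplication by an elementary matrix.\<close>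
  define v where "v m r = mat (Suc n) (Suc n)
    (\<lambda>(p,q). if q < m \<or> q = m \<and> p < r then u $$ (p,q) else if p = q then 1 else 0)" for m r
  have up: "u $$ (p,q) = 0" if "p \<le> n" "q < p" for p q using u that by (simp add: unip_plus_iff)
  have dg: "u $$ (p,p) = 1" if "p \<le> n" for p using u that by (simp add: unip_plus_iff)
  have i1: "i - 1 < n" using i by auto
  have mem: "v m r \<in> unip_plus n" for m r by (auto simp: unip_plus_iff v_def up dg)
  have "v 0 0 = 1\<^sub>m (Suc n)" by (intro eq_matI) (auto simp: v_def)
  moreover have "\<chi> (1\<^sub>m (Suc n)) = \<chi> (1\<^sub>m (Suc n)) + \<chi> (1\<^sub>m (Suc n))"
    using chi mem[of 0 0] calculation unfolding is_char_def
    by (metis left_mult_one_mat one_carrier_mat)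
  ultimately have base: "\<chi> (v 0 0) = 0" by simp
  have next_row: "v m (Suc r) = addrow_mat (Suc n) (u $$ (r,m)) r m * v m r" if "r < m" "m \<le> n" for m r
    using that by (subst addrow_mat[symmetric, of _ "Suc n" "Suc n"])
      (auto simp: v_def mat_addrow_def up dg intro!: eq_matI)
  have step: "\<chi> (v m r) = v m r $$ (i - 1, i)" if "\<chi> (v m 0) = v m 0 $$ (i - 1, i)" "r \<le> m" "m \<le> n" for m r
    using that(2)
  proof (induction r)
    case (Suc r)
    then have r: "r < m" by simp
    let ?E = "addrow_mat (Suc n) (u $$ (r,m)) r m"
    have E: "?E \<in> unip_plus n" using r that by (intro addrow_mat_unip_plus)
    have "\<chi> (v m (Suc r)) = \<chi> ?E + \<chi> (v m r)"
      using chi E mem next_row[OF r that(3)] by (simp add: is_char_def)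
    also have "\<chi> ?E = ?E $$ (i - 1, i)"
      using is_char_root_subgroup[OF chi r that(3), of "u $$ (r,m)"] i r that by (auto simp: addrow_mat_def)
    also have "?E $$ (i - 1, i) + \<chi> (v m r) = v m (Suc r) $$ (i - 1, i)"
      using Suc.IH r superdiag_mult[OF E mem i1, of m r] next_row[OF r that(3)] i
      by (simp del: index_mat_addrow_mat)
    finally show ?case .
  qed (use that in simp)
  have col: "v m m = v (Suc m) 0" if "m \<le> n" for m
    by (intro eq_matI) (auto simp: v_def up dg less_Suc_eq)
  have "m \<le> Suc n \<Longrightarrow> \<chi> (v m 0) = v m 0 $$ (i - 1, i)" for m
  proof (induction m)
    case 0
    then show ?case using base i i1 by (auto simp: v_def)
  next
    case (Suc m)
    then show ?case using step[of m m] col[of m] by simp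
  qed
  from this[of "Suc n"] have "\<chi> (v (Suc n) 0) = v (Suc n) 0 $$ (i - 1, i)" by simp
  moreover have "v (Suc n) 0 = u" using u by (intro eq_matI) (auto simp: v_def unip_plus_iff)
  ultimately show ?thesis by simp
qed

lemma chi_st_eq: "u \<in> unip_plus n \<Longrightarrow> chi_st n u = (\<Sum>i<n. u $$ (i, Suc i))"
proof -
  assume u: "u \<in> unip_plus n"
  have "chi n i u = u $$ (i - 1, i)" if "i \<in> {1..n}" for i
    unfolding chi_def using is_char_unique[OF someI[of "is_char n i", OF is_char_superdiag[OF that]] that u] .
  then have "chi_st n u = (\<Sum>i\<in>{1..n}. u $$ (i - 1, i))" by (simp add: chi_st_def)
  also have "\<dots> = (\<Sum>i<n. u $$ (i, Suc i))"
    by (rule sum.reindex_bij_witness[of _ Suc "\<lambda>i. i - 1"]) auto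
  finally show ?thesis .
qed

section \<open>The anti-automorphism\<close>

definition sign_mat :: "nat \<Rightarrow> complex mat" where
  "sign_mat n = mat_diag (Suc n) (\<lambda>p. (-1) ^ p)"

lemma sign_mat_carrier [simp]: "sign_mat n \<in> carrier_mat (Suc n) (Suc n)"
  by (simp add: sign_mat_def)

lemma sign_mat_square: "sign_mat n * sign_mat n = 1\<^sub>m (Suc n)"
  by (simp add: sign_mat_def flip: power_mult_distrib)

lemma sign_conj_index:
  assumes "A \<in> carrier_mat (Suc n) (Suc n)" "i \<le> n" "j \<le> n"
  shows "(sign_mat n * A * sign_mat n) $$ (i,j) = (-1) ^ (i + j) * A $$ (i,j)"
  using assms
  by (simp add: sign_mat_def mat_diag_mult_left[of _ _ "Suc n"] mat_diag_mult_right[of _ "Suc n"]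
      power_add mult_ac)

definition eta_conj :: "nat \<Rightarrow> complex mat \<Rightarrow> complex mat" where
  "eta_conj n g = sign_mat n * inv\<^bsub>SL n\<^esub> g * sign_mat n"

lemma sign_conj_mult:
  assumes A: "A \<in> carrier_mat (Suc n) (Suc n)" and B: "B \<in> carrier_mat (Suc n) (Suc n)"
  shows "sign_mat n * (A * B) * sign_mat n =
    (sign_mat n * A * sign_mat n) * (sign_mat n * B * sign_mat n)"
proof -
  let ?N = "Suc n" and ?J = "sign_mat n"
  note a = assoc_mult_mat[of _ ?N ?N _ ?N _ ?N] mult_carrier_mat[of _ ?N ?N _ ?N]
  have "(?J * A * ?J) * (?J * B * ?J) = ?J * A * ((?J * ?J) * (B * ?J))"
    using A B by (simp add: a)
  also have "\<dots> = ?J * (A * B) * ?J"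
    using A B by (simp add: sign_mat_square a left_mult_one_mat[of _ ?N ?N])
  finally show ?thesis by simp
qed

lemma sign_conj_one: "sign_mat n * 1\<^sub>m (Suc n) * sign_mat n = 1\<^sub>m (Suc n)"
  by (simp add: right_mult_one_mat[of _ "Suc n" "Suc n"] sign_mat_square)

lemma sign_conj_conj:
  assumes "A \<in> carrier_mat (Suc n) (Suc n)"
  shows "sign_mat n * (sign_mat n * A * sign_mat n) * sign_mat n = A"
proof -
  let ?N = "Suc n" and ?J = "sign_mat n"
  note a = assoc_mult_mat[of _ ?N ?N _ ?N _ ?N] mult_carrier_mat[of _ ?N ?N _ ?N]
  have "?J * (?J * A * ?J) * ?J = (?J * ?J) * (A * (?J * ?J))"
    using assms by (simp add: a)
  then show ?thesis
    using assms by (simp add: sign_mat_square left_mult_one_mat[of _ ?N ?N] right_mult_one_mat[of _ ?N ?N])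
qed

lemma sign_conj_SL:
  assumes "A \<in> carrier (SL n)"
  shows "sign_mat n * A * sign_mat n \<in> carrier (SL n)"
proof -
  let ?N = "Suc n" and ?J = "sign_mat n"
  have A: "A \<in> carrier_mat ?N ?N" "det A = 1" using assms by (auto simp: carrier_SL)
  have "det (?J * A * ?J) = det ?J * det ?J"
    using A det_mult[of "?J * A" ?N ?J] det_mult[of ?J ?N A] by (simp add: mult_carrier_mat[of _ ?N ?N])
  also have "\<dots> = 1" using det_mult[of ?J ?N ?J] by (simp add: sign_mat_square)
  finally show ?thesis using A by (simp add: carrier_SL mult_carrier_mat[of _ ?N ?N])
qed

text \<open>As \<open>sign_mat\<close> is an involution, conjugating the inverse of \<open>g\<close>
  inverts the conjugate of \<open>g\<close>. Images can thus be verified by a single product, with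
  no inverse to compute.\<close>

lemma eta_conj_eqI:
  assumes "g \<in> carrier (SL n)" "h \<in> carrier_mat (Suc n) (Suc n)"
    and "h * (sign_mat n * g * sign_mat n) = 1\<^sub>m (Suc n)"
  shows "eta_conj n g = h"
proof -
  let ?N = "Suc n" and ?J = "sign_mat n"
  have g: "g \<in> carrier_mat ?N ?N" using assms by (simp add: carrier_SL)
  have JgJ: "?J * g * ?J \<in> carrier_mat ?N ?N" using g by (simp add: mult_carrier_mat[of _ ?N ?N])
  have "(?J * h * ?J) * g = (?J * h * ?J) * (?J * (?J * g * ?J) * ?J)"
    using sign_conj_conj[OF g] by simp
  also have "\<dots> = 1\<^sub>m ?N"
    using sign_conj_mult[OF assms(2) JgJ] assms(3) sign_conj_one by simp
  finally have "inv\<^bsub>SL n\<^esub> g = ?J * h * ?J"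
    using assms by (intro SL_inv_eqI) (auto intro!: mult_carrier_mat)
  then show ?thesis using sign_conj_conj[OF assms(2)] by (simp add: eta_conj_def)
qed

lemma eta_conj_SL: "g \<in> carrier (SL n) \<Longrightarrow> eta_conj n g \<in> carrier (SL n)"
  unfolding eta_conj_def by (intro sign_conj_SL SL.inv_closed)

lemma eta_conj_mult:
  "g \<in> carrier (SL n) \<Longrightarrow> h \<in> carrier (SL n) \<Longrightarrow> eta_conj n (g * h) = eta_conj n h * eta_conj n g"
  using SL.inv_mult_group[of g n h] sign_conj_mult[of "inv\<^bsub>SL n\<^esub> h" n "inv\<^bsub>SL n\<^esub> g"]
  by (simp add: eta_conj_def SL_carrier_mat)

lemma eta_conj_eta_conj:
  assumes g: "g \<in> carrier (SL n)"
  shows "eta_conj n (eta_conj n g) = g"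
proof (rule eta_conj_eqI)
  have "sign_mat n * eta_conj n g * sign_mat n = inv\<^bsub>SL n\<^esub> g"
    unfolding eta_conj_def using g by (intro sign_conj_conj) (auto intro: SL_carrier_mat)
  then show "g * (sign_mat n * eta_conj n g * sign_mat n) = 1\<^sub>m (Suc n)"
    using g by (simp add: SL_mult_inv)
qed (use g eta_conj_SL in \<open>auto intro: SL_carrier_mat\<close>)

lemma torus_index: "t \<in> torus n \<Longrightarrow> i \<le> n \<Longrightarrow> j \<le> n \<Longrightarrow> i \<noteq> j \<Longrightarrow> t $$ (i,j) = 0"
  by (auto simp: torus_def carrier_SL diagonal_mat_def)

lemma torus_SL: "t \<in> torus n \<Longrightarrow> t \<in> carrier (SL n)"
  by (simp add: torus_def)

lemma torus_eq_mat_diag: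
  assumes "t \<in> torus n"
  shows "t = mat_diag (Suc n) (\<lambda>p. t $$ (p,p))"
  using assms SL_carrier_mat[OF torus_SL[OF assms]] torus_index[OF assms]
  by (intro eq_matI) (auto simp: mat_diag_def less_Suc_eq_le)

lemma torus_diag_nonzero: "t \<in> torus n \<Longrightarrow> i \<le> n \<Longrightarrow> t $$ (i,i) \<noteq> 0"
  using torus_index[of t n]
  by (intro borel_minus_diag_nonzero[of t n]) (auto simp: borel_minus_iff torus_SL)

lemma torus_inv:
  assumes t: "t \<in> torus n"
  shows "inv\<^bsub>SL n\<^esub> t = mat_diag (Suc n) (\<lambda>p. inverse (t $$ (p,p)))"
proof (rule SL_inv_eqI)
  have "mat_diag (Suc n) (\<lambda>p. inverse (t $$ (p,p))) * t =
      mat_diag (Suc n) (\<lambda>p. inverse (t $$ (p,p))) * mat_diag (Suc n) (\<lambda>p. t $$ (p,p))"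
    using torus_eq_mat_diag[OF t] by simp
  also have "\<dots> = 1\<^sub>m (Suc n)"
    unfolding mat_diag_diag using torus_diag_nonzero[OF t]
    by (intro eq_matI) (auto simp: mat_diag_def less_Suc_eq_le)
  finally show "mat_diag (Suc n) (\<lambda>p. inverse (t $$ (p,p))) * t = 1\<^sub>m (Suc n)" .
qed (use torus_SL[OF t] in auto)

lemma eta_conj_torus:
  assumes t: "t \<in> torus n"
  shows "eta_conj n t = inv\<^bsub>SL n\<^esub> t"
proof -
  have "mat_diag (Suc n) f \<in> carrier_mat (Suc n) (Suc n)" for f :: "nat \<Rightarrow> complex" by simp
  then show ?thesis
    unfolding eta_conj_def torus_inv[OF t] sign_mat_def
    by (simp add: mult.commute[of "(-1) ^ _"] mult.assoc flip: power_mult_distrib)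
qed

text \<open>Inversion negates \<open>c\<close>, and so does conjugation by the signs, because
  \<open>k\<close> and \<open>l\<close> have opposite parity.\<close>

lemma eta_conj_root_subgroup:
  assumes kl: "k \<le> n" "l \<le> n" "l = Suc k \<or> k = Suc l"
  shows "eta_conj n (addrow_mat (Suc n) c k l) = addrow_mat (Suc n) c k l"
proof (rule eta_conj_eqI)
  let ?E = "addrow_mat (Suc n) c k l" and ?J = "sign_mat n"
  show "?E \<in> carrier (SL n)" using kl by (intro addrow_mat_SL) auto
  have "?J * ?E * ?J = addrow_mat (Suc n) (- c) k l"
  proof (rule eq_matI)
    fix i j assume "i < dim_row (addrow_mat (Suc n) (- c) k l)" "j < dim_col (addrow_mat (Suc n) (- c) k l)"
    then have ij: "i < Suc n" "j < Suc n" by auto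
    then show "(?J * ?E * ?J) $$ (i,j) = addrow_mat (Suc n) (- c) k l $$ (i,j)"
      using kl by (subst sign_conj_index) (auto simp: power_add minus_one_power_iff)
  qed (auto simp: sign_mat_def mat_diag_def)
  then show "?E * (?J * ?E * ?J) = 1\<^sub>m (Suc n)"
    using kl by (simp, subst addrow_mat[symmetric, of _ "Suc n" "Suc n"]) (auto intro!: eq_matI)
qed simp

lemma is_eta_eta_conj: "is_eta n (eta_conj n)"
proof -
  have "bij_betw (eta_conj n) (carrier (SL n)) (carrier (SL n))"
    by (rule bij_betw_byWitness[of _ "eta_conj n"]) (auto simp: eta_conj_eta_conj eta_conj_SL)
  then show ?thesis
    unfolding is_eta_def
    using eta_conj_root_subgroup
    by (auto simp: eta_conj_mult eta_conj_torus x_elt_eq y_elt_eq)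
qed

lemma is_eta_eta: "is_eta n (eta n)"
  unfolding eta_def by (rule someI[of "is_eta n"], rule is_eta_eta_conj)

lemma mat_prod_SL: "set gs \<subseteq> carrier (SL n) \<Longrightarrow> mat_prod n gs \<in> carrier (SL n)"
  by (induction gs) (auto simp: mat_prod_def SL_mult_closed SL.one_closed[simplified])

text \<open>\<open>is_eta\<close> prescribes values on generators only; induction along a product
  carries the agreement over to \<open>Theta_minus\<close>.\<close>

lemma is_eta_agree_mat_prod:
  assumes eta: "is_eta n \<eta>" "is_eta n \<eta>'" and "set gs \<subseteq> carrier (SL n)"
    and "\<And>g. g \<in> set gs \<Longrightarrow> \<eta> g = \<eta>' g"
  shows "\<eta> (mat_prod n gs) = \<eta>' (mat_prod n gs)"
  using assms(3,4)
proof (induction gs)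
  case Nil
  have "1\<^sub>m (Suc n) \<in> torus n" by (auto simp: torus_def carrier_SL diagonal_mat_def)
  then show ?case using eta by (simp add: is_eta_def mat_prod_def)
next
  case (Cons g gs)
  have "mat_prod n (g # gs) = g * mat_prod n gs" by (simp add: mat_prod_def)
  moreover have "mat_prod n gs \<in> carrier (SL n)" using Cons.prems by (intro mat_prod_SL) auto
  ultimately show ?case using eta Cons by (auto simp: is_eta_def)
qed

lemma coroot_torus:
  assumes "i \<in> {1..n}" "c \<noteq> 0"
  shows "coroot n i c \<in> torus n"
proof -
  let ?d = "\<lambda>p. if p = i - 1 then c else if p = i then inverse c else 1"
  have "det (coroot n i c) = (\<Prod>p<Suc n. ?d p)"
    unfolding coroot_def by (rule det_mat_diag)
  also have "\<dots> = (\<Prod>p\<in>{i - 1, i}. ?d p)"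
    using assms by (intro prod.mono_neutral_right) auto
  also have "\<dots> = 1" using assms by (cases i) auto
  finally have "det (coroot n i c) = 1" .
  then show ?thesis
    by (auto simp: torus_def carrier_SL coroot_def diagonal_mat_def) (simp add: mat_diag_def)
qed

lemma y_elt_SL: "i \<in> {1..n} \<Longrightarrow> y_elt n i c \<in> carrier (SL n)"
  by (auto simp: y_elt_eq intro!: addrow_mat_SL)

lemma word_i0_set: "set (word_i0 n) \<subseteq> {1..n}"
  by (induction n) auto

lemma Theta_minus_factorE:
  assumes "length c = length (word_i0 n)" "0 \<notin> set c"
    and "g \<in> set (map2 (\<lambda>i c. y_elt n i c * coroot n i (inverse c)) (word_i0 n) c)"
  obtains i d where "i \<in> {1..n}" "d \<noteq> 0" "g = y_elt n i d * coroot n i (inverse d)"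
proof -
  obtain i d where id: "(i,d) \<in> set (zip (word_i0 n) c)" "g = y_elt n i d * coroot n i (inverse d)"
    using assms(3) by auto
  then have "i \<in> {1..n}" "d \<noteq> 0"
    using word_i0_set[of n] assms(2) set_zip_leftD[OF id(1)] set_zip_rightD[OF id(1)] by auto
  then show ?thesis using that id(2) by blast
qed

lemma y_coroot_SL:
  "i \<in> {1..n} \<Longrightarrow> c \<noteq> 0 \<Longrightarrow> y_elt n i c * coroot n i (inverse c) \<in> carrier (SL n)"
  by (intro SL_mult_closed y_elt_SL torus_SL coroot_torus) auto

lemma Theta_minus_SL:
  assumes "length c = length (word_i0 n)" "0 \<notin> set c"
  shows "Theta_minus n c \<in> carrier (SL n)"
  unfolding Theta_minus_def
proof (rule mat_prod_SL, rule subsetI)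
  fix g assume "g \<in> set (map2 (\<lambda>i c. y_elt n i c * coroot n i (inverse c)) (word_i0 n) c)"
  with assms show "g \<in> carrier (SL n)" by (rule Theta_minus_factorE) (simp add: y_coroot_SL)
qed

lemma eta_torus_Theta:
  assumes t: "t \<in> torus n" and c: "length c = length (word_i0 n)" "0 \<notin> set c"
  shows "eta n (t * Theta_minus n c) = eta_conj n (Theta_minus n c) * inv\<^bsub>SL n\<^esub> t"
proof -
  have agree: "\<eta> (y_elt n i d * coroot n i (inverse d)) = inv\<^bsub>SL n\<^esub> (coroot n i (inverse d)) * y_elt n i d"
    if "i \<in> {1..n}" "d \<noteq> 0" "is_eta n \<eta>" for i d \<eta>
    using that y_elt_SL[of i n d] coroot_torus[of i n "inverse d"]
      torus_SL[OF coroot_torus[of i n "inverse d"]] by (simp add: is_eta_def)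
  have "eta n (Theta_minus n c) = eta_conj n (Theta_minus n c)"
    unfolding Theta_minus_def
  proof (rule is_eta_agree_mat_prod[OF is_eta_eta is_eta_eta_conj])
    show "set (map2 (\<lambda>i c. y_elt n i c * coroot n i (inverse c)) (word_i0 n) c) \<subseteq> carrier (SL n)"
      by (rule subsetI, erule Theta_minus_factorE[OF c]) (simp add: y_coroot_SL)
    fix g assume "g \<in> set (map2 (\<lambda>i c. y_elt n i c * coroot n i (inverse c)) (word_i0 n) c)"
    with c show "eta n g = eta_conj n g"
      by (rule Theta_minus_factorE) (simp add: agree is_eta_eta is_eta_eta_conj)
  qed
  moreover have "eta n (t * Theta_minus n c) = eta n (Theta_minus n c) * eta n t"
    using is_eta_eta[of n] torus_SL[OF t] Theta_minus_SL[OF c] by (simp add: is_eta_def)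
  ultimately show ?thesis using is_eta_eta[of n] t by (simp add: is_eta_def)
qed

section \<open>Ultra-discretization\<close>

text \<open>All values are positive, so nothing cancels and two-sided bounds survive every
  operation. For \<open>s\<close> at most 1 a smaller exponent gives the larger power, so
  \<open>min\<close> governs a sum; in a quotient the lower bound of one part meets the upper bound
  of the other.\<close>

lemma sf_ud_bounds:
  fixes e :: "'v \<Rightarrow> int"
  shows "\<exists>c d. c > 0 \<and> d > 0 \<and> (\<forall>s::real. 0 < s \<longrightarrow> s \<le> 1 \<longrightarrow>
    c * s powr sf_ud e E \<le> sf_eval (\<lambda>v. s powr e v) E \<and>
    sf_eval (\<lambda>v. s powr e v) E \<le> d * s powr sf_ud e E)"
proof (induction E)
  case (Var v)
  show ?case by (intro exI[of _ 1]) auto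
next
  case Unit
  show ?case by (intro exI[of _ 1]) auto
next
  case (Add E F)
  then obtain c d c' d' where pos: "c > 0" "d > 0" "c' > 0" "d' > 0"
    and b: "\<And>s::real. 0 < s \<Longrightarrow> s \<le> 1 \<Longrightarrow>
      c * s powr sf_ud e E \<le> sf_eval (\<lambda>v. s powr e v) E \<and>
      sf_eval (\<lambda>v. s powr e v) E \<le> d * s powr sf_ud e E \<and>
      c' * s powr sf_ud e F \<le> sf_eval (\<lambda>v. s powr e v) F \<and>
      sf_eval (\<lambda>v. s powr e v) F \<le> d' * s powr sf_ud e F" by blast
  show ?case
  proof (rule exI[of _ "min c c'"], rule exI[of _ "d + d'"], intro conjI allI impI)
    fix s :: real assume s: "0 < s" "s \<le> 1"
    note bs = b[OF s]
    have nn: "0 < c * s powr sf_ud e E" "0 < c' * s powr sf_ud e F" using pos s by auto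
    show "min c c' * s powr sf_ud e (Add E F) \<le> sf_eval (\<lambda>v. s powr e v) (Add E F)"
    proof (cases "sf_ud e E \<le> sf_ud e F")
      case True
      then have "min c c' * s powr sf_ud e (Add E F) \<le> c * s powr sf_ud e E"
        by (auto simp: min_def intro!: mult_right_mono)
      then show ?thesis using bs nn by simp
    next
      case False
      then have "min c c' * s powr sf_ud e (Add E F) \<le> c' * s powr sf_ud e F"
        by (auto simp: min_def intro!: mult_right_mono)
      then show ?thesis using bs nn by simp
    qed
    have "d * s powr sf_ud e E \<le> d * s powr sf_ud e (Add E F)"
      "d' * s powr sf_ud e F \<le> d' * s powr sf_ud e (Add E F)"
      using pos s by (auto intro!: mult_left_mono powr_mono')
    then show "sf_eval (\<lambda>v. s powr e v) (Add E F) \<le> (d + d') * s powr sf_ud e (Add E F)"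
      using bs unfolding sf_eval.simps distrib_right by linarith
  qed (use pos in auto)
next
  case (Mul E F)
  then obtain c d c' d' where pos: "c > 0" "d > 0" "c' > 0" "d' > 0"
    and b: "\<And>s::real. 0 < s \<Longrightarrow> s \<le> 1 \<Longrightarrow>
      c * s powr sf_ud e E \<le> sf_eval (\<lambda>v. s powr e v) E \<and>
      sf_eval (\<lambda>v. s powr e v) E \<le> d * s powr sf_ud e E \<and>
      c' * s powr sf_ud e F \<le> sf_eval (\<lambda>v. s powr e v) F \<and>
      sf_eval (\<lambda>v. s powr e v) F \<le> d' * s powr sf_ud e F" by blast
  show ?case
  proof (rule exI[of _ "c * c'"], rule exI[of _ "d * d'"], intro conjI allI impI)
    fix s :: real assume s: "0 < s" "s \<le> 1"
    note bs = b[OF s]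
    have nn: "0 < c * s powr sf_ud e E" "0 < c' * s powr sf_ud e F" using pos s by auto
    have "(c * s powr sf_ud e E) * (c' * s powr sf_ud e F)
       \<le> sf_eval (\<lambda>v. s powr e v) E * sf_eval (\<lambda>v. s powr e v) F"
      using bs nn by (intro mult_mono) auto
    then show "c * c' * s powr sf_ud e (Mul E F) \<le> sf_eval (\<lambda>v. s powr e v) (Mul E F)"
      by (simp add: powr_add mult_ac)
    have "sf_eval (\<lambda>v. s powr e v) E * sf_eval (\<lambda>v. s powr e v) F
       \<le> (d * s powr sf_ud e E) * (d' * s powr sf_ud e F)"
      using bs nn pos by (intro mult_mono) auto
    then show "sf_eval (\<lambda>v. s powr e v) (Mul E F) \<le> d * d' * s powr sf_ud e (Mul E F)"
      by (simp add: powr_add mult_ac)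
  qed (use pos in auto)
next
  case (Div E F)
  then obtain c d c' d' where pos: "c > 0" "d > 0" "c' > 0" "d' > 0"
    and b: "\<And>s::real. 0 < s \<Longrightarrow> s \<le> 1 \<Longrightarrow>
      c * s powr sf_ud e E \<le> sf_eval (\<lambda>v. s powr e v) E \<and>
      sf_eval (\<lambda>v. s powr e v) E \<le> d * s powr sf_ud e E \<and>
      c' * s powr sf_ud e F \<le> sf_eval (\<lambda>v. s powr e v) F \<and>
      sf_eval (\<lambda>v. s powr e v) F \<le> d' * s powr sf_ud e F" by blast
  show ?case
  proof (rule exI[of _ "c / d'"], rule exI[of _ "d / c'"], intro conjI allI impI)
    fix s :: real assume s: "0 < s" "s \<le> 1"
    note bs = b[OF s]
    have nn: "0 < c * s powr sf_ud e E" "0 < c' * s powr sf_ud e F" using pos s by auto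
    have "(c * s powr sf_ud e E) / (d' * s powr sf_ud e F)
       \<le> sf_eval (\<lambda>v. s powr e v) E / sf_eval (\<lambda>v. s powr e v) F"
      using bs nn by (intro frac_le) auto
    then show "c / d' * s powr sf_ud e (Div E F) \<le> sf_eval (\<lambda>v. s powr e v) (Div E F)"
      by (simp add: powr_diff)
    have "sf_eval (\<lambda>v. s powr e v) E / sf_eval (\<lambda>v. s powr e v) F
       \<le> (d * s powr sf_ud e E) / (c' * s powr sf_ud e F)"
      using bs nn pos by (intro frac_le) auto
    then show "sf_eval (\<lambda>v. s powr e v) (Div E F) \<le> d / c' * s powr sf_ud e (Div E F)"
      by (simp add: powr_diff)
  qed (use pos in auto)
qed

lemma sf_ud_le_if_eval_eq:
  fixes e :: "'v \<Rightarrow> int"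
  assumes "\<And>s::real. 0 < s \<Longrightarrow> s \<le> 1 \<Longrightarrow>
    sf_eval (\<lambda>v. s powr e v) E = sf_eval (\<lambda>v. s powr e v) F"
  shows "sf_ud e F \<le> sf_ud e E"
proof (rule ccontr)
  assume "\<not> ?thesis"
  then have less: "sf_ud e E + 1 \<le> sf_ud e F" by simp
  obtain c where c: "c > 0" "\<And>s::real. 0 < s \<Longrightarrow> s \<le> 1 \<Longrightarrow>
      c * s powr sf_ud e E \<le> sf_eval (\<lambda>v. s powr e v) E"
    using sf_ud_bounds[of e E] by blast
  obtain d where d: "d > 0" "\<And>s::real. 0 < s \<Longrightarrow> s \<le> 1 \<Longrightarrow>
      sf_eval (\<lambda>v. s powr e v) F \<le> d * s powr sf_ud e F"
    using sf_ud_bounds[of e F] by blast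
  \<comment> \<open>The exponents are integers, so a strict inequality between them leaves a factor
    \<open>s\<close>, and the bounds would force \<open>c <= d * s\<close>. This \<open>s\<close> is
    small enough to contradict that.\<close>
  define s where "s = min 1 (c / (2 * d))"
  have s: "0 < s" "s \<le> 1" "d * s < c" using c d by (auto simp: s_def min_def field_simps)
  have "c * s powr sf_ud e E \<le> d * s powr sf_ud e F"
    using c(2)[OF s(1,2)] d(2)[OF s(1,2)] assms[OF s(1,2)] by simp
  also have "\<dots> \<le> d * s powr (sf_ud e E + 1)"
    using less d s by (intro mult_left_mono powr_mono') auto
  also have "\<dots> = (d * s) * s powr sf_ud e E" using s by (simp add: powr_add)
  also have "\<dots> < c * s powr sf_ud e E" using s by simp
  finally show False by simp
qed

lemma sf_ud_eq_if_eval_eq: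
  fixes e :: "'v \<Rightarrow> int"
  assumes "\<And>s::real. 0 < s \<Longrightarrow> s \<le> 1 \<Longrightarrow>
    sf_eval (\<lambda>v. s powr e v) E = sf_eval (\<lambda>v. s powr e v) F"
  shows "sf_ud e E = sf_ud e F"
  using sf_ud_le_if_eval_eq[of e E F] sf_ud_le_if_eval_eq[of e F E] assms by force

section \<open>Evaluation at positive reals and independence of the chosen expression\<close>

lemma sf_eval_cong:
  "(\<And>v. v \<in> set_sfree E \<Longrightarrow> \<rho> v = \<rho>' v) \<Longrightarrow> sf_eval \<rho> E = sf_eval \<rho>' E"
  by (induction E) auto

lemma sf_defined_cong:
  assumes "\<And>v. v \<in> set_sfree E \<Longrightarrow> \<rho> v = \<rho>' v"
  shows "sf_defined \<rho> E = sf_defined \<rho>' E"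
  using assms
proof (induction E)
  case (Div E F)
  then show ?case using sf_eval_cong[of F \<rho> \<rho>'] by auto
qed auto

lemma sf_eval_of_real:
  "sf_eval (\<lambda>v. of_real (\<rho> v)) E = (of_real (sf_eval \<rho> E) :: 'a::{real_div_algebra,field})"
  by (induction E) auto

lemma sf_eval_pos: "(\<And>v. \<rho> v > (0::real)) \<Longrightarrow> sf_eval \<rho> E > 0"
  by (induction E) (auto intro: add_pos_pos)

text \<open>Discharges the guard \<open>sf_defined\<close> in \<open>represents_f_B\<close> along
  the positive curves used to compare expressions.\<close>

lemma sf_defined_of_real:
  assumes "\<And>v. \<rho> v > (0::real)"
  shows "sf_defined (\<lambda>v. of_real (\<rho> v) :: 'a::{real_div_algebra,field}) E"
proof (induction E)
  case (Div E F)
  then show ?case using sf_eval_pos[of \<rho> F] assms by (simp add: sf_eval_of_real)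
qed auto

text \<open>The head is kept apart because subtraction-free expressions have no zero to stand for an
  empty sum.\<close>

primrec sf_sum :: "'v sfree \<Rightarrow> 'v sfree list \<Rightarrow> 'v sfree" where
  "sf_sum E [] = E"
| "sf_sum E (F # Fs) = Add E (sf_sum F Fs)"

lemma sf_eval_sf_sum: "sf_eval \<rho> (sf_sum E Es) = (\<Sum>F\<leftarrow>E # Es. sf_eval \<rho> F)"
  by (induction Es arbitrary: E) auto

lemma sf_ud_sf_sum_nonneg: "sf_ud \<rho> (sf_sum E Es) \<ge> 0 \<longleftrightarrow> (\<forall>F\<in>set (E # Es). sf_ud \<rho> F \<ge> 0)"
  by (induction Es arbitrary: E) auto

lemma set_sf_sum: "set_sfree (sf_sum E Es) = (\<Union>F\<in>set (E # Es). set_sfree F)"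
  by (induction Es arbitrary: E) auto

lemma torus_root_surj:
  assumes "\<And>j. a j > (0::real)"
  shows "\<exists>t\<in>torus n. \<forall>j\<in>{1..n}. root_char j t = of_real (a j)"
proof
  \<comment> \<open>Diagonal entries proportional to \<open>1 / P p\<close> have the prescribed
    consecutive quotients; the common factor \<open>r\<close>, a root of degree n+1, normalizes the
    determinant to 1.\<close>
  define P where "P p = (\<Prod>j\<in>{1..p}. a j)" for p
  have P: "P p > 0" for p using assms by (auto simp: P_def intro: prod_pos)
  define r where "r = root (Suc n) (\<Prod>p<Suc n. P p)"
  have "(\<Prod>p<Suc n. P p) > 0" using P by (intro prod_pos) auto
  then have r: "r > 0" "r ^ Suc n = (\<Prod>p<Suc n. P p)"
    unfolding r_def using real_root_pow_pos[of "Suc n"] by (auto simp del: prod.lessThan_Suc)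
  let ?t = "mat_diag (Suc n) (\<lambda>p. complex_of_real (r / P p))"
  have "(\<Prod>p<Suc n. r / P p) = 1"
    using r P by (simp only: prod_dividef prod_constant card_lessThan)
      (simp add: less_imp_neq[THEN not_sym] del: prod.lessThan_Suc)
  then have "det ?t = 1"
    by (simp only: det_mat_diag of_real_prod[symmetric]) simp
  then show "?t \<in> torus n"
    unfolding torus_def SL_def by (simp add: diagonal_mat_def) (simp add: mat_diag_def)
  show "\<forall>j\<in>{1..n}. root_char j ?t = of_real (a j)"
  proof
    fix j assume j: "j \<in> {1..n}"
    then obtain i where i: "j = Suc i" by (cases j) auto
    have "P j = P i * a j" by (simp add: P_def i)
    moreover have "P i \<noteq> 0" "P j \<noteq> 0" "r \<noteq> 0" "a j \<noteq> 0" using P[of i] P[of j] r assms[of j] by auto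
    ultimately have "(r / P i) / (r / P j) = a j" by (simp add: field_simps)
    then show "root_char j ?t = of_real (a j)"
      using j i by (simp add: root_char_def mat_diag_def flip: of_real_divide)
  qed
qed

lemma UD_f_B_eq:
  assumes F: "represents_f_B n F" and x: "length x = length (word_i0 n)"
  shows "UD_f_B n lam x = sf_ud (param_val lam x) F"
proof -
  define G where "G = (SOME F. represents_f_B n F)"
  have G: "represents_f_B n G" unfolding G_def by (rule someI[of _ F]) (rule F)
  let ?e = "param_val lam x"
  have "sf_ud ?e G = sf_ud ?e F"
  proof (rule sf_ud_eq_if_eval_eq)
    fix s :: real assume s: "0 < s" "s \<le> 1"
    \<comment> \<open>The test curve: simple roots \<open>s powr lam j\<close> and coordinates
      \<open>s powr k\<close> for the entries \<open>k\<close> of \<open>x\<close>. Along it both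
      expressions have the value of \<open>f_B\<close>.\<close>
    obtain t where t: "t \<in> torus n" "\<And>j. j \<in> {1..n} \<Longrightarrow> root_char j t = of_real (s powr lam j)"
      using torus_root_surj[of "\<lambda>j. s powr lam j" n] s by auto
    define c where "c = map (\<lambda>k. complex_of_real (s powr k)) x"
    have c: "length c = length (word_i0 n)" "0 \<notin> set c" using x s by (auto simp: c_def)
    let ?v = "param_val (\<lambda>j. root_char j t) c" and ?w = "\<lambda>v. complex_of_real (s powr ?e v)"
    have v: "?v v = ?w v" if "v \<in> Root ` {1..n} \<union> Coord ` {..<length (word_i0 n)}" for v
      using that t(2) x by (auto simp: c_def)
    have *: "f_B n (t * Theta_minus n c) = of_real (sf_eval (\<lambda>v. s powr ?e v) H)"
      if H: "represents_f_B n H" for H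
    proof -
      have vH: "?v v = ?w v" if "v \<in> set_sfree H" for v
        using that H by (intro v) (auto simp: represents_f_B_def)
      have "sf_defined ?v H"
        using sf_defined_cong[of H ?v ?w] sf_defined_of_real[of "\<lambda>v. s powr ?e v"] vH s by simp
      then have "f_B n (t * Theta_minus n c) = sf_eval ?v H"
        using H t(1) c by (auto simp: represents_f_B_def)
      also have "\<dots> = sf_eval ?w H" by (rule sf_eval_cong) (rule vH)
      finally show ?thesis by (simp add: sf_eval_of_real)
    qed
    from *[OF F] *[OF G]
    show "sf_eval (\<lambda>v. s powr ?e v) G = sf_eval (\<lambda>v. s powr ?e v) F" by simp
  qed
  then show ?thesis by (simp add: UD_f_B_def G_def)
qed

section \<open>The decoration in coordinates\<close>

definition corner_ext :: "nat \<Rightarrow> complex mat \<Rightarrow> complex mat" where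
  "corner_ext n A = four_block_mat A (0\<^sub>m (Suc n) 1) (0\<^sub>m 1 (Suc n)) (1\<^sub>m 1)"

lemma corner_ext_carrier [simp]:
  "A \<in> carrier_mat (Suc n) (Suc n) \<Longrightarrow> corner_ext n A \<in> carrier_mat (Suc (Suc n)) (Suc (Suc n))"
  using four_block_carrier_mat[of A "Suc n" "Suc n" "1\<^sub>m 1" 1 1] by (simp add: corner_ext_def)

lemma corner_ext_index:
  assumes "A \<in> carrier_mat (Suc n) (Suc n)" "p \<le> Suc n" "q \<le> Suc n"
  shows "corner_ext n A $$ (p,q) =
    (if p \<le> n \<and> q \<le> n then A $$ (p,q) else if p = q then 1 else 0)"
  using assms by (auto simp: corner_ext_def less_Suc_eq_le not_less_eq_eq)

lemma corner_ext_mult: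
  assumes "A \<in> carrier_mat (Suc n) (Suc n)" "B \<in> carrier_mat (Suc n) (Suc n)"
  shows "corner_ext n A * corner_ext n B = corner_ext n (A * B)"
  using assms unfolding corner_ext_def
  by (subst mult_four_block_mat[of _ "Suc n" "Suc n" _ 1 _ 1 _ _ "Suc n" _ 1])
    (auto intro!: arg_cong4[of _ _ _ _ _ _ _ _ four_block_mat])

lemma corner_ext_one: "corner_ext n (1\<^sub>m (Suc n)) = 1\<^sub>m (Suc (Suc n))"
  by (simp add: corner_ext_def four_block_one_mat)

lemma mat_prod_carrier:
  "set gs \<subseteq> carrier_mat (Suc n) (Suc n) \<Longrightarrow> mat_prod n gs \<in> carrier_mat (Suc n) (Suc n)"
  by (induction gs) (auto simp: mat_prod_def intro: mult_carrier_mat)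

lemma mat_prod_append:
  assumes "set gs \<subseteq> carrier_mat (Suc n) (Suc n)" "set hs \<subseteq> carrier_mat (Suc n) (Suc n)"
  shows "mat_prod n (gs @ hs) = mat_prod n gs * mat_prod n hs"
  using assms(1)
proof (induction gs)
  case Nil
  then show ?case
    using mat_prod_carrier[OF assms(2)] by (simp add: mat_prod_def)
next
  case (Cons g gs)
  then have g: "g \<in> carrier_mat (Suc n) (Suc n)"
    and gs: "mat_prod n gs \<in> carrier_mat (Suc n) (Suc n)" using mat_prod_carrier by auto
  have "mat_prod n ((g # gs) @ hs) = g * mat_prod n (gs @ hs)" by (simp add: mat_prod_def)
  also have "\<dots> = g * mat_prod n gs * mat_prod n hs"
    using Cons assoc_mult_mat[OF g gs mat_prod_carrier[OF assms(2)]] by simp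
  finally show ?case by (simp add: mat_prod_def)
qed

lemma mat_prod_corner_ext:
  "set gs \<subseteq> carrier_mat (Suc n) (Suc n) \<Longrightarrow>
    mat_prod (Suc n) (map (corner_ext n) gs) = corner_ext n (mat_prod n gs)"
proof (induction gs)
  case Nil
  then show ?case by (simp add: mat_prod_def corner_ext_one)
next
  case (Cons g gs)
  then have "mat_prod (Suc n) (map (corner_ext n) (g # gs)) = corner_ext n g * corner_ext n (mat_prod n gs)"
    by (simp add: mat_prod_def)
  also have "\<dots> = corner_ext n (g * mat_prod n gs)"
    using Cons.prems by (intro corner_ext_mult mat_prod_carrier) auto
  finally show ?case by (simp add: mat_prod_def)
qed

section \<open>The factors of Theta and the product over one block\<close>

definition theta_factor :: "nat \<Rightarrow> nat \<Rightarrow> complex \<Rightarrow> complex mat" where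
  "theta_factor n i c = y_elt n i c * coroot n i (inverse c)"

lemma theta_factor_carrier:
  "i \<in> {1..n} \<Longrightarrow> theta_factor n i c \<in> carrier_mat (Suc n) (Suc n)"
  by (auto simp: theta_factor_def y_elt_eq coroot_def intro!: mult_carrier_mat)

lemma theta_factor_index:
  assumes "i \<in> {1..n}" "c \<noteq> 0" "p \<le> n" "q \<le> n"
  shows "theta_factor n i c $$ (p,q) =
    (if p = q then if p = i - 1 then inverse c else if p = i then c else 1
     else if p = i \<and> q = i - 1 then 1 else 0)"
  using assms
  by (auto simp: theta_factor_def y_elt_eq coroot_def mat_diag_mult_right[of _ "Suc n"] addrow_mat_def)

lemma theta_factor_corner_ext:
  assumes "i \<in> {1..n}" "c \<noteq> 0"
  shows "theta_factor (Suc n) i c = corner_ext n (theta_factor n i c)"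
proof (rule eq_matI)
  note [simp] = theta_factor_carrier[of i "Suc n" c] theta_factor_carrier[of i n c]
  show "dim_row (theta_factor (Suc n) i c) = dim_row (corner_ext n (theta_factor n i c))"
    "dim_col (theta_factor (Suc n) i c) = dim_col (corner_ext n (theta_factor n i c))"
    using assms carrier_matD[OF theta_factor_carrier[of i "Suc n" c]]
      carrier_matD[OF theta_factor_carrier[of i n c]] by (auto simp: corner_ext_def)
  fix p q assume "p < dim_row (corner_ext n (theta_factor n i c))"
    "q < dim_col (corner_ext n (theta_factor n i c))"
  then have "p \<le> Suc n" "q \<le> Suc n"
    using assms carrier_matD[OF theta_factor_carrier[of i n c]] by (auto simp: corner_ext_def)
  then show "theta_factor (Suc n) i c $$ (p,q) = corner_ext n (theta_factor n i c) $$ (p,q)"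
    using assms by (auto simp: corner_ext_index theta_factor_index not_less_eq_eq)
qed

text \<open>The subdiagonal entries of \<open>y_i(c) \<alpha>_i\<^sup>\<or>(1/c)\<close> equal \<open>1\<close>, whence those of the product over
  the letters \<open>1, ..., n\<close>.\<close>

definition bidiag :: "nat \<Rightarrow> (nat \<Rightarrow> complex) \<Rightarrow> complex mat" where
  "bidiag n d = mat (Suc n) (Suc n) (\<lambda>(p,q). if p = q then d p else if p = Suc q then 1 else 0)"

lemma bidiag_carrier [simp]: "bidiag n d \<in> carrier_mat (Suc n) (Suc n)"
  by (simp add: bidiag_def)

lemma bidiag_mult_index:
  assumes "B \<in> carrier_mat (Suc n) k" "p \<le> n" "q < k"
  shows "(bidiag n d * B) $$ (p,q) = d p * B $$ (p,q) + (if p = 0 then 0 else B $$ (p - 1, q))"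
proof -
  have "(bidiag n d * B) $$ (p,q) = (\<Sum>r<Suc n. bidiag n d $$ (p,r) * B $$ (r,q))"
    using assms by (intro mat_mult_index[of _ "Suc n" _ _ k]) auto
  also have "\<dots> = (\<Sum>r\<in>{p} \<union> {p - 1}. bidiag n d $$ (p,r) * B $$ (r,q))"
    using assms by (intro sum.mono_neutral_right) (auto simp: bidiag_def)
  also have "\<dots> = d p * B $$ (p,q) + (if p = 0 then 0 else B $$ (p - 1, q))"
    using assms by (cases p) (auto simp: bidiag_def)
  finally show ?thesis .
qed

lemma mat_prod_snoc:
  assumes "set gs \<subseteq> carrier_mat (Suc n) (Suc n)" "g \<in> carrier_mat (Suc n) (Suc n)"
  shows "mat_prod n (gs @ [g]) = mat_prod n gs * g"
  using mat_prod_append[OF assms(1), of "[g]"] assms(2) by (simp add: mat_prod_def)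

text \<open>Diagonal position p receives c_p from the letter p and 1/c_{p+1} from the letter p+1.
  The value 1 of \<open>r\<close> outside the block covers the two ends.\<close>

lemma theta_row_eq_bidiag:
  assumes "length c = n" "0 \<notin> set c"
  defines "r \<equiv> (\<lambda>c p. if 1 \<le> p \<and> p \<le> length c then c ! (p - 1) else 1)"
  shows "mat_prod n (map2 (theta_factor n) [1..<Suc n] c) = bidiag n (\<lambda>p. r c p / r c (Suc p))"
  using assms(1,2)
proof (induction n arbitrary: c)
  case 0
  then show ?case by (auto simp: mat_prod_def bidiag_def r_def intro!: eq_matI)
next
  case (Suc n)
  define a c' where "a = last c" and "c' = butlast c"
  have c: "c = c' @ [a]" using Suc.prems by (cases c rule: rev_cases) (auto simp: a_def c'_def)
  then have c': "length c' = n" "0 \<notin> set c'" and a: "a \<noteq> 0" using Suc.prems by auto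
  let ?gs = "map2 (theta_factor n) [1..<Suc n] c'"
  have mem: "i \<in> {1..n} \<and> x \<noteq> 0" if "(i,x) \<in> set (zip [1..<Suc n] c')" for i x
  proof -
    have "x \<in> set c'" using that by (rule set_zip_rightD)
    moreover have "i \<in> set [1..<Suc n]" using that by (rule set_zip_leftD)
    ultimately show ?thesis using c' by auto
  qed
  have gs: "set ?gs \<subseteq> carrier_mat (Suc n) (Suc n)"
    using mem by (auto simp del: upt_Suc intro!: theta_factor_carrier)
  have "map2 (theta_factor (Suc n)) [1..<Suc n] c' = map (corner_ext n) ?gs"
    using mem by (auto simp del: upt_Suc intro!: theta_factor_corner_ext)
  then have "map2 (theta_factor (Suc n)) [1..<Suc (Suc n)] c =
      map (corner_ext n) ?gs @ [theta_factor (Suc n) (Suc n) a]"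
    using c c' by simp
  then have "mat_prod (Suc n) (map2 (theta_factor (Suc n)) [1..<Suc (Suc n)] c) =
      mat_prod (Suc n) (map (corner_ext n) ?gs @ [theta_factor (Suc n) (Suc n) a])" by (rule arg_cong)
  also have "\<dots> = mat_prod (Suc n) (map (corner_ext n) ?gs) * theta_factor (Suc n) (Suc n) a"
    using gs by (intro mat_prod_snoc) (auto simp del: upt_Suc intro!: theta_factor_carrier)
  also have "mat_prod (Suc n) (map (corner_ext n) ?gs) = corner_ext n (bidiag n (\<lambda>p. r c' p / r c' (Suc p)))"
    by (simp only: mat_prod_corner_ext[OF gs] Suc.IH[OF c'])
  finally have eq: "mat_prod (Suc n) (map2 (theta_factor (Suc n)) [1..<Suc (Suc n)] c) =
    corner_ext n (bidiag n (\<lambda>p. r c' p / r c' (Suc p))) * theta_factor (Suc n) (Suc n) a" .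
  show ?case unfolding eq
  proof (rule eq_matI)
    let ?B = "corner_ext n (bidiag n (\<lambda>p. r c' p / r c' (Suc p)))" and ?g = "theta_factor (Suc n) (Suc n) a"
    have g: "?g \<in> carrier_mat (Suc (Suc n)) (Suc (Suc n))" by (intro theta_factor_carrier) auto
    show "dim_row (?B * ?g) = dim_row (bidiag (Suc n) (\<lambda>p. r c p / r c (Suc p)))"
      "dim_col (?B * ?g) = dim_col (bidiag (Suc n) (\<lambda>p. r c p / r c (Suc p)))"
      using carrier_matD[OF g] by (simp_all add: corner_ext_def bidiag_def)
    fix p q assume "p < dim_row (bidiag (Suc n) (\<lambda>p. r c p / r c (Suc p)))"
      "q < dim_col (bidiag (Suc n) (\<lambda>p. r c p / r c (Suc p)))"
    then have pq: "p \<le> Suc n" "q \<le> Suc n" by (auto simp: bidiag_def)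
    have "(?B * ?g) $$ (p,q) = (\<Sum>s<Suc (Suc n). ?B $$ (p,s) * ?g $$ (s,q))"
      using pq g by (intro mat_mult_index[of _ "Suc (Suc n)" _ _ "Suc (Suc n)"]) auto
    also have "\<dots> = (\<Sum>s\<in>{q} \<union> (if q = n then {Suc n} else {}). ?B $$ (p,s) * ?g $$ (s,q))"
      using pq a by (intro sum.mono_neutral_right) (auto simp: theta_factor_index split: if_splits)
    also have "\<dots> = bidiag (Suc n) (\<lambda>p. r c p / r c (Suc p)) $$ (p,q)"
      using pq a c'
      by (auto simp: theta_factor_index corner_ext_index bidiag_def r_def c nth_append field_simps
          not_less_eq_eq le_Suc_eq)
    finally show "(?B * ?g) $$ (p,q) = bidiag (Suc n) (\<lambda>p. r c p / r c (Suc p)) $$ (p,q)" .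
  qed
qed

section \<open>The lift of the longest element\<close>

lemma s_bar_carrier: "i \<in> {1..n} \<Longrightarrow> s_bar n i \<in> carrier_mat (Suc n) (Suc n)"
  by (auto simp: s_bar_def x_elt_eq y_elt_eq intro!: mult_carrier_mat)

lemma s_bar_SL: "i \<in> {1..n} \<Longrightarrow> s_bar n i \<in> carrier (SL n)"
  by (auto simp: s_bar_def x_elt_eq y_elt_eq intro!: SL_mult_closed addrow_mat_SL)

lemma s_bar_index:
  assumes i: "i \<in> {1..n}" and pq: "p \<le> n" "q \<le> n"
  shows "s_bar n i $$ (p,q) =
    (if p = i \<and> q = i - 1 then 1 else if p = i - 1 \<and> q = i then -1
     else if p = q \<and> p \<noteq> i - 1 \<and> p \<noteq> i then 1 else 0)"
proof -
  let ?x = "addrow_mat (Suc n) (-1) (i - 1) i :: complex mat" and ?y = "addrow_mat (Suc n) 1 i (i - 1) :: complex mat"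
  have "s_bar n i = ?x * (?y * ?x)"
    using i by (simp add: s_bar_def x_elt_eq y_elt_eq assoc_mult_mat[of _ "Suc n" "Suc n" _ "Suc n" _ "Suc n"])
  also have "?y * ?x = mat_addrow 1 i (i - 1) ?x"
    using i by (intro addrow_mat[symmetric, of _ "Suc n" "Suc n"]) auto
  also have "?x * \<dots> = mat_addrow (-1) (i - 1) i (mat_addrow 1 i (i - 1) ?x)"
    using i by (intro addrow_mat[symmetric, of _ "Suc n" "Suc n"]) (auto simp: mat_addrow_def)
  finally have eq: "s_bar n i = mat_addrow (-1) (i - 1) i (mat_addrow 1 i (i - 1) ?x)" .
  obtain j where j: "i = Suc j" using i by (cases i) auto
  show ?thesis
    unfolding eq using i pq
    by (cases "p = j"; cases "p = i"; cases "q = j"; cases "q = i")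
      (simp_all add: mat_addrow_def addrow_mat_def j)
qed

lemma s_bar_corner_ext:
  assumes "i \<in> {1..n}"
  shows "s_bar (Suc n) i = corner_ext n (s_bar n i)"
proof (rule eq_matI)
  have c: "s_bar n i \<in> carrier_mat (Suc n) (Suc n)" "s_bar (Suc n) i \<in> carrier_mat (Suc (Suc n)) (Suc (Suc n))"
    using assms by (auto intro!: s_bar_carrier)
  note d = carrier_matD[OF c(2)] carrier_matD[OF corner_ext_carrier[OF c(1)]]
  show "dim_row (s_bar (Suc n) i) = dim_row (corner_ext n (s_bar n i))"
    "dim_col (s_bar (Suc n) i) = dim_col (corner_ext n (s_bar n i))"
    using d by auto
  fix p q assume "p < dim_row (corner_ext n (s_bar n i))" "q < dim_col (corner_ext n (s_bar n i))"
  then have "p \<le> Suc n" "q \<le> Suc n" using d by auto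
  then show "s_bar (Suc n) i $$ (p,q) = corner_ext n (s_bar n i) $$ (p,q)"
    using assms c by (auto simp: corner_ext_index s_bar_index not_less_eq_eq)
qed

text \<open>Each factor is a signed transposition with its -1 above the diagonal. The product is a
  signed cycle, whose corner entry collects one sign from every letter.\<close>

lemma s_bar_row_index:
  "p \<le> n \<Longrightarrow> q \<le> n \<Longrightarrow> mat_prod n (map (s_bar n) [1..<Suc n]) $$ (p,q) =
    (if p = Suc q then 1 else if p = 0 \<and> q = n then (-1) ^ n else 0)"
proof (induction n arbitrary: p q)
  case 0
  then show ?case by (simp add: mat_prod_def)
next
  case (Suc n)
  let ?gs = "map (s_bar n) [1..<Suc n]" and ?g = "s_bar (Suc n) (Suc n)"
  have gs: "set ?gs \<subseteq> carrier_mat (Suc n) (Suc n)" by (auto intro!: s_bar_carrier)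
  have g: "?g \<in> carrier_mat (Suc (Suc n)) (Suc (Suc n))" by (auto intro!: s_bar_carrier)
  have "map (s_bar (Suc n)) [1..<Suc n] = map (corner_ext n) ?gs"
    by (auto intro!: s_bar_corner_ext simp del: upt_Suc)
  then have "map (s_bar (Suc n)) [1..<Suc (Suc n)] = map (corner_ext n) ?gs @ [?g]" by simp
  then have eq: "mat_prod (Suc n) (map (s_bar (Suc n)) [1..<Suc (Suc n)]) = corner_ext n (mat_prod n ?gs) * ?g"
    using gs g by (simp only: mat_prod_corner_ext[symmetric]) 
      (rule mat_prod_snoc, auto simp del: upt_Suc)
  define P where "P = mat_prod n ?gs"
  have P: "P \<in> carrier_mat (Suc n) (Suc n)" unfolding P_def by (rule mat_prod_carrier[OF gs])
  have IH: "P $$ (p,q) = (if p = Suc q then 1 else if p = 0 \<and> q = n then (-1) ^ n else 0)"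
    if "p \<le> n" "q \<le> n" for p q using Suc.IH[OF that] by (simp only: P_def)
  let ?B = "corner_ext n P"
  have "(?B * ?g) $$ (p,q) = (\<Sum>s<Suc (Suc n). ?B $$ (p,s) * ?g $$ (s,q))"
    using Suc.prems g P
    by (intro mat_mult_index[of _ "Suc (Suc n)" _ _ "Suc (Suc n)"]) auto
  also have "\<dots> = (\<Sum>s\<in>(if q = n then {Suc n} else if q = Suc n then {n} else {q}). ?B $$ (p,s) * ?g $$ (s,q))"
    using Suc.prems by (intro sum.mono_neutral_right) (auto simp: s_bar_index split: if_splits)
  also have "\<dots> = (if p = Suc q then 1 else if p = 0 \<and> q = Suc n then (-1) ^ Suc n else 0)"
    using Suc.prems P
    by (auto simp: s_bar_index corner_ext_index IH not_less_eq_eq)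
  finally show ?case unfolding eq P_def .
qed

lemma w0_bar_SL: "w0_bar n \<in> carrier (SL n)"
  unfolding w0_bar_def using word_i0_set[of n] by (intro mat_prod_SL) (auto intro!: s_bar_SL)

lemma w0_bar_index:
  "p \<le> n \<Longrightarrow> q \<le> n \<Longrightarrow> w0_bar n $$ (p,q) = (if p + q = n then (-1) ^ q else 0)"
proof (induction n arbitrary: p q)
  case 0
  then show ?case by (simp add: w0_bar_def mat_prod_def)
next
  case (Suc n)
  let ?gs = "map (s_bar (Suc n)) [1..<Suc (Suc n)]" and ?hs = "map (s_bar n) (word_i0 n)"
  have gs: "set ?gs \<subseteq> carrier_mat (Suc (Suc n)) (Suc (Suc n))" by (auto intro!: s_bar_carrier)
  have hs: "set ?hs \<subseteq> carrier_mat (Suc n) (Suc n)" using word_i0_set[of n] by (auto intro!: s_bar_carrier)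
  have ext: "map (s_bar (Suc n)) (word_i0 n) = map (corner_ext n) ?hs"
    using word_i0_set[of n] by (auto intro!: s_bar_corner_ext)
  have "w0_bar (Suc n) = mat_prod (Suc n) (?gs @ map (corner_ext n) ?hs)"
    by (simp only: w0_bar_def word_i0.simps map_append ext)
  also have "\<dots> = mat_prod (Suc n) ?gs * mat_prod (Suc n) (map (corner_ext n) ?hs)"
    using gs hs by (intro mat_prod_append) (auto simp del: upt_Suc)
  also have "\<dots> = mat_prod (Suc n) ?gs * corner_ext n (w0_bar n)"
    by (simp only: mat_prod_corner_ext[OF hs] w0_bar_def)
  finally have eq: "w0_bar (Suc n) = mat_prod (Suc n) ?gs * corner_ext n (w0_bar n)" .
  define C where "C = mat_prod (Suc n) ?gs"
  have C: "C \<in> carrier_mat (Suc (Suc n)) (Suc (Suc n))" unfolding C_def by (rule mat_prod_carrier[OF gs])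
  have C_index: "C $$ (p,q) = (if p = Suc q then 1 else if p = 0 \<and> q = Suc n then (-1) ^ Suc n else 0)"
    if "p \<le> Suc n" "q \<le> Suc n" for p q unfolding C_def by (rule s_bar_row_index[OF that])
  let ?W = "corner_ext n (w0_bar n)"
  have W: "w0_bar n \<in> carrier_mat (Suc n) (Suc n)" using w0_bar_SL by (rule SL_carrier_mat)
  have "(C * ?W) $$ (p,q) = (\<Sum>s<Suc (Suc n). C $$ (p,s) * ?W $$ (s,q))"
    using Suc.prems W C
    by (intro mat_mult_index[of _ "Suc (Suc n)" _ _ "Suc (Suc n)"]) auto
  also have "\<dots> = (\<Sum>s\<in>{if q = Suc n then Suc n else n - q}. C $$ (p,s) * ?W $$ (s,q))"
    using Suc.prems W
    by (intro sum.mono_neutral_right) (auto simp: corner_ext_index Suc.IH split: if_splits)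
  also have "\<dots> = (if p + q = Suc n then (-1) ^ q else 0)"
    using Suc.prems W
    by (auto simp: corner_ext_index Suc.IH C_index not_less_eq_eq)
  finally show ?case unfolding eq C_def .
qed

text \<open>The lift is a signed permutation matrix, hence orthogonal.\<close>

lemma w0_bar_inv: "inv\<^bsub>SL n\<^esub> (w0_bar n) = transpose_mat (w0_bar n)"
proof (rule SL_inv_eqI[OF w0_bar_SL])
  have W: "w0_bar n \<in> carrier_mat (Suc n) (Suc n)" using w0_bar_SL by (rule SL_carrier_mat)
  then show "transpose_mat (w0_bar n) \<in> carrier_mat (Suc n) (Suc n)" by simp
  show "transpose_mat (w0_bar n) * w0_bar n = 1\<^sub>m (Suc n)"
  proof (rule eq_matI)
    fix p q assume "p < dim_row (1\<^sub>m (Suc n))" "q < dim_col (1\<^sub>m (Suc n))"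
    then have pq: "p \<le> n" "q \<le> n" by auto
    have "(transpose_mat (w0_bar n) * w0_bar n) $$ (p,q) = 
        (\<Sum>s<Suc n. transpose_mat (w0_bar n) $$ (p,s) * w0_bar n $$ (s,q))"
      using pq W by (intro mat_mult_index[of _ "Suc n" _ _ "Suc n"]) auto
    also have "\<dots> = (\<Sum>s<Suc n. w0_bar n $$ (s,p) * w0_bar n $$ (s,q))"
      using pq carrier_matD[OF W] by (intro sum.cong) auto
    also have "\<dots> = (\<Sum>s\<in>{n - q}. w0_bar n $$ (s,p) * w0_bar n $$ (s,q))"
      using pq by (intro sum.mono_neutral_right) (auto simp: w0_bar_index)
    also have "\<dots> = 1\<^sub>m (Suc n) $$ (p,q)"
      using pq by (auto simp: w0_bar_index simp flip: power_mult_distrib)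
    finally show "(transpose_mat (w0_bar n) * w0_bar n) $$ (p,q) = 1\<^sub>m (Suc n) $$ (p,q)" .
  qed (use carrier_matD[OF W] in auto)
qed

lemma unip_plus_inv:
  assumes v: "v \<in> unip_plus n"
  shows "inv\<^bsub>SL n\<^esub> v \<in> unip_plus n"
proof -
  let ?N = "Suc n" and ?u = "inv\<^bsub>SL n\<^esub> v"
  have vc: "v \<in> carrier_mat ?N ?N" and uc: "?u \<in> carrier_mat ?N ?N"
    using unip_plus_SL[OF v] SL_carrier_mat[of _ n] by auto
  have uv: "?u * v = 1\<^sub>m ?N" using SL_inv_mult[OF unip_plus_SL[OF v]] .
  have "transpose_mat v * transpose_mat ?u = 1\<^sub>m ?N"
    using transpose_mult[OF uc vc] uv by simp
  then have "transpose_mat ?u $$ (i,j) = 0" if "j \<le> n" "i < j" for i j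
    using v that vc uc
    by (intro lower_triangular_cancel[of "transpose_mat v" ?N "transpose_mat ?u"])
      (auto simp: unip_plus_iff)
  then have upper: "?u $$ (i,j) = 0" if "i \<le> n" "j < i" for i j
    using that carrier_matD[OF uc] by (metis index_transpose_mat(1) le_imp_less_Suc less_trans)
  have "?u $$ (i,i) = 1" if "i \<le> n" for i
  proof -
    have "1 = (?u * v) $$ (i,i)" using uv that by simp
    also have "\<dots> = (\<Sum>r<?N. ?u $$ (i,r) * v $$ (r,i))"
      using that vc uc by (intro mat_mult_index[of _ ?N _ _ ?N]) auto
    also have "\<dots> = (\<Sum>r\<in>{i}. ?u $$ (i,r) * v $$ (r,i))"
    proof (rule sum.mono_neutral_right)
      show "\<forall>r\<in>{..<?N} - {i}. ?u $$ (i,r) * v $$ (r,i) = 0"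
      proof
        fix r assume "r \<in> {..<?N} - {i}"
        then show "?u $$ (i,r) * v $$ (r,i) = 0"
          using upper[of i r] v that by (cases "r < i") (auto simp: unip_plus_iff)
      qed
    qed (use that in auto)
    finally show ?thesis using v that by (simp add: unip_plus_iff)
  qed
  then show ?thesis using upper uc by (auto simp: unip_plus_iff)
qed

section \<open>Reading the decoration off a unipotent factor\<close>

definition antilower :: "nat \<Rightarrow> complex mat \<Rightarrow> bool" where
  "antilower n A \<longleftrightarrow> (\<forall>i\<le>n. \<forall>j\<le>n. n < i + j \<longrightarrow> A $$ (i,j) = 0)"

text \<open>The inverse lift reverses the rows up to sign and so maps antilower matrices to lower
  triangular ones. Superdiagonal entries are additive on U, so those of the inverse of
  \<open>v\<close> are the negatives of those of \<open>v\<close>.\<close>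

lemma chi_st_pi_plus_antilower:
  assumes X: "X \<in> carrier (SL n)" and v: "v \<in> unip_plus n" and Xv: "antilower n (X * v)"
  shows "chi_st n (pi_plus n (inv\<^bsub>SL n\<^esub> (w0_bar n) * X)) = - (\<Sum>i<n. v $$ (i, Suc i))"
proof -
  let ?N = "Suc n" and ?W = "transpose_mat (w0_bar n)"
  define u where "u = inv\<^bsub>SL n\<^esub> v"
  have u: "u \<in> unip_plus n" unfolding u_def by (rule unip_plus_inv[OF v])
  have [simp]: "u \<in> carrier_mat ?N ?N" "v \<in> carrier_mat ?N ?N" "X \<in> carrier_mat ?N ?N"
    "w0_bar n \<in> carrier_mat ?N ?N"
    using u v X w0_bar_SL[of n] unip_plus_SL[of _ n] SL_carrier_mat[of _ n] by auto
  have [simp]: "X * v \<in> carrier_mat ?N ?N" "?W * X \<in> carrier_mat ?N ?N" by (auto intro!: mult_carrier_mat[of _ ?N ?N])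
  have vu: "v * u = 1\<^sub>m ?N" unfolding u_def using SL_mult_inv[OF unip_plus_SL[OF v]] .
  define b where "b = ?W * (X * v)"
  have bc: "b \<in> carrier_mat ?N ?N" unfolding b_def by (rule mult_carrier_mat[of _ ?N ?N]) auto
  have "b * u = ?W * ((X * v) * u)"
    unfolding b_def by (rule assoc_mult_mat[of _ ?N ?N _ ?N _ ?N]) auto
  also have "(X * v) * u = X"
    using assoc_mult_mat[of X ?N ?N v ?N u ?N] vu right_mult_one_mat[of X ?N ?N] by simp
  finally have bu: "?W * X = b * u" by simp
  have "b \<in> borel_minus n"
  proof (rule borel_minusI[OF bc _ u])
    show "b * u \<in> carrier (SL n)"
      using SL_mult_closed[OF SL.inv_closed[OF w0_bar_SL] X] bu by (simp add: w0_bar_inv)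
    fix i j assume ij: "i \<le> n" "j \<le> n" "i < j"
    have "b $$ (i,j) = (\<Sum>r<?N. ?W $$ (i,r) * (X * v) $$ (r,j))"
      unfolding b_def using ij by (intro mat_mult_index[of _ ?N _ _ ?N]) auto
    also have "\<dots> = 0"
    proof (rule sum.neutral, rule ballI)
      fix r assume r: "r \<in> {..<?N}"
      show "?W $$ (i,r) * (X * v) $$ (r,j) = 0"
      proof (cases "r + i = n")
        case True
        then show ?thesis using Xv ij r by (simp add: antilower_def)
      next
        case False
        then show ?thesis using ij r carrier_matD[of "w0_bar n" ?N ?N] by (simp add: w0_bar_index)
      qed
    qed
    finally show "b $$ (i,j) = 0" .
  qed
  then have "pi_plus n (?W * X) = u" using pi_plus_eq[OF _ u bu] by simp
  moreover have "u $$ (i, Suc i) = - v $$ (i, Suc i)" if "i < n" for i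
    using superdiag_mult[OF v u that] vu that by (simp add: eq_neg_iff_add_eq_0 add.commute)
  ultimately show ?thesis
    using chi_st_eq[OF u] by (simp add: w0_bar_inv sum_negf)
qed

text \<open>\<open>coord n c k p\<close> is c_{k+1,p}: the row is counted from 0, so that dropping
  the first block turns row \<open>Suc k\<close> into row \<open>k\<close>. The value 1 off the
  triangle is the multiplicative form of the 0 in \<open>family_of\<close>.\<close>

definition coord :: "nat \<Rightarrow> complex list \<Rightarrow> nat \<Rightarrow> nat \<Rightarrow> complex" where
  "coord n c k p = (if (Suc k, p) \<in> tri n then c ! word_pos n (Suc k, p) else 1)"

lemma coord_Suc:
  "Suc n \<le> length c \<Longrightarrow> coord (Suc n) c (Suc k) p = coord n (drop (Suc n) c) k p"
  by (auto simp: coord_def tri_def)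

lemma coord_outside: "p = 0 \<or> n < k + p \<Longrightarrow> coord n c k p = 1"
  by (auto simp: coord_def tri_def)

lemma coord_nonzero: "length c = length (word_i0 n) \<Longrightarrow> 0 \<notin> set c \<Longrightarrow> coord n c k p \<noteq> 0"
  using word_pos_less[of "(Suc k, p)" n]
  by (auto simp: coord_def) (metis nth_mem)

lemma sum_tri_Suc:
  "(\<Sum>p\<in>tri (Suc n). f p) =
    (\<Sum>l\<in>{1..Suc n}. f (1,l)) + (\<Sum>p\<in>tri n. f (Suc (fst p), snd p))"
proof -
  have split: "tri (Suc n) = Pair 1 ` {1..Suc n} \<union> (\<lambda>p. (Suc (fst p), snd p)) ` tri n"
  proof (intro equalityI subsetI)
    fix p assume "p \<in> tri (Suc n)"
    then show "p \<in> Pair 1 ` {1..Suc n} \<union> (\<lambda>p. (Suc (fst p), snd p)) ` tri n"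
      by (cases "fst p = 1")
        (auto simp: tri_def image_iff prod_eq_iff intro!: exI[of _ "fst p - 1"])
  qed (auto simp: tri_def)
  have fin: "finite (tri n)" using tri_subset by (rule finite_subset) auto
  have "Pair 1 ` {1..Suc n} \<inter> (\<lambda>p. (Suc (fst p), snd p)) ` tri n = {}"
    by (auto simp: tri_def)
  then have "(\<Sum>p\<in>tri (Suc n). f p) =
      (\<Sum>p\<in>Pair 1 ` {1..Suc n}. f p) + (\<Sum>p\<in>(\<lambda>p. (Suc (fst p), snd p)) ` tri n. f p)"
    unfolding split using fin by (intro sum.union_disjoint) auto
  then show ?thesis by (simp add: sum.reindex inj_on_def prod_eq_iff)
qed

section \<open>The unipotent factor for Theta\<close>

lemma Theta_minus_eq: "Theta_minus n c = mat_prod n (map2 (theta_factor n) (word_i0 n) c)"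
  by (simp add: Theta_minus_def theta_factor_def[abs_def])

lemma Theta_minus_Suc:
  assumes c: "length c = length (word_i0 (Suc n))" "0 \<notin> set c"
  shows "Theta_minus (Suc n) c =
    bidiag (Suc n) (\<lambda>p. coord (Suc n) c 0 p / coord (Suc n) c 0 (Suc p)) *
    corner_ext n (Theta_minus n (drop (Suc n) c))"
proof -
  define c1 c2 where "c1 = take (Suc n) c" and "c2 = drop (Suc n) c"
  have split: "c = c1 @ c2" by (simp add: c1_def c2_def)
  have len: "length c1 = Suc n" "length c2 = length (word_i0 n)" using c(1) by (auto simp: c1_def c2_def)
  have nz: "0 \<notin> set c1" "0 \<notin> set c2" using c(2) split by auto
  let ?gs = "map2 (theta_factor (Suc n)) [1..<Suc (Suc n)] c1" and ?hs = "map2 (theta_factor n) (word_i0 n) c2"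
  have mem: "i \<in> {1..n} \<and> x \<noteq> 0" if "(i,x) \<in> set (zip (word_i0 n) c2)" for i x
    using set_zip_leftD[OF that] set_zip_rightD[OF that] word_i0_set[of n] nz by auto
  have gs: "set ?gs \<subseteq> carrier_mat (Suc (Suc n)) (Suc (Suc n))"
  proof
    fix g assume "g \<in> set ?gs"
    then obtain i x where ix: "(i,x) \<in> set (zip [1..<Suc (Suc n)] c1)" "g = theta_factor (Suc n) i x" by auto
    have "i \<in> set [1..<Suc (Suc n)]" using ix(1) by (rule set_zip_leftD)
    then show "g \<in> carrier_mat (Suc (Suc n)) (Suc (Suc n))"
      unfolding ix(2) by (intro theta_factor_carrier) auto
  qed
  have hs: "set ?hs \<subseteq> carrier_mat (Suc n) (Suc n)"
    using mem by (auto intro!: theta_factor_carrier)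
  have hs_ext: "map2 (theta_factor (Suc n)) (word_i0 n) c2 = map (corner_ext n) ?hs"
    using mem by (auto intro!: theta_factor_corner_ext)
  have "map2 (theta_factor (Suc n)) (word_i0 (Suc n)) c = ?gs @ map (corner_ext n) ?hs"
    using len by (simp add: split hs_ext[symmetric] zip_append del: upt_Suc map_map)
  then have "Theta_minus (Suc n) c = mat_prod (Suc n) (?gs @ map (corner_ext n) ?hs)"
    by (simp only: Theta_minus_eq)
  also have "\<dots> = mat_prod (Suc n) ?gs * mat_prod (Suc n) (map (corner_ext n) ?hs)"
    using gs hs by (intro mat_prod_append) (auto simp del: upt_Suc)
  also have "mat_prod (Suc n) (map (corner_ext n) ?hs) = corner_ext n (Theta_minus n c2)"
    by (simp only: mat_prod_corner_ext[OF hs] Theta_minus_eq)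
  also have "mat_prod (Suc n) ?gs =
      bidiag (Suc n) (\<lambda>p. coord (Suc n) c 0 p / coord (Suc n) c 0 (Suc p))"
  proof -
    have "(if 1 \<le> p \<and> p \<le> length c1 then c1 ! (p - 1) else 1) = coord (Suc n) c 0 p" for p
      by (auto simp: coord_def tri_def len split nth_append)
    then show ?thesis by (simp only: theta_row_eq_bidiag[OF len(1) nz(1)])
  qed
  finally show ?thesis by (simp add: c2_def)
qed

text \<open>With y_p = (-1)^p g_{p+1} z_p, row p of the system reads z_p = z_{p-1} + s_p / g_p for
  positive p, so forward substitution telescopes. The signs on the right-hand side keep the sum from
  alternating.\<close>

lemma bidiag_solve:
  fixes g s :: "nat \<Rightarrow> complex"
  assumes y: "y \<in> carrier_mat (Suc n) 1" and g: "\<And>p. g p \<noteq> 0" "g 0 = 1"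
    and eq: "\<And>p. p \<le> n \<Longrightarrow> (bidiag n (\<lambda>p. g p / g (Suc p)) * y) $$ (p,0) = (-1) ^ p * s p"
  shows "p \<le> n \<Longrightarrow> y $$ (p,0) = (-1) ^ p * g (Suc p) * (\<Sum>q\<le>p. s q / g q)"
proof (induction p)
  case 0
  then show ?case using eq[of 0] y g by (simp add: bidiag_mult_index[of _ _ 1] field_simps)
next
  case (Suc p)
  then have "g (Suc p) / g (Suc (Suc p)) * y $$ (Suc p,0) + y $$ (p,0) = (-1) ^ Suc p * s (Suc p)"
    using eq[of "Suc p"] y by (simp add: bidiag_mult_index[of _ _ 1])
  then have "y $$ (Suc p,0) = g (Suc (Suc p)) / g (Suc p) * ((-1) ^ Suc p * s (Suc p) - y $$ (p,0))"
    using g(1)[of "Suc p"] g(1)[of "Suc (Suc p)"] by (simp add: field_simps)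
  also have "y $$ (p,0) = (-1) ^ p * g (Suc p) * (\<Sum>q\<le>p. s q / g q)" using Suc by simp
  finally show ?case using g(1)[of "Suc p"] by (simp add: field_simps)
qed

text \<open>All blocks after the first act in the smaller corner and fix the last coordinate. Hence
  the last entry of the solution depends on the first block only, whose system
  \<open>bidiag_solve\<close> settles.\<close>

lemma Theta_minus_solve_last:
  assumes c: "length c = length (word_i0 n)" "0 \<notin> set c" and x: "x \<in> carrier_mat (Suc n) 1"
    and eq: "\<And>p. p \<le> n \<Longrightarrow> (Theta_minus n c * x) $$ (p,0) = (-1) ^ p * s p"
  shows "x $$ (n,0) = (-1) ^ n * (\<Sum>q\<le>n. s q / coord n c 0 q)"
proof (cases n)
  case 0
  then show ?thesis using eq[of 0] x
    by (simp add: Theta_minus_eq mat_prod_def coord_outside left_mult_one_mat[of _ 1 1])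
next
  case (Suc m)
  let ?g = "coord n c 0" and ?T = "corner_ext m (Theta_minus m (drop n c))"
  have c': "length (drop (Suc m) c) = length (word_i0 m)" "0 \<notin> set (drop (Suc m) c)"
    using c Suc by (auto dest: in_set_dropD)
  have T0: "Theta_minus m (drop n c) \<in> carrier_mat (Suc m) (Suc m)"
    using Theta_minus_SL[OF c'] Suc by (auto intro: SL_carrier_mat)
  then have T: "?T \<in> carrier_mat (Suc n) (Suc n)" using Suc by simp
  have "Theta_minus n c * x = bidiag n (\<lambda>p. ?g p / ?g (Suc p)) * ?T * x"
    using Theta_minus_Suc[of c m] c Suc by simp
  also have "\<dots> = bidiag n (\<lambda>p. ?g p / ?g (Suc p)) * (?T * x)"
    using T x by (intro assoc_mult_mat[of _ "Suc n" "Suc n"]) auto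
  finally have "(bidiag n (\<lambda>p. ?g p / ?g (Suc p)) * (?T * x)) $$ (p,0) = (-1) ^ p * s p"
    if "p \<le> n" for p using eq[OF that] by simp
  then have "(?T * x) $$ (n,0) = (-1) ^ n * ?g (Suc n) * (\<Sum>q\<le>n. s q / ?g q)"
    using T x coord_nonzero[OF c]
    by (intro bidiag_solve[of "?T * x" n ?g]) (auto simp: coord_outside intro: mult_carrier_mat)
  moreover have "(?T * x) $$ (n,0) = (\<Sum>r<Suc n. ?T $$ (n,r) * x $$ (r,0))"
    using T x by (intro mat_mult_index[of _ "Suc n" _ _ 1]) auto
  moreover have "\<dots> = (\<Sum>r\<in>{n}. ?T $$ (n,r) * x $$ (r,0))"
    using T0 by (intro sum.mono_neutral_right) (auto simp: corner_ext_index Suc)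
  moreover have "\<dots> = x $$ (n,0)" using T0 by (simp add: corner_ext_index Suc)
  ultimately show ?thesis by (simp add: coord_outside)
qed

text \<open>In the induction \<open>v\<close> is bordered by a column \<open>x\<close>. Its last
  entry is the only new superdiagonal entry and contributes the terms c_{1,l} / c_{2,l-1} of the new
  first row.\<close>

lemma Theta_minus_antilower:
  assumes "length c = length (word_i0 n)" "0 \<notin> set c"
  shows "\<exists>v\<in>unip_plus n. antilower n (Theta_minus n c * v) \<and>
    (\<Sum>i<n. v $$ (i, Suc i)) =
      - (\<Sum>p\<in>tri n. coord n c (fst p - 1) (snd p) / coord n c (fst p) (snd p - 1))"
  using assms
proof (induction n arbitrary: c)
  case 0
  have "tri 0 = {}" by (auto simp: tri_def)
  then show ?case
    by (intro bexI[of _ "1\<^sub>m (Suc 0)"]) (auto simp: antilower_def unip_plus_iff)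
next
  case (Suc n)
  let ?N = "Suc n" and ?M = "Suc (Suc n)"
  define c' where "c' = drop ?N c"
  have c': "length c' = length (word_i0 n)" "0 \<notin> set c'"
    using Suc.prems by (auto simp: c'_def dest: in_set_dropD)
  let ?g = "coord ?N c 0" and ?T = "Theta_minus n c'"
  have TSL: "?T \<in> carrier (SL n)" by (rule Theta_minus_SL[OF c'])
  then have T: "?T \<in> carrier_mat ?N ?N" by (rule SL_carrier_mat)
  obtain v where v: "v \<in> unip_plus n" "antilower n (?T * v)"
    and sum_v: "(\<Sum>i<n. v $$ (i, Suc i)) =
      - (\<Sum>p\<in>tri n. coord n c' (fst p - 1) (snd p) / coord n c' (fst p) (snd p - 1))"
    using Suc.IH[OF c'] by blast
  have vc: "v \<in> carrier_mat ?N ?N" using v by (simp add: unip_plus_iff)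
  \<comment> \<open>The last column of \<open>V\<close> is chosen so that its product with \<open>Theta\<close> is a multiple of the first
    unit vector; \<open>r\<close> is what this demands of the corner block.\<close>
  define r where "r = mat ?N 1 (\<lambda>(p,_). (-1) ^ (p + ?N) * ?g (Suc p))"
  have r: "r \<in> carrier_mat ?N 1" by (simp add: r_def)
  define x where "x = inv\<^bsub>SL n\<^esub> ?T * r"
  have Ti: "inv\<^bsub>SL n\<^esub> ?T \<in> carrier_mat ?N ?N" using SL.inv_closed[OF TSL] by (rule SL_carrier_mat)
  have x: "x \<in> carrier_mat ?N 1" unfolding x_def using Ti r by (rule mult_carrier_mat)
  have Tx: "?T * x = r"
    unfolding x_def using assoc_mult_mat[OF T Ti r] SL_mult_inv[OF TSL] r by simp
  have "x $$ (n,0) = (-1) ^ n * (\<Sum>q\<le>n. ((-1) ^ ?N * ?g (Suc q)) / coord n c' 0 q)"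
    by (rule Theta_minus_solve_last[OF c' x]) (simp add: Tx r_def power_add)
  also have "\<dots> = - (\<Sum>q\<le>n. ?g (Suc q) / coord n c' 0 q)"
    by (simp add: sum_negf sum_distrib_left flip: power_mult_distrib mult.assoc)
  also have "\<dots> = - (\<Sum>l\<in>{1..?N}. coord ?N c 0 l / coord ?N c 1 (l - 1))"
  proof -
    have "(\<Sum>q\<le>n. ?g (Suc q) / coord n c' 0 q) = (\<Sum>l\<in>{1..?N}. coord ?N c 0 l / coord n c' 0 (l - 1))"
      by (rule sum.reindex_bij_witness[of _ "\<lambda>l. l - 1" Suc]) auto
    then show ?thesis using Suc.prems by (simp add: coord_Suc c'_def)
  qed
  finally have x_last: "x $$ (n,0) = - (\<Sum>l\<in>{1..?N}. coord ?N c 0 l / coord ?N c 1 (l - 1))" .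
  define V where "V = four_block_mat v x (0\<^sub>m 1 ?N) (1\<^sub>m 1)"
  have Vc: "V \<in> carrier_mat ?M ?M"
    unfolding V_def using four_block_carrier_mat[of v ?N ?N "1\<^sub>m 1" 1 1] vc by simp
  have block_index: "four_block_mat A y (0\<^sub>m 1 ?N) (1\<^sub>m 1) $$ (p,q) =
      (if p \<le> n then if q \<le> n then A $$ (p,q) else y $$ (p,0) else if q \<le> n then 0 else 1)"
    if "p \<le> ?N" "q \<le> ?N" "A \<in> carrier_mat ?N ?N" "y \<in> carrier_mat ?N 1"
    for p q and A y :: "complex mat"
    using that by (auto simp: not_less_eq_eq le_Suc_eq)
  note V_index = block_index[OF _ _ vc x, folded V_def]
  have V: "V \<in> unip_plus ?N"
    using Vc v by (auto simp: unip_plus_iff V_index not_less_eq_eq)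
  let ?B = "four_block_mat (?T * v) r (0\<^sub>m 1 ?N) (1\<^sub>m 1)"
  have Tv: "?T * v \<in> carrier_mat ?N ?N" using T vc by (rule mult_carrier_mat)
  have Bc: "?B \<in> carrier_mat ?M ?M"
    using four_block_carrier_mat[of "?T * v" ?N ?N "1\<^sub>m 1" 1 1] Tv by simp
  have "corner_ext n ?T * V = ?B"
    unfolding corner_ext_def V_def using T vc x r Tx Tv
    by (subst mult_four_block_mat[of _ ?N ?N _ 1 _ 1 _ _ ?N _ 1]) auto
  then have TV: "Theta_minus ?N c * V = bidiag ?N (\<lambda>p. ?g p / ?g (Suc p)) * ?B"
    using Theta_minus_Suc[OF Suc.prems] T Vc
      assoc_mult_mat[of "bidiag ?N (\<lambda>p. ?g p / ?g (Suc p))" ?M ?M "corner_ext n ?T" ?M V ?M]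
    by (simp add: c'_def)
  have g: "?g p \<noteq> 0" for p by (rule coord_nonzero[OF Suc.prems])
  have "antilower ?N (Theta_minus ?N c * V)"
    unfolding antilower_def
  proof (intro allI impI)
    fix i j assume ij: "i \<le> ?N" "j \<le> ?N" "?N < i + j"
    have "(Theta_minus ?N c * V) $$ (i,j) =
        ?g i / ?g (Suc i) * ?B $$ (i,j) + (if i = 0 then 0 else ?B $$ (i - 1, j))"
      unfolding TV using ij Bc by (intro bidiag_mult_index[of _ _ ?M]) auto
    also have "\<dots> = 0"
    proof (cases "j \<le> n")
      case True
      \<comment> \<open>The bidiagonal factor mixes row \<open>i\<close> with row
        \<open>i - 1\<close>, so the zero region moves down by one row, as the antidiagonal does
        when the size grows.\<close>
      have "?B $$ (l,j) = 0" if "l \<le> ?N" "n < l + j" for l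
        using that True v(2) block_index[OF _ _ Tv r, of l j] by (auto simp: antilower_def)
      then show ?thesis using ij by simp
    next
      case False
      then have j: "j = ?N" and i: "0 < i" using ij by auto
      \<comment> \<open>The corner entry 1 fits the formula for \<open>r\<close> at
        \<open>l = ?N\<close>, since the next coordinate is 1 there. Consecutive rows then cancel
        under the bidiagonal factor.\<close>
      have "?B $$ (l,j) = (-1) ^ (l + ?N) * ?g (Suc l)" if "l \<le> ?N" for l
      proof (cases "l \<le> n")
        case True
        then show ?thesis using block_index[OF _ _ Tv r, of l j] j by (simp add: r_def)
      next
        case False
        then have "l = ?N" using that by simp
        then show ?thesis using block_index[OF _ _ Tv r, of l j] j by (simp add: coord_outside flip: power_mult_distrib power_add)
      qed
      then show ?thesis using ij i g[of "Suc i"] by (cases i) auto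
    qed
    finally show "(Theta_minus ?N c * V) $$ (i,j) = 0" .
  qed
  moreover have "(\<Sum>i<?N. V $$ (i, Suc i)) =
      - (\<Sum>p\<in>tri ?N. coord ?N c (fst p - 1) (snd p) / coord ?N c (fst p) (snd p - 1))"
  proof -
    have *: "coord ?N c (fst p) (snd p) / coord ?N c (Suc (fst p)) (snd p - 1) =
        coord n c' (fst p - 1) (snd p) / coord n c' (fst p) (snd p - 1)" if "p \<in> tri n" for p
      using that Suc.prems coord_Suc[of n c "fst p - 1"] coord_Suc[of n c "fst p"]
      by (auto simp: c'_def tri_def)
    have "(\<Sum>i<?N. V $$ (i, Suc i)) = (\<Sum>i<n. v $$ (i, Suc i)) + x $$ (n,0)"
      by (simp add: V_index)
    also have "\<dots> = - (\<Sum>p\<in>tri ?N. coord ?N c (fst p - 1) (snd p) / coord ?N c (fst p) (snd p - 1))"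
      unfolding sum_tri_Suc sum_v x_last using * by simp
    finally show ?thesis .
  qed
  ultimately show ?case using V by blast
qed

section \<open>The unipotent factor for the image of Theta under eta\<close>

lemma sign_conj_corner_ext:
  assumes A: "A \<in> carrier_mat (Suc n) (Suc n)"
  shows "sign_mat (Suc n) * corner_ext n A * sign_mat (Suc n) =
    corner_ext n (sign_mat n * A * sign_mat n)"
proof (rule eq_matI)
  let ?L = "sign_mat (Suc n) * corner_ext n A * sign_mat (Suc n)"
    and ?R = "corner_ext n (sign_mat n * A * sign_mat n)"
  have A': "sign_mat n * A * sign_mat n \<in> carrier_mat (Suc n) (Suc n)"
    by (intro mult_carrier_mat[of _ "Suc n" "Suc n"] sign_mat_carrier A)
  have L: "?L \<in> carrier_mat (Suc (Suc n)) (Suc (Suc n))"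
    by (intro mult_carrier_mat[of _ "Suc (Suc n)" "Suc (Suc n)"] sign_mat_carrier corner_ext_carrier A)
  note d = carrier_matD[OF L] carrier_matD[OF corner_ext_carrier[OF A']]
  show "dim_row ?L = dim_row ?R" "dim_col ?L = dim_col ?R" using d by auto
  fix p q assume "p < dim_row ?R" "q < dim_col ?R"
  then have pq: "p \<le> Suc n" "q \<le> Suc n" using d by auto
  have "?L $$ (p,q) = (-1) ^ (p + q) * corner_ext n A $$ (p,q)"
    using A pq by (intro sign_conj_index) auto
  also have "\<dots> = ?R $$ (p,q)"
  proof (cases "p \<le> n \<and> q \<le> n")
    case True
    then show ?thesis using sign_conj_index[OF A, of p q] pq by (simp add: corner_ext_index[OF A] corner_ext_index[OF A'])
  next
    case False
    then show ?thesis using pq by (auto simp: corner_ext_index[OF A] corner_ext_index[OF A'] power_add simp flip: power_mult_distrib)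
  qed
  finally show "?L $$ (p,q) = ?R $$ (p,q)" .
qed

text \<open>The inverse of \<^const>\<open>bidiag\<close> with the quotients \<open>g p / g (p + 1)\<close> on the diagonal,
  up to the signs introduced by \<^const>\<open>eta_conj\<close>.\<close>

definition quot_lower :: "nat \<Rightarrow> (nat \<Rightarrow> complex) \<Rightarrow> complex mat" where
  "quot_lower n g = mat (Suc n) (Suc n) (\<lambda>(p,q). if q \<le> p then g (Suc p) / g q else 0)"

lemma quot_lower_bidiag:
  assumes g: "\<And>p. g p \<noteq> 0"
  shows "quot_lower n g * (sign_mat n * bidiag n (\<lambda>p. g p / g (Suc p)) * sign_mat n) = 1\<^sub>m (Suc n)"
proof (rule eq_matI)
  let ?N = "Suc n" and ?b = "bidiag n (\<lambda>p. g p / g (Suc p))"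
  let ?B = "sign_mat n * ?b * sign_mat n"
  have Q: "quot_lower n g \<in> carrier_mat ?N ?N" by (simp add: quot_lower_def)
  have B: "?B \<in> carrier_mat ?N ?N"
    by (intro mult_carrier_mat[of _ ?N ?N] sign_mat_carrier bidiag_carrier)
  show "dim_row (quot_lower n g * ?B) = dim_row (1\<^sub>m ?N)" "dim_col (quot_lower n g * ?B) = dim_col (1\<^sub>m ?N)"
    using carrier_matD[OF Q] carrier_matD[OF B] by auto
  fix p q assume "p < dim_row (1\<^sub>m ?N)" "q < dim_col (1\<^sub>m ?N)"
  then have pq: "p \<le> n" "q \<le> n" by auto
  have B_index: "?B $$ (r,q) = (if r = q then g q / g (Suc q) else if r = Suc q then -1 else 0)"
    if "r \<le> n" for r
    using that pq by (subst sign_conj_index) (auto simp: bidiag_def power_add simp flip: power_mult_distrib)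
  have "(quot_lower n g * ?B) $$ (p,q) = (\<Sum>r<?N. quot_lower n g $$ (p,r) * ?B $$ (r,q))"
    using pq Q B by (intro mat_mult_index[of _ ?N _ _ ?N]) auto
  also have "\<dots> = (\<Sum>r\<in>{q} \<union> (if q = n then {} else {Suc q}). quot_lower n g $$ (p,r) * ?B $$ (r,q))"
    using pq by (intro sum.mono_neutral_right) (auto simp: B_index)
  also have "\<dots> = 1\<^sub>m ?N $$ (p,q)"
    using pq g by (auto simp: B_index quot_lower_def)
  finally show "(quot_lower n g * ?B) $$ (p,q) = 1\<^sub>m ?N $$ (p,q)" .
qed

text \<open>An anti-automorphism reverses the factors, so the block of the first letters now stands
  on the right of the corner and next to the unipotent factor.\<close>

lemma eta_conj_Theta_minus_Suc:
  assumes c: "length c = length (word_i0 (Suc n))" "0 \<notin> set c"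
  shows "eta_conj (Suc n) (Theta_minus (Suc n) c) =
    corner_ext n (eta_conj n (Theta_minus n (drop (Suc n) c))) * quot_lower (Suc n) (coord (Suc n) c 0)"
proof (rule eta_conj_eqI)
  let ?N = "Suc n" and ?M = "Suc (Suc n)"
  let ?T = "Theta_minus n (drop ?N c)" and ?g = "coord ?N c 0"
  let ?b = "bidiag ?N (\<lambda>p. ?g p / ?g (Suc p))" and ?Q = "quot_lower ?N ?g"
    and ?J = "sign_mat n" and ?K = "sign_mat ?N"
  have "length (drop ?N c) = length (word_i0 n)" "0 \<notin> set (drop ?N c)"
    using c by (auto dest: in_set_dropD)
  then have TSL: "?T \<in> carrier (SL n)" by (rule Theta_minus_SL)
  then have T: "?T \<in> carrier_mat ?N ?N" by (rule SL_carrier_mat)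
  have E: "eta_conj n ?T \<in> carrier_mat ?N ?N" using eta_conj_SL[OF TSL] by (rule SL_carrier_mat)
  have Q: "?Q \<in> carrier_mat ?M ?M" by (simp add: quot_lower_def)
  have JTJ: "?J * ?T * ?J \<in> carrier_mat ?N ?N"
    by (intro mult_carrier_mat[of _ ?N ?N] sign_mat_carrier T)
  have KbK: "?K * ?b * ?K \<in> carrier_mat ?M ?M"
    by (intro mult_carrier_mat[of _ ?M ?M] sign_mat_carrier bidiag_carrier)
  show "Theta_minus ?N c \<in> carrier (SL ?N)" by (rule Theta_minus_SL[OF c])
  show "corner_ext n (eta_conj n ?T) * ?Q \<in> carrier_mat ?M ?M"
    using corner_ext_carrier[OF E] Q by (rule mult_carrier_mat)
  have ETJ: "eta_conj n ?T * (?J * ?T * ?J) = 1\<^sub>m ?N"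
  proof -
    have i: "inv\<^bsub>SL n\<^esub> ?T \<in> carrier_mat ?N ?N" using SL.inv_closed[OF TSL] by (rule SL_carrier_mat)
    show ?thesis
      unfolding eta_conj_def sign_conj_mult[OF i T, symmetric] SL_inv_mult[OF TSL] by (rule sign_conj_one)
  qed
  have QB: "?Q * (?K * ?b * ?K) = 1\<^sub>m ?M"
    by (rule quot_lower_bidiag) (rule coord_nonzero[OF c])
  have "?K * Theta_minus ?N c * ?K = (?K * ?b * ?K) * corner_ext n (?J * ?T * ?J)"
    unfolding Theta_minus_Suc[OF c]
    by (simp only: sign_conj_mult[OF bidiag_carrier corner_ext_carrier[OF T]] sign_conj_corner_ext[OF T])
  then have "corner_ext n (eta_conj n ?T) * ?Q * (?K * Theta_minus ?N c * ?K) =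
      corner_ext n (eta_conj n ?T) * (?Q * ((?K * ?b * ?K) * corner_ext n (?J * ?T * ?J)))"
    using assoc_mult_mat[OF corner_ext_carrier[OF E] Q mult_carrier_mat[OF KbK corner_ext_carrier[OF JTJ]]]
    by simp
  also have "?Q * ((?K * ?b * ?K) * corner_ext n (?J * ?T * ?J)) =
      (?Q * (?K * ?b * ?K)) * corner_ext n (?J * ?T * ?J)"
    using assoc_mult_mat[OF Q KbK corner_ext_carrier[OF JTJ]] by simp
  also have "\<dots> = corner_ext n (?J * ?T * ?J)"
    unfolding QB by (rule left_mult_one_mat[OF corner_ext_carrier[OF JTJ]])
  also have "corner_ext n (eta_conj n ?T) * \<dots> = 1\<^sub>m ?M"
    by (simp only: corner_ext_mult[OF E JTJ] ETJ corner_ext_one)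
  finally show "corner_ext n (eta_conj n ?T) * ?Q * (?K * Theta_minus ?N c * ?K) = 1\<^sub>m ?M" .
qed

lemma unip_plus_mult:
  assumes u: "u \<in> unip_plus n" and v: "v \<in> unip_plus n"
  shows "u * v \<in> unip_plus n"
proof -
  let ?N = "Suc n"
  have c: "u \<in> carrier_mat ?N ?N" "v \<in> carrier_mat ?N ?N" using u v by (auto simp: unip_plus_iff)
  have index: "(u * v) $$ (i,j) = (\<Sum>r\<in>{i..j}. u $$ (i,r) * v $$ (r,j))" if "i \<le> n" "j \<le> n" for i j
  proof -
    have "(u * v) $$ (i,j) = (\<Sum>r<?N. u $$ (i,r) * v $$ (r,j))"
      using that c by (intro mat_mult_index[of _ ?N _ _ ?N]) auto
    also have "\<dots> = (\<Sum>r\<in>{i..j}. u $$ (i,r) * v $$ (r,j))"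
      using that u v by (intro sum.mono_neutral_right) (auto simp: unip_plus_iff not_le)
    finally show ?thesis .
  qed
  then show ?thesis using c u v by (auto simp: unip_plus_iff index)
qed

text \<open>Here the smaller solution is moved to the lower right corner, which shifts superdiagonal
  indices by one. Hence the hypothesis must hold for all weights \<open>a\<close>; later these are
  the simple roots at \<open>t\<close>.\<close>

lemma eta_conj_Theta_minus_antilower:
  assumes "length c = length (word_i0 n)" "0 \<notin> set c"
  shows "\<exists>v\<in>unip_plus n. antilower n (eta_conj n (Theta_minus n c) * v) \<and>
    (\<forall>a. (\<Sum>i<n. a (Suc i) * v $$ (i, Suc i)) =
      - (\<Sum>p\<in>tri n. a (fst p + snd p - 1) *
          (coord n c (fst p - 1) (snd p - 1) / coord n c (fst p - 1) (snd p))))"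
  using assms
proof (induction n arbitrary: c)
  case 0
  have "tri 0 = {}" by (auto simp: tri_def)
  then show ?case
    by (intro bexI[of _ "1\<^sub>m (Suc 0)"]) (auto simp: antilower_def unip_plus_iff)
next
  case (Suc n)
  let ?N = "Suc n" and ?M = "Suc (Suc n)"
  define c' where "c' = drop ?N c"
  have c': "length c' = length (word_i0 n)" "0 \<notin> set c'"
    using Suc.prems by (auto simp: c'_def dest: in_set_dropD)
  let ?g = "coord ?N c 0" and ?E = "eta_conj n (Theta_minus n c')"
  have E: "?E \<in> carrier_mat ?N ?N"
    using eta_conj_SL[OF Theta_minus_SL[OF c']] by (rule SL_carrier_mat)
  obtain v where v: "v \<in> unip_plus n" "antilower n (?E * v)"
    and sum_v: "\<And>a. (\<Sum>i<n. a (Suc i) * v $$ (i, Suc i)) =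
      - (\<Sum>p\<in>tri n. a (fst p + snd p - 1) *
          (coord n c' (fst p - 1) (snd p - 1) / coord n c' (fst p - 1) (snd p)))"
    using Suc.IH[OF c'] by blast
  have vc: "v \<in> carrier_mat ?N ?N" using v by (simp add: unip_plus_iff)
  have g: "?g p \<noteq> 0" for p by (rule coord_nonzero[OF Suc.prems])
  have g0: "?g 0 = 1" "?g (Suc ?N) = 1" by (simp_all add: coord_outside)
  \<comment> \<open>On and below the diagonal, consecutive columns of \<open>quot_lower\<close> are
    proportional with ratio \<open>?g p / ?g (Suc p)\<close>. Subtracting that multiple of the
    preceding column leaves a single -1, just above the diagonal.\<close>
  define U where "U = mat ?M ?M (\<lambda>(p,q). if p = q then 1 else if q = Suc p then - ?g p / ?g q else 0)"
  \<comment> \<open>Those -1 entries move row \<open>Suc p\<close> to row \<open>p\<close>; placing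
    \<open>v\<close> one step down and right therefore reproduces it, negated, next to the corner
    block, shifted by one column.\<close>
  define P where "P = mat ?M ?M (\<lambda>(p,q). if p = 0 \<or> q = 0 then if p = q then 1 else 0 else v $$ (p - 1, q - 1))"
  have U: "U \<in> unip_plus ?N" and P: "P \<in> unip_plus ?N"
    using v by (auto simp: U_def P_def unip_plus_iff)
  have Uc: "U \<in> carrier_mat ?M ?M" and Pc: "P \<in> carrier_mat ?M ?M" by (auto simp: U_def P_def)
  have UP: "U * P \<in> unip_plus ?N" using U P by (rule unip_plus_mult)
  let ?Q = "quot_lower ?N ?g"
  have Qc: "?Q \<in> carrier_mat ?M ?M" by (simp add: quot_lower_def)
  have QU_index: "(?Q * U) $$ (p,q) = (if q = 0 then ?g (Suc p) else if q = Suc p then -1 else 0)"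
    if pq: "p \<le> ?N" "q \<le> ?N" for p q
  proof -
    have "(?Q * U) $$ (p,q) = (\<Sum>r<?M. ?Q $$ (p,r) * U $$ (r,q))"
      using pq Qc Uc by (intro mat_mult_index[of _ ?M _ _ ?M]) auto
    also have "\<dots> = (\<Sum>r\<in>{q} \<union> (if q = 0 then {} else {q - 1}). ?Q $$ (p,r) * U $$ (r,q))"
      using pq by (intro sum.mono_neutral_right) (auto simp: U_def)
    also have "\<dots> = (if q = 0 then ?g (Suc p) else if q = Suc p then -1 else 0)"
      using pq g by (cases q) (auto simp: U_def quot_lower_def g0)
    finally show ?thesis .
  qed
  have QUc: "?Q * U \<in> carrier_mat ?M ?M" using Qc Uc by (rule mult_carrier_mat)
  have QUP_index: "(?Q * U * P) $$ (p, Suc q) = (if p \<le> n then - v $$ (p,q) else 0)"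
    if pq: "p \<le> ?N" "q \<le> n" for p q
  proof -
    have "(?Q * U * P) $$ (p, Suc q) = (\<Sum>r<?M. (?Q * U) $$ (p,r) * P $$ (r, Suc q))"
      using pq QUc Pc by (intro mat_mult_index[of _ ?M _ _ ?M]) auto
    also have "\<dots> = (\<Sum>r\<in>(if p \<le> n then {Suc p} else {}). (?Q * U) $$ (p,r) * P $$ (r, Suc q))"
      using pq by (intro sum.mono_neutral_right) (auto simp: QU_index P_def)
    also have "\<dots> = (if p \<le> n then - v $$ (p,q) else 0)"
      using pq by (simp add: QU_index P_def)
    finally show ?thesis .
  qed
  have QUPc: "?Q * U * P \<in> carrier_mat ?M ?M" using QUc Pc by (rule mult_carrier_mat)
  have "eta_conj ?N (Theta_minus ?N c) * (U * P) = corner_ext n ?E * (?Q * U * P)"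
    unfolding eta_conj_Theta_minus_Suc[OF Suc.prems, folded c'_def]
    using assoc_mult_mat[OF corner_ext_carrier[OF E] Qc mult_carrier_mat[OF Uc Pc]]
      assoc_mult_mat[OF Qc Uc Pc] by simp
  have "antilower ?N (eta_conj ?N (Theta_minus ?N c) * (U * P))"
    unfolding antilower_def \<open>_ = corner_ext n ?E * (?Q * U * P)\<close>
  proof (intro allI impI)
    fix i j assume ij: "i \<le> ?N" "j \<le> ?N" "?N < i + j"
    then obtain l where l: "j = Suc l" "l \<le> n" by (cases j) auto
    have "(corner_ext n ?E * (?Q * U * P)) $$ (i,j) =
        (\<Sum>r<?M. corner_ext n ?E $$ (i,r) * (?Q * U * P) $$ (r,j))"
      using ij QUPc corner_ext_carrier[OF E] by (intro mat_mult_index[of _ ?M _ _ ?M]) auto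
    also have "\<dots> = (\<Sum>r<?N. corner_ext n ?E $$ (i,r) * (?Q * U * P) $$ (r,j))"
      using QUP_index[of ?N l] l by simp
    also have "\<dots> = (\<Sum>r<?N. (if i \<le> n then - (?E $$ (i,r) * v $$ (r,l)) else 0))"
      using ij l by (intro sum.cong) (auto simp: corner_ext_index[OF E] QUP_index)
    also have "\<dots> = (if i \<le> n then - (?E * v) $$ (i,l) else 0)"
      using mat_mult_index[OF E vc, of i l] l by (simp add: sum_negf)
    also have "\<dots> = 0" using v(2) ij l by (auto simp: antilower_def)
    finally show "(corner_ext n ?E * (?Q * U * P)) $$ (i,j) = 0" .
  qed
  moreover have "(\<Sum>i<?N. a (Suc i) * (U * P) $$ (i, Suc i)) =
      - (\<Sum>p\<in>tri ?N. a (fst p + snd p - 1) *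
          (coord ?N c (fst p - 1) (snd p - 1) / coord ?N c (fst p - 1) (snd p)))" for a
  proof -
    have UP_index: "(U * P) $$ (i, Suc i) = - (?g i / ?g (Suc i)) + (if i = 0 then 0 else v $$ (i - 1, i))"
      if "i < ?N" for i
      using superdiag_mult[OF U P that] that by (simp add: U_def P_def)
    have "(\<Sum>i<?N. a (Suc i) * (U * P) $$ (i, Suc i)) =
        (\<Sum>i<?N. - (a (Suc i) * (?g i / ?g (Suc i)))) + (\<Sum>i<?N. if i = 0 then 0 else a (Suc i) * v $$ (i - 1, i))"
      unfolding sum.distrib[symmetric] by (intro sum.cong) (simp_all add: UP_index distrib_left right_diff_distrib)
    also have "(\<Sum>i<?N. if i = 0 then 0 else a (Suc i) * v $$ (i - 1, i)) =
        (\<Sum>i<n. a (Suc (Suc i)) * v $$ (i, Suc i))"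
      by (simp only: sum.lessThan_Suc_shift) simp
    also have "\<dots> = - (\<Sum>p\<in>tri n. a (Suc (fst p + snd p - 1)) *
          (coord n c' (fst p - 1) (snd p - 1) / coord n c' (fst p - 1) (snd p)))"
      using sum_v[of "\<lambda>i. a (Suc i)"] .
    also have "\<dots> = - (\<Sum>p\<in>tri n. a (Suc (fst p) + snd p - 1) *
          (coord ?N c (Suc (fst p) - 1) (snd p - 1) / coord ?N c (Suc (fst p) - 1) (snd p)))"
    proof (intro arg_cong[of _ _ uminus] sum.cong refl)
      fix p assume "p \<in> tri n"
      then obtain k l where "p = (Suc k, Suc l)" by (cases p; cases "fst p"; cases "snd p") (auto simp: tri_def)
      then show "a (Suc (fst p + snd p - 1)) *
          (coord n c' (fst p - 1) (snd p - 1) / coord n c' (fst p - 1) (snd p)) =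
          a (Suc (fst p) + snd p - 1) *
          (coord ?N c (Suc (fst p) - 1) (snd p - 1) / coord ?N c (Suc (fst p) - 1) (snd p))"
        using Suc.prems by (simp add: c'_def coord_Suc)
    qed
    also have "(\<Sum>i<?N. - (a (Suc i) * (?g i / ?g (Suc i)))) =
        - (\<Sum>l\<in>{1..?N}. a l * (?g (l - 1) / ?g l))"
      unfolding sum_negf
      by (intro arg_cong[of _ _ uminus] sum.reindex_bij_witness[of _ "\<lambda>l. l - 1" Suc]) auto
    finally show ?thesis by (simp add: sum_tri_Suc)
  qed
  ultimately show ?case using UP by blast
qed

text \<open>In the first summand \<open>t\<close> multiplies from the left, which merely rescales
  rows and keeps the same unipotent factor; so that summand is free of \<open>t\<close>. In the
  second, eta puts the inverse of \<open>t\<close> on the right, and the roots appear.\<close>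

lemma f_B_torus_Theta_minus:
  assumes t: "t \<in> torus n" and c: "length c = length (word_i0 n)" "0 \<notin> set c"
  shows "f_B n (t * Theta_minus n c) =
    (\<Sum>p\<in>tri n. coord n c (fst p - 1) (snd p) / coord n c (fst p) (snd p - 1) +
       root_char (fst p + snd p - 1) t *
       (coord n c (fst p - 1) (snd p - 1) / coord n c (fst p - 1) (snd p)))"
proof -
  let ?N = "Suc n" and ?T = "Theta_minus n c" and ?W = "inv\<^bsub>SL n\<^esub> (w0_bar n)"
  let ?E = "eta_conj n ?T" and ?ti = "inv\<^bsub>SL n\<^esub> t"
  have TSL: "?T \<in> carrier (SL n)" by (rule Theta_minus_SL[OF c])
  have ESL: "?E \<in> carrier (SL n)" by (rule eta_conj_SL[OF TSL])
  have tSL: "t \<in> carrier (SL n)" "?ti \<in> carrier (SL n)" using t by (auto simp: torus_SL)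
  note carrier = SL_carrier_mat[OF TSL] SL_carrier_mat[OF ESL] SL_carrier_mat[OF tSL(1)] SL_carrier_mat[OF tSL(2)]
  let ?d = "\<lambda>p. t $$ (p,p)"
  have t_eq: "t = mat_diag ?N ?d" by (rule torus_eq_mat_diag[OF t])
  have ti_eq: "?ti = mat_diag ?N (\<lambda>p. inverse (?d p))" by (rule torus_inv[OF t])
  obtain v where v: "v \<in> unip_plus n" "antilower n (?T * v)"
    "(\<Sum>i<n. v $$ (i, Suc i)) =
      - (\<Sum>p\<in>tri n. coord n c (fst p - 1) (snd p) / coord n c (fst p) (snd p - 1))"
    using Theta_minus_antilower[OF c] by blast
  obtain w where w: "w \<in> unip_plus n" "antilower n (?E * w)"
    and sum_w: "\<And>a. (\<Sum>i<n. a (Suc i) * w $$ (i, Suc i)) =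
      - (\<Sum>p\<in>tri n. a (fst p + snd p - 1) *
          (coord n c (fst p - 1) (snd p - 1) / coord n c (fst p - 1) (snd p)))"
    using eta_conj_Theta_minus_antilower[OF c] by blast
  have vc: "v \<in> carrier_mat ?N ?N" and wc: "w \<in> carrier_mat ?N ?N" using v w by (auto simp: unip_plus_iff)
  have left: "antilower n (t * A)" if "antilower n A" "A \<in> carrier_mat ?N ?N" for A
    using that by (subst t_eq) (auto simp: antilower_def mat_diag_mult_left[of _ _ ?N])
  have right: "antilower n (A * ?ti)" if "antilower n A" "A \<in> carrier_mat ?N ?N" for A
    using that by (subst ti_eq) (auto simp: antilower_def mat_diag_mult_right[of _ ?N])
  have "antilower n (t * ?T * v)"
    using left[OF v(2) mult_carrier_mat[OF carrier(1) vc]] assoc_mult_mat[OF carrier(3,1) vc] by simp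
  then have 1: "chi_st n (pi_plus n (?W * (t * ?T))) = - (\<Sum>i<n. v $$ (i, Suc i))"
    using SL_mult_closed[OF tSL(1) TSL] v(1) by (intro chi_st_pi_plus_antilower)
  \<comment> \<open>Conjugating \<open>w\<close> by \<open>t\<close> absorbs the inverse of
    \<open>t\<close> standing before it; the superdiagonal entries get scaled by the simple roots at
    \<open>t\<close>.\<close>
  define w' where "w' = t * (w * ?ti)"
  have w'_index: "w' $$ (p,q) = ?d p * inverse (?d q) * w $$ (p,q)" if "p \<le> n" "q \<le> n" for p q
    unfolding w'_def ti_eq using that wc
    by (subst t_eq) (auto simp: mat_diag_mult_left[of _ _ ?N] mat_diag_mult_right[of _ ?N])
  have w'c: "w' \<in> carrier_mat ?N ?N" unfolding w'_def
    by (intro mult_carrier_mat[of _ ?N ?N] carrier wc)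
  have w': "w' \<in> unip_plus n"
    using w'c w(1) torus_diag_nonzero[OF t] by (auto simp: unip_plus_iff w'_index)
  have "(?E * ?ti) * w' = ?E * ((?ti * t) * (w * ?ti))"
    unfolding w'_def using carrier wc
    by (simp add: assoc_mult_mat[of _ ?N ?N _ ?N _ ?N] mult_carrier_mat[of _ ?N ?N])
  also have "\<dots> = (?E * w) * ?ti"
    using carrier wc SL_inv_mult[OF tSL(1)] assoc_mult_mat[OF carrier(2) wc carrier(4)]
      left_mult_one_mat[OF mult_carrier_mat[OF wc carrier(4)]] by simp
  finally have "antilower n (?E * ?ti * w')"
    using right[OF w(2) mult_carrier_mat[OF carrier(2) wc]] by simp
  then have 2: "chi_st n (pi_plus n (?W * (?E * ?ti))) = - (\<Sum>i<n. w' $$ (i, Suc i))"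
    using SL_mult_closed[OF ESL tSL(2)] w' by (intro chi_st_pi_plus_antilower)
  have "(\<Sum>i<n. w' $$ (i, Suc i)) = (\<Sum>i<n. root_char (Suc i) t * w $$ (i, Suc i))"
    by (intro sum.cong) (auto simp: w'_index root_char_def divide_inverse)
  then show ?thesis
    unfolding f_B_def eta_torus_Theta[OF t c] 1 2
    using v(3) sum_w[of "\<lambda>i. root_char i t"] by (simp add: sum.distrib)
qed

section \<open>The decoration as a subtraction-free expression\<close>

definition coord_expr :: "nat \<Rightarrow> nat \<Rightarrow> nat \<Rightarrow> param sfree" where
  "coord_expr n k p = (if (Suc k, p) \<in> tri n then Var (Coord (word_pos n (Suc k, p))) else Unit)"

definition decoration_term :: "nat \<Rightarrow> nat \<times> nat \<Rightarrow> param sfree" where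
  "decoration_term n p =
    Add (Div (coord_expr n (fst p - 1) (snd p)) (coord_expr n (fst p) (snd p - 1)))
      (Mul (Var (Root (fst p + snd p - 1)))
        (Div (coord_expr n (fst p - 1) (snd p - 1)) (coord_expr n (fst p - 1) (snd p))))"

text \<open>\<open>Unit\<close> evaluates to 1 and ultra-discretizes to 0, so the same expression
  meets the boundary conventions of \<open>coord\<close> and of \<open>family_of\<close>.\<close>

lemma sf_eval_coord_expr: "sf_eval (param_val a c) (coord_expr n k p) = coord n c k p"
  by (simp add: coord_expr_def coord_def)

lemma sf_ud_coord_expr: "sf_ud (param_val a x) (coord_expr n k p) = family_of n x (Suc k, p)"
  by (simp add: coord_expr_def family_of_def)

lemma set_coord_expr: "set_sfree (coord_expr n k p) \<subseteq> Coord ` {..<length (word_i0 n)}"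
  by (auto simp: coord_expr_def word_pos_less)

lemma set_decoration_term:
  assumes "p \<in> tri n"
  shows "set_sfree (decoration_term n p) \<subseteq> Root ` {1..n} \<union> Coord ` {..<length (word_i0 n)}"
proof -
  have "fst p + snd p - 1 \<in> {1..n}" using assms by (auto simp: tri_def)
  then show ?thesis using set_coord_expr by (fastforce simp: decoration_term_def)
qed

lemma UD_f_B_nonneg_iff:
  assumes n: "n \<ge> 1" and x: "length x = length (word_i0 n)"
  shows "UD_f_B n lam x \<ge> 0 \<longleftrightarrow>
    (\<forall>p\<in>tri n. sf_ud (param_val lam x) (decoration_term n p) \<ge> 0)"
proof -
  have "finite (tri n)" using tri_subset by (rule finite_subset) auto
  then obtain ps where ps: "set ps = tri n" "distinct ps" using finite_distinct_list by blast
  \<comment> \<open>A nonempty triangle supplies the head that \<open>sf_sum\<close>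
    requires.\<close>
  have "(1,1) \<in> tri n" using n by (simp add: tri_def)
  then obtain q qs where qs: "ps = q # qs" using ps by (cases ps) auto
  let ?F = "sf_sum (decoration_term n q) (map (decoration_term n) qs)"
  have F_set: "set (decoration_term n q # map (decoration_term n) qs) = decoration_term n ` tri n"
    using ps by (simp add: qs flip: ps(1))
  have "represents_f_B n ?F"
    unfolding represents_f_B_def
  proof (intro conjI ballI allI impI)
    show "set_sfree ?F \<subseteq> Root ` {1..n} \<union> Coord ` {..<length (word_i0 n)}"
      unfolding set_sf_sum F_set using set_decoration_term by blast
    fix t c assume t: "t \<in> torus n" and c: "length c = length (word_i0 n)" "(0::complex) \<notin> set c"
    let ?\<rho> = "param_val (\<lambda>j. root_char j t) c"
    have "sf_eval ?\<rho> ?F = (\<Sum>p\<leftarrow>ps. sf_eval ?\<rho> (decoration_term n p))"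
      by (simp add: sf_eval_sf_sum qs comp_def)
    also have "\<dots> = (\<Sum>p\<in>tri n. sf_eval ?\<rho> (decoration_term n p))"
      using ps by (simp add: sum_list_distinct_conv_sum_set)
    also have "\<dots> = f_B n (t * Theta_minus n c)"
      unfolding f_B_torus_Theta_minus[OF t c]
      by (simp add: decoration_term_def sf_eval_coord_expr)
    finally show "f_B n (t * Theta_minus n c) = sf_eval ?\<rho> ?F" by simp
  qed
  then have "UD_f_B n lam x = sf_ud (param_val lam x) ?F" by (rule UD_f_B_eq[OF _ x])
  then show ?thesis unfolding sf_ud_sf_sum_nonneg F_set \<open>UD_f_B n lam x = _\<close> by simp
qed

text \<open>The zeros in column 0 let the terms at \<open>(j,1)\<close> yield the one-variable
  inequalities, 0 <= x_{j;1} and x_{j;1} <= lambda_j.\<close>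

lemma B_set_eq:
  assumes "n \<ge> 1"
  shows "B_set n lam = {x. length x = length (word_i0 n) \<and> family_of n x \<in> Sigma_set n lam}"
proof -
  have "UD_f_B n lam x \<ge> 0 \<longleftrightarrow> family_of n x \<in> Sigma_set n lam"
    if x: "length x = length (word_i0 n)" for x
  proof -
    let ?y = "family_of n x"
    have "UD_f_B n lam x \<ge> 0 \<longleftrightarrow> (\<forall>(j,i)\<in>tri n. ?y (Suc j, i - 1) \<le> ?y (j,i) \<and>
        ?y (j,i) - ?y (j, i - 1) \<le> lam (i + j - 1))"
      unfolding UD_f_B_nonneg_iff[OF assms x]
      by (intro ball_cong refl)
        (auto simp: decoration_term_def sf_ud_coord_expr tri_def add.commute)
    also have "\<dots> \<longleftrightarrow> ?y \<in> Sigma_set n lam"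
    proof
      assume "?y \<in> Sigma_set n lam"
      from Sigma_setD(2,3)[OF this]
      show "\<forall>(j,i)\<in>tri n. ?y (Suc j, i - 1) \<le> ?y (j,i) \<and> ?y (j,i) - ?y (j, i - 1) \<le> lam (i + j - 1)"
        by (auto simp: tri_def)
    next
      assume *: "\<forall>(j,i)\<in>tri n. ?y (Suc j, i - 1) \<le> ?y (j,i) \<and> ?y (j,i) - ?y (j, i - 1) \<le> lam (i + j - 1)"
      show "?y \<in> Sigma_set n lam"
      proof (rule Sigma_setI)
        show "?y p = 0" if "p \<notin> tri n" for p using that by (simp add: family_of_def)
        fix j i :: nat assume "1 \<le> j" "1 \<le> i" "i + j \<le> n + 1"
        then have "(j,i) \<in> tri n" by (simp add: tri_def add.commute)
        with * show "?y (Suc j, i - 1) \<le> ?y (j,i)" "?y (j,i) - ?y (j, i - 1) \<le> lam (i + j - 1)"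
          by blast+
      qed
    qed
    finally show ?thesis .
  qed
  then show ?thesis by (auto simp: B_set_def)
qed

theorem theorem5p2:
  fixes n :: nat and lam :: "nat \<Rightarrow> int"
  assumes "n \<ge> 1"
    and "\<forall>i\<in>{1..n}. lam i \<ge> 0"
  shows "crystal_isomorphic {1..n} (B_crystal n lam) (Sigma_crystal n lam)"
  unfolding crystal_isomorphic_def
  using crystal_isomorphism_family_of[OF B_set_eq[OF assms(1)]] by blast

end
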